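(* Let $x$ be an oscillatory solution of $$x''(t)+p(t)x(t-\tau(t))=0,\qquad t\ge s,$$ where $\operatorname{ess\,sup}_{t\in\mathbb{R}}|p(t)|\le 1$. If $\tau_m>0$, assume that the semicycles of $x$ satisfy $$x(t)\neq 0 \text{ for all } t\in(a,b)\ \Longrightarrow\ b-a\le \Psi(1,\tau_m)+\vartheta_{\tau_m},$$ and if $\tau_m=0$, assume that $$x(t)\neq 0 \text{ for all } t\in(a,b)\ \Longrightarrow\ b-a<\pi .$$ Then $x$ is bounded. If, further, there is a real constant $c\in(0,\Psi(1,\tau_m)+\vartheta_{\tau_m})$ such that $$x(t)\neq 0 \text{ for all } t\in(a,b)\ \Longrightarrow\ \Psi(1,\tau_m)+\vartheta_{\tau_m}>c>b-a,$$ then $x(t)\to 0$ as $t\to+\infty$.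
   Context: Equation and solutions. $\tau:\mathbb{R}\to[0,+\infty)$ and $p:\mathbb{R}\to\mathbb{R}$ are Lebesgue measurable and essentially bounded ($p$ may change sign). $\tau_m:=\operatorname{ess\,sup}\{\tau(t):t\ge s\}$. A solution on $[s,+\infty)$ is a function $x:[s-\tau_m,+\infty)\to\mathbb{R}$, absolutely continuous together with its first derivative, satisfying the equation a.e. on $[s,+\infty)$. A function is oscillatory if it has arbitrarily large zeros. A semicycle is an interval between adjacent zeros of an oscillatory solution. The function $r_\Delta$ and the number $\vartheta_\Delta$. For $\Delta\ge 0$, $r_\Delta:\mathbb{R}\to\mathbb{R}$ is the solution of $r_\Delta''(t)+r_\Delta(t-\Delta)=0$ for $t\ge 0$, with $r_\Delta(t)=1$ for $t\le 0$ and $r_\Delta'(0)=0$. $\vartheta_\Delta>0$ denotes its first zero (it is known that $r_\Delta$ is strictly decreasing on $[0,\vartheta_\Delta]$ and that $\vartheta_\Delta\geq\sqrt2$ is continuous in $\Delta$; for $\Delta=0$, $r_0=\cos$ on $[0,+\infty)$ and $\vartheta_0=\pi/2$). The number $\Psi(\rho,\Delta)$. Let $\chi_S$ be the characteristic function of $S\subset\mathbb{R}$. For $\Delta\in[0,+\infty)$, $\rho\in(0,+\infty)$ set $\beta_0(t)\equiv 1$ for $t\le 0$ and, for $n=0,1,2,\dots$, let $\varpi_n\in(0,+\infty)$ be the unique number with $$\int_{-\varpi_n}^{0}\Big[\int_{-\varpi_n}^{u}\max\{\beta_n(v),\rho\, r_\Delta(\vartheta_\Delta-v-\Delta)\chi_{[-\Delta,0]}(v)\}\,dv\Big]du=1,$$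 and put $\beta_{n+1}(t)=1$ for $t\le-\varpi_n$ and $$\beta_{n+1}(t)=1-\int_{-\varpi_n}^{t}\Big[\int_{-\varpi_n}^{u}\max\{\beta_n(v),\rho\, r_\Delta(\vartheta_\Delta-v-\Delta)\chi_{[-\Delta,0]}(v)\}\,dv\Big]du,\qquad t\in[-\varpi_n,0].$$ The sequence $\varpi_n$ is well-defined, nondecreasing and bounded, and $\Psi(\rho,\Delta):=\lim_{n\to\infty}\varpi_n$. *)

theory Defs
  imports "HOL-Analysis.Analysis" "HOL-Probability.Essential_Supremum"
begin

text \<open>
  Absolute continuity on an interval \<open>S\<close>: the usual epsilon-delta condition over finite families
  \<open>d\<close> of nonoverlapping compact subintervals \<open>k = [Inf k, Sup k]\<close> of \<open>S\<close>.
\<close>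

definition abs_cont_on :: "real set \<Rightarrow> (real \<Rightarrow> real) \<Rightarrow> bool" where
  "abs_cont_on S f \<longleftrightarrow>
     (\<forall>\<epsilon>>0. \<exists>\<delta>>0. \<forall>d T. d division_of T \<longrightarrow> T \<subseteq> S \<longrightarrow> (\<Sum>k\<in>d. Sup k - Inf k) < \<delta> \<longrightarrow>
        (\<Sum>k\<in>d. \<bar>f (Sup k) - f (Inf k)\<bar>) < \<epsilon>)"

text \<open>On a half-line, absolute continuity is understood on every compact subinterval.\<close>

definition abs_cont_from :: "real \<Rightarrow> (real \<Rightarrow> real) \<Rightarrow> bool" where
  "abs_cont_from a f \<longleftrightarrow> (\<forall>b. abs_cont_on {a..b} f)"

text \<open>
  \<^const>\<open>esssup\<close> lives in a complete linear order, hence the detour through the extended reals; it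
  is finite whenever the delay is essentially bounded.
\<close>

definition tau_max :: "(real \<Rightarrow> real) \<Rightarrow> real \<Rightarrow> real" where
  "tau_max \<tau> s = real_of_ereal (esssup (lebesgue_on {s..}) (\<lambda>t. ereal (\<tau> t)))"

text \<open>
  A solution is a function on \<open>[s - \<tau>\<^sub>m, \<infinity>)\<close>; the values of the total function \<open>x\<close> to the left of
  that half-line are irrelevant. The derivative at the left endpoint is one-sided.
\<close>

definition is_solution ::
  "(real \<Rightarrow> real) \<Rightarrow> (real \<Rightarrow> real) \<Rightarrow> real \<Rightarrow> (real \<Rightarrow> real) \<Rightarrow> bool" where
  "is_solution p \<tau> s x \<longleftrightarrow>
     (let a = s - tau_max \<tau> s in
      abs_cont_from a x \<and>
      (\<exists>x'. (\<forall>t\<ge>a. (x has_real_derivative x' t) (at t within {a..})) \<and>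
            abs_cont_from a x' \<and>
            (AE t in lebesgue_on {s..}.
               \<exists>x''. (x' has_real_derivative x'') (at t) \<and> x'' + p t * x (t - \<tau> t) = 0)))"

definition oscillatory :: "(real \<Rightarrow> real) \<Rightarrow> bool" where
  "oscillatory x \<longleftrightarrow> (\<forall>T. \<exists>t\<ge>T. x t = 0)"

text \<open>\<open>(a, b)\<close> is a semicycle of the function \<open>x\<close> with domain \<open>S\<close>.\<close>

definition semicycle :: "real set \<Rightarrow> (real \<Rightarrow> real) \<Rightarrow> real \<Rightarrow> real \<Rightarrow> bool" where
  "semicycle S x a b \<longleftrightarrow>
     a < b \<and> {a..b} \<subseteq> S \<and> x a = 0 \<and> x b = 0 \<and> (\<forall>t\<in>{a<..<b}. x t \<noteq> 0)"

text \<open>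
  The equation for \<open>r\<^sub>\<Delta>\<close> has a continuous right-hand side, so it holds everywhere on \<open>[0, \<infinity>)\<close>;
  at \<open>0\<close> the second derivative is the right-hand one (the left-hand one is \<open>0\<close>).
\<close>

definition r_fun :: "real \<Rightarrow> real \<Rightarrow> real" where
  "r_fun \<Delta> = (THE f. (\<forall>t\<le>0. f t = 1) \<and>
     (\<exists>f'. f' 0 = 0 \<and>
       (\<forall>t\<ge>0. (f has_real_derivative f' t) (at t within {0..})) \<and>
       (\<forall>t\<ge>0. \<exists>f''. (f' has_real_derivative f'') (at t within {0..}) \<and>
                     f'' + f (t - \<Delta>) = 0)))"

definition vartheta :: "real \<Rightarrow> real" where
  "vartheta \<Delta> = (LEAST t. 0 < t \<and> r_fun \<Delta> t = 0)"

definition Psi_kernel :: "real \<Rightarrow> real \<Rightarrow> (real \<Rightarrow> real) \<Rightarrow> real \<Rightarrow> real" where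
  "Psi_kernel \<rho> \<Delta> \<beta> v = max (\<beta> v) (\<rho> * r_fun \<Delta> (vartheta \<Delta> - v - \<Delta>) * indicator {-\<Delta>..0} v)"

definition varpi_of :: "real \<Rightarrow> real \<Rightarrow> (real \<Rightarrow> real) \<Rightarrow> real" where
  "varpi_of \<rho> \<Delta> \<beta> =
     (THE w. 0 < w \<and> integral {-w..0} (\<lambda>u. integral {-w..u} (Psi_kernel \<rho> \<Delta> \<beta>)) = 1)"

text \<open>The functions \<open>\<beta>\<^sub>n\<close> only matter on \<open>(-\<infinity>, 0]\<close>.\<close>

primrec beta_seq :: "real \<Rightarrow> real \<Rightarrow> nat \<Rightarrow> real \<Rightarrow> real" where
  "beta_seq \<rho> \<Delta> 0 = (\<lambda>t. 1)"
| "beta_seq \<rho> \<Delta> (Suc n) =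
     (let \<beta> = beta_seq \<rho> \<Delta> n; w = varpi_of \<rho> \<Delta> \<beta> in
      (\<lambda>t. if t \<le> -w then 1
           else 1 - integral {-w..t} (\<lambda>u. integral {-w..u} (Psi_kernel \<rho> \<Delta> \<beta>))))"

definition varpi :: "real \<Rightarrow> real \<Rightarrow> nat \<Rightarrow> real" where
  "varpi \<rho> \<Delta> n = varpi_of \<rho> \<Delta> (beta_seq \<rho> \<Delta> n)"

definition Psi :: "real \<Rightarrow> real \<Rightarrow> real" where
  "Psi \<rho> \<Delta> = lim (varpi \<rho> \<Delta>)"

end

theory Submission
  imports Defs
begin

text \<open>
  Since \<open>\<bar>p\<bar> \<le> 1\<close>, the only information used about the equation is \<open>\<bar>x''(t)\<bar> \<le> \<bar>x(u)\<bar>\<close> for some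
  \<open>u \<in> [t - \<tau>\<^sub>m, t]\<close>. If a bound \<open>k\<close> for the past is known and \<open>Q'' = - k\<close>, then \<open>x - Q\<close> is convex, so
  \<open>x \<le> Q\<close> on an interval as soon as this holds at its two ends. Iterating this comparison shows that
  \<open>\<bar>x\<bar> \<le> S\<close> up to a zero \<open>a\<close> implies \<open>\<bar>x(a - u)\<bar> \<le> S r(\<vartheta> - u)\<close>, and that on the semicycle starting at
  \<open>a\<close> one has \<open>x(a + \<sigma>) \<le> M \<beta>\<^sub>n(-\<sigma>)\<close> for all \<open>n\<close>, where \<open>M \<ge> S\<close> bounds \<open>x\<close> there. Hence a semicycle on
  which \<open>\<bar>x\<bar>\<close> attains \<open>M \<ge> S\<close> needs at least the time \<open>\<Psi>(1, \<tau>\<^sub>m)\<close> to rise and \<open>\<vartheta>\<close> to fall. When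
  \<open>M > S\<close>, the past before \<open>a\<close> is strictly below the barrier and the rise takes longer than \<open>\<Psi>\<close>, so a
  semicycle of length at most \<open>\<Psi> + \<vartheta>\<close> cannot exceed an earlier bound. When all lengths are below
  \<open>c < \<Psi> + \<vartheta>\<close>, the same two estimates show that the bound shrinks by a fixed factor \<open>q < 1\<close> each
  time. For \<open>\<tau>\<^sub>m = 0\<close> a comparison with a cosine shows that there is no semicycle shorter than \<open>\<pi>\<close>.
\<close>

section \<open>Absolutely continuous derivatives and convex barriers\<close>

text \<open>Two obstacles shape the proof. Every comparison is circular: the delayed value that
  controls x'' is among the values being estimated. Before a zero the circle is broken by an
  additive error which each comparison multiplies by \<vartheta>^2 / 8; the bound \<vartheta>^2
  \<le> 3 sends it to 0. After a zero it is broken by starting from the constant bound M, and the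
  successive improvements are exactly the functions \<open>beta_seq\<close>. The second obstacle is
  the non-strict hypothesis b - a \<le> \<Psi> + \<vartheta>: the barriers show that a rise takes at
  least every \<open>varpi\<close>, hence at least \<Psi>, and strictness is lost in the limit. So a
  gain uniform in n is extracted; it keeps x below a line of positive slope through its maximum,
  where x' = 0. Beneath all this, x'' exists only almost everywhere, so monotonicity of x' - Q' has
  to come from absolute continuity.\<close>

lemma abs_cont_on_increase_bound:
  fixes f :: "real \<Rightarrow> real"
  assumes ac: "abs_cont_on {a..b} f" and ab: "a \<le> b" and N: "negligible N"
    and der: "\<And>t. t \<in> {a..b} - N \<Longrightarrow> \<exists>D\<ge>0. (f has_real_derivative D) (at t within {a..b})"
    and \<epsilon>: "\<epsilon> > 0"
  shows "- \<epsilon> * (b - a) - \<epsilon> \<le> f b - f a"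
proof -
  \<comment> \<open>Henstock argument: the intervals of a fine division tagged in \<open>N\<close>
    lie in an open set of measure below \<open>\<delta>\<close>, so absolute continuity bounds the
    change of \<open>f\<close> over them by \<open>\<epsilon>\<close>; an interval tagged outside
    \<open>N\<close> loses at most \<open>\<epsilon>\<close> times its length.\<close>
  obtain \<delta> where \<delta>: "\<delta> > 0"
    and small: "\<And>d T. \<lbrakk>d division_of T; T \<subseteq> {a..b}; (\<Sum>k\<in>d. Sup k - Inf k) < \<delta>\<rbrakk>
      \<Longrightarrow> (\<Sum>k\<in>d. \<bar>f (Sup k) - f (Inf k)\<bar>) < \<epsilon>"
    using ac \<epsilon> unfolding abs_cont_on_def by metis
  obtain U where U: "open U" "N \<subseteq> U" "U \<in> lmeasurable" "measure lebesgue U < \<delta>"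
  proof -
    have "N \<in> sets lebesgue"
      using N by (simp add: negligible_imp_sets)
    then obtain U where U: "open U" "N \<subseteq> U" "U - N \<in> lmeasurable" "emeasure lebesgue (U - N) < ennreal \<delta>"
      using sets_lebesgue_outer_open \<delta> by blast
    have null: "N \<in> null_sets lebesgue"
      using N by (simp add: negligible_iff_null_sets)
    have eq: "U = (U - N) \<union> N"
      using U(2) by blast
    have "U \<in> lmeasurable"
      using U(3) null eq by (metis fmeasurable.Un fmeasurableI_null_sets)
    moreover have "measure lebesgue U = measure lebesgue (U - N)"
      using measure_Un_null_set[OF fmeasurableD[OF U(3)] null] eq by simp
    moreover have "measure lebesgue (U - N) < \<delta>"
      using U(4) \<delta> emeasure_eq_measure2[OF U(3)] by (simp add: ennreal_less_iff)
    ultimately show ?thesis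
      using that[of U] U by simp
  qed
  have straddle: "\<exists>r>0. \<forall>u v. u \<le> t \<and> t \<le> v \<and> {u..v} \<subseteq> {a..b} \<and> {u..v} \<subseteq> ball t r
      \<longrightarrow> - \<epsilon> * (v - u) \<le> f v - f u" if t: "t \<in> {a..b} - N" for t
  proof -
    obtain D where D: "D \<ge> 0" "(f has_real_derivative D) (at t within {a..b})"
      using der[OF t] by blast
    then have "(f has_derivative (*) D) (at t within {a..b})"
      by (simp add: has_field_derivative_def)
    then obtain r where r: "r > 0"
      and rb: "\<And>y. y \<in> {a..b} \<Longrightarrow> norm (y - t) < r \<Longrightarrow>
          norm (f y - f t - D * (y - t)) \<le> \<epsilon> * norm (y - t)"
      using \<epsilon> unfolding has_derivative_within_alt by blast
    have "- \<epsilon> * (v - u) \<le> f v - f u"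
      if h: "u \<le> t" "t \<le> v" "{u..v} \<subseteq> {a..b}" "{u..v} \<subseteq> ball t r" for u v
    proof -
      have "u \<in> {u..v}" "v \<in> {u..v}"
        using h by auto
      then have in': "u \<in> {a..b}" "v \<in> {a..b}" "u \<in> ball t r" "v \<in> ball t r"
        using h by blast+
      have 1: "\<bar>f v - f t - D * (v - t)\<bar> \<le> \<epsilon> * (v - t)"
        using rb[of v] in' h by (simp add: dist_real_def)
      have 2: "\<bar>f u - f t - D * (u - t)\<bar> \<le> \<epsilon> * (t - u)"
        using rb[of u] in' h by (simp add: dist_real_def abs_minus_commute)
      have 3: "D * (v - t) \<ge> 0" "D * (t - u) \<ge> 0"
        using D h by auto
      show ?thesis
        using 1 2 3 by (simp add: algebra_simps abs_le_iff)
    qed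
    then show ?thesis
      using r by blast
  qed
  then obtain r where r: "\<And>t. t \<in> {a..b} - N \<Longrightarrow> r t > 0"
    and rs: "\<And>t u v. \<lbrakk>t \<in> {a..b} - N; u \<le> t; t \<le> v; {u..v} \<subseteq> {a..b}; {u..v} \<subseteq> ball t (r t)\<rbrakk>
      \<Longrightarrow> - \<epsilon> * (v - u) \<le> f v - f u"
    by metis
  define \<gamma> where "\<gamma> t = (if t \<in> N then U else if t \<in> {a..b} then ball t (r t) else ball t 1)" for t
  have "gauge \<gamma>"
    unfolding gauge_def \<gamma>_def using U r by auto
  then obtain P where P: "P tagged_division_of {a..b}" "\<gamma> fine P"
    using fine_division_exists_real by blast
  have fin: "finite P"
    using P(1) by blast
  have interval: "\<exists>u v. K = {u..v} \<and> u \<le> t \<and> t \<le> v \<and> {u..v} \<subseteq> {a..b} \<and> {u..v} \<subseteq> \<gamma> t"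
    if tK: "(t, K) \<in> P" for t K
  proof -
    obtain u v where uv: "K = cbox u v"
      using tagged_division_ofD(4)[OF P(1) tK] by blast
    moreover have "t \<in> K" "K \<subseteq> {a..b}"
      using tagged_division_ofD(2,3)[OF P(1) tK] by auto
    moreover have "K \<subseteq> \<gamma> t"
      using P(2) tK by (auto simp: fine_def)
    ultimately show ?thesis
      by (auto simp del: atLeastatMost_subset_iff)
  qed
  define A where "A = {q \<in> P. fst q \<in> N}"
  have A: "A tagged_partial_division_of {a..b}"
    using P(1) tagged_partial_division_subset[of P "{a..b}" A]
    by (auto simp: A_def tagged_division_of_def)
  have Adiv: "A tagged_division_of (\<Union>(snd ` A))"
    by (rule tagged_partial_division_of_Union_self[OF A])
  have sA: "(snd ` A) division_of (\<Union>(snd ` A))"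
    by (rule division_of_tagged_division[OF Adiv])
  have sub: "\<Union>(snd ` A) \<subseteq> {a..b} \<inter> U"
  proof clarify
    fix y t K assume "y \<in> snd (t, K)" "(t, K) \<in> A"
    then show "y \<in> {a..b} \<inter> U"
      using interval[of t K] by (auto simp: A_def \<gamma>_def)
  qed
  have "(\<Sum>k\<in>snd ` A. Sup k - Inf k) = (\<Sum>k\<in>snd ` A. measure lebesgue k)"
  proof (rule sum.cong)
    fix k assume "k \<in> snd ` A"
    then obtain u v where "k = {u..v}" "u \<le> v"
      using interval by (force simp: A_def)
    then show "Sup k - Inf k = measure lebesgue k"
      by simp
  qed simp
  also have "\<dots> = measure lebesgue (\<Union>(snd ` A))"
    using content_division[OF sA] .
  also have "\<dots> \<le> measure lebesgue U"
    using sub by (intro measure_mono_fmeasurable) (auto simp: U lmeasurable_division[OF sA] fmeasurableD)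
  finally have "(\<Sum>k\<in>snd ` A. \<bar>f (Sup k) - f (Inf k)\<bar>) < \<epsilon>"
    using U(4) sub by (intro small[OF sA]) auto
  moreover have "(\<Sum>(t, k)\<in>A. \<bar>f (Sup k) - f (Inf k)\<bar>) = (\<Sum>k\<in>snd ` A. \<bar>f (Sup k) - f (Inf k)\<bar>)"
  proof -
    \<comment> \<open>The value 0 at the empty set makes \<open>?h\<close> vanish on every
      degenerate box, as the passage from tagged intervals to the set of intervals requires;
      \<open>Sup {}\<close> and \<open>Inf {}\<close> carry no information.\<close>
    let ?h = "\<lambda>k. if k = {} then 0 else \<bar>f (Sup k) - f (Inf k)\<bar>"
    have ne: "k \<noteq> {}" if "(t, k) \<in> A" for t k
      using interval[of t k] that by (auto simp: A_def)
    have "(\<Sum>(t, k)\<in>A. \<bar>f (Sup k) - f (Inf k)\<bar>) = (\<Sum>(t, k)\<in>A. ?h k)"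
      using ne by (intro sum.cong) auto
    also have "\<dots> = (\<Sum>k\<in>snd ` A. ?h k)"
    proof (rule sum.over_tagged_division_lemma[OF Adiv])
      fix u v :: real assume "box u v = {}"
      then show "?h (cbox u v) = 0"
        by (cases "u = v") auto
    qed
    also have "\<dots> = (\<Sum>k\<in>snd ` A. \<bar>f (Sup k) - f (Inf k)\<bar>)"
      using ne by (intro sum.cong) auto
    finally show ?thesis .
  qed
  ultimately have partA: "(\<Sum>(t, k)\<in>A. \<bar>f (Sup k) - f (Inf k)\<bar>) < \<epsilon>"
    by simp
  have sumP: "(\<Sum>(t, k)\<in>P. f (Sup k) - f (Inf k)) = f b - f a"
    by (rule additive_tagged_division_1[OF ab P(1)])
  have sumId: "(\<Sum>(t, k)\<in>P. Sup k - Inf k) = b - a"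
    using additive_tagged_division_1[OF ab P(1), of "\<lambda>x. x"] by simp
  have "- \<epsilon> * (b - a) - (\<Sum>(t, k)\<in>A. \<bar>f (Sup k) - f (Inf k)\<bar>)
    = (\<Sum>(t, k)\<in>P. - \<epsilon> * (Sup k - Inf k) - (if (t, k) \<in> A then \<bar>f (Sup k) - f (Inf k)\<bar> else 0))"
  proof -
    have "(\<Sum>(t, k)\<in>P. if (t, k) \<in> A then \<bar>f (Sup k) - f (Inf k)\<bar> else 0)
      = (\<Sum>(t, k)\<in>A. \<bar>f (Sup k) - f (Inf k)\<bar>)"
      using fin by (intro sum.mono_neutral_cong_right) (auto simp: A_def split: if_splits)
    then show ?thesis
      unfolding sumId[symmetric] sum_distrib_left
      by (simp add: sum_subtractf case_prod_unfold flip: sum_distrib_left)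
  qed
  also have "\<dots> \<le> (\<Sum>(t, k)\<in>P. f (Sup k) - f (Inf k))"
  proof (rule sum_mono, clarify)
    fix t K assume tK: "(t, K) \<in> P"
    then obtain u v where uv: "K = {u..v}" "u \<le> t" "t \<le> v" "{u..v} \<subseteq> {a..b}" "{u..v} \<subseteq> \<gamma> t"
      using interval by blast
    have SI: "Sup K = v" "Inf K = u"
      using uv by auto
    show "- \<epsilon> * (Sup K - Inf K) - (if (t, K) \<in> A then \<bar>f (Sup K) - f (Inf K)\<bar> else 0)
        \<le> f (Sup K) - f (Inf K)"
    proof (cases "t \<in> N")
      case True
      have "0 \<le> \<epsilon> * (v - u)"
        using \<epsilon> uv by auto
      then show ?thesis
        using True tK by (simp add: A_def SI)
    next
      case False
      then have "t \<in> {a..b} - N"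
        using uv by auto
      moreover from this have "\<gamma> t = ball t (r t)"
        by (simp add: \<gamma>_def)
      ultimately show ?thesis
        using rs[of t u v] uv False by (simp add: A_def SI)
    qed
  qed
  finally show ?thesis
    using partA sumP by simp
qed

lemma abs_cont_on_mono_if_deriv_nonneg_ae:
  fixes f :: "real \<Rightarrow> real"
  assumes "abs_cont_on {a..b} f" and "a \<le> b" and "negligible N"
    and "\<And>t. t \<in> {a..b} - N \<Longrightarrow> \<exists>D\<ge>0. (f has_real_derivative D) (at t within {a..b})"
  shows "f a \<le> f b"
proof (rule ccontr)
  assume "\<not> f a \<le> f b"
  \<comment> \<open>With this \<open>\<epsilon>\<close> the admissible loss is only half of the
    assumed decrease.\<close>
  then have "0 < (f a - f b) / (2 * (b - a + 1))"
    using assms by (intro divide_pos_pos) auto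
  from abs_cont_on_increase_bound[OF assms this]
  have "f a - f b \<le> (f a - f b) / (2 * (b - a + 1)) * (b - a + 1)"
    unfolding distrib_left by linarith
  also have "\<dots> = (f a - f b) / 2"
    using \<open>a \<le> b\<close> by (simp add: field_simps)
  finally show False
    using \<open>\<not> f a \<le> f b\<close> by simp
qed

lemma abs_cont_on_add:
  assumes "abs_cont_on S f" and "abs_cont_on S g"
  shows "abs_cont_on S (\<lambda>t. f t + g t)"
  unfolding abs_cont_on_def
proof (intro allI impI)
  fix \<epsilon> :: real assume "\<epsilon> > 0"
  then have e: "\<epsilon> / 2 > 0" by simp
  obtain d1 where d1: "d1 > 0" "\<And>d T. \<lbrakk>d division_of T; T \<subseteq> S; (\<Sum>k\<in>d. Sup k - Inf k) < d1\<rbrakk>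
      \<Longrightarrow> (\<Sum>k\<in>d. \<bar>f (Sup k) - f (Inf k)\<bar>) < \<epsilon> / 2"
    using assms(1) e unfolding abs_cont_on_def by metis
  obtain d2 where d2: "d2 > 0" "\<And>d T. \<lbrakk>d division_of T; T \<subseteq> S; (\<Sum>k\<in>d. Sup k - Inf k) < d2\<rbrakk>
      \<Longrightarrow> (\<Sum>k\<in>d. \<bar>g (Sup k) - g (Inf k)\<bar>) < \<epsilon> / 2"
    using assms(2) e unfolding abs_cont_on_def by metis
  have "(\<Sum>k\<in>d. \<bar>f (Sup k) + g (Sup k) - (f (Inf k) + g (Inf k))\<bar>) < \<epsilon>"
    if "d division_of T" "T \<subseteq> S" "(\<Sum>k\<in>d. Sup k - Inf k) < min d1 d2" for d T
  proof -
    have "(\<Sum>k\<in>d. \<bar>f (Sup k) + g (Sup k) - (f (Inf k) + g (Inf k))\<bar>)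
        \<le> (\<Sum>k\<in>d. \<bar>f (Sup k) - f (Inf k)\<bar>) + (\<Sum>k\<in>d. \<bar>g (Sup k) - g (Inf k)\<bar>)"
      unfolding sum.distrib[symmetric] by (rule sum_mono) linarith
    also have "\<dots> < \<epsilon>"
      using d1(2)[of d T] d2(2)[of d T] that by auto
    finally show ?thesis .
  qed
  then show "\<exists>\<delta>>0. \<forall>d T. d division_of T \<longrightarrow> T \<subseteq> S \<longrightarrow> (\<Sum>k\<in>d. Sup k - Inf k) < \<delta> \<longrightarrow>
      (\<Sum>k\<in>d. \<bar>f (Sup k) + g (Sup k) - (f (Inf k) + g (Inf k))\<bar>) < \<epsilon>"
    using d1(1) d2(1) by (intro exI[of _ "min d1 d2"]) auto
qed

lemma abs_cont_on_lipschitz: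
  fixes f :: "real \<Rightarrow> real"
  assumes lip: "\<And>u v. \<lbrakk>u \<in> S; v \<in> S; u \<le> v\<rbrakk> \<Longrightarrow> \<bar>f v - f u\<bar> \<le> C * (v - u)" and C: "C > 0"
  shows "abs_cont_on S f"
  unfolding abs_cont_on_def
proof (intro allI impI)
  fix \<epsilon> :: real assume e: "\<epsilon> > 0"
  have "(\<Sum>k\<in>d. \<bar>f (Sup k) - f (Inf k)\<bar>) < \<epsilon>"
    if d: "d division_of T" "T \<subseteq> S" "(\<Sum>k\<in>d. Sup k - Inf k) < \<epsilon> / C" for d T
  proof -
    have "(\<Sum>k\<in>d. \<bar>f (Sup k) - f (Inf k)\<bar>) \<le> (\<Sum>k\<in>d. C * (Sup k - Inf k))"
    proof (rule sum_mono)
      fix k assume k: "k \<in> d"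
      obtain u v where uv: "k = cbox u v"
        using division_ofD(4)[OF d(1) k] by blast
      moreover have "k \<noteq> {}" "k \<subseteq> S"
        using division_ofD(2,3)[OF d(1) k] d(2) by auto
      ultimately have "u \<le> v" "u \<in> S" "v \<in> S"
        by auto
      then show "\<bar>f (Sup k) - f (Inf k)\<bar> \<le> C * (Sup k - Inf k)"
        using lip[of u v] uv by simp
    qed
    also have "\<dots> = C * (\<Sum>k\<in>d. Sup k - Inf k)"
      by (rule sum_distrib_left[symmetric])
    also have "\<dots> < \<epsilon>"
      using d(3) C by (simp add: pos_less_divide_eq mult.commute)
    finally show ?thesis .
  qed
  then show "\<exists>\<delta>>0. \<forall>d T. d division_of T \<longrightarrow> T \<subseteq> S \<longrightarrow> (\<Sum>k\<in>d. Sup k - Inf k) < \<delta> \<longrightarrow>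
      (\<Sum>k\<in>d. \<bar>f (Sup k) - f (Inf k)\<bar>) < \<epsilon>"
    using e C by (intro exI[of _ "\<epsilon> / C"]) auto
qed

lemma abs_cont_on_subset: "abs_cont_on T f \<Longrightarrow> S \<subseteq> T \<Longrightarrow> abs_cont_on S f"
  unfolding abs_cont_on_def by (meson order_trans)

lemma abs_cont_on_uminus: "abs_cont_on S f \<Longrightarrow> abs_cont_on S (\<lambda>t. - f t)"
  unfolding abs_cont_on_def by (simp add: abs_minus_commute)

section \<open>Comparison with barriers of prescribed second derivative\<close>

lemma MVT_within:
  fixes f :: "real \<Rightarrow> real"
  assumes "u < v" and "{u..v} \<subseteq> S"
    and der: "\<And>t. t \<in> {u..v} \<Longrightarrow> (f has_real_derivative f' t) (at t within S)"
  obtains \<xi> where "u < \<xi>" "\<xi> < v" "f v - f u = (v - u) * f' \<xi>"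
proof -
  have d: "(f has_real_derivative f' t) (at t within {u..v})" if "t \<in> {u..v}" for t
    using der[OF that] assms(2) by (rule DERIV_subset)
  have "continuous_on {u..v} f"
    using d DERIV_continuous_on by blast
  moreover have "(f has_derivative (*) (f' t)) (at t)" if "u < t" "t < v" for t
  proof -
    have "(f has_real_derivative f' t) (at t)"
      using d[of t] that by (simp add: at_within_Icc_at)
    then show ?thesis
      by (simp add: has_field_derivative_def)
  qed
  ultimately obtain \<xi> where "u < \<xi>" "\<xi> < v" "f v - f u = f' \<xi> * (v - u)"
    using mvt[OF assms(1), of f "\<lambda>t. (*) (f' t)"] by metis
  then show ?thesis
    using that by (simp add: mult.commute)
qed

text \<open>A positive interior value would force, by the mean value theorem, a positive slope
  somewhere before it and a negative slope after it. Both points are interior, so monotonicity of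
  the slope is asked for in the open interval.\<close>

lemma convex_le_zero:
  fixes d :: "real \<Rightarrow> real"
  assumes der: "\<And>t. t \<in> {u..v} \<Longrightarrow> (d has_real_derivative e t) (at t within {u..v})"
    and mono: "\<And>y z. \<lbrakk>u < y; y \<le> z; z < v\<rbrakk> \<Longrightarrow> e y \<le> e z"
    and ends: "d u \<le> 0" "d v \<le> 0" and t: "t \<in> {u..v}"
  shows "d t \<le> 0"
proof (rule ccontr)
  assume "\<not> d t \<le> 0"
  then have dt: "d t > 0" by simp
  then have ut: "u < t" "t < v"
    using t ends by (auto simp: less_le)
  obtain y where y: "u < y" "y < t" "d t - d u = (t - u) * e y"
    using MVT_within[of u t "{u..v}" d e] ut der by auto
  obtain z where z: "t < z" "z < v" "d v - d t = (v - t) * e z"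
    using MVT_within[of t v "{u..v}" d e] ut der by auto
  have "e y > 0"
    using y dt ends ut by (metis diff_gt_0_iff_gt less_le_trans not_le zero_less_mult_pos order.strict_trans1)
  moreover have "e z < 0"
  proof (rule ccontr)
    assume "\<not> e z < 0"
    then have "(v - t) * e z \<ge> 0"
      using ut by auto
    then show False
      using z dt ends by linarith
  qed
  ultimately show False
    using mono[of y z] y z by auto
qed

text \<open>The difference \<open>f - Q\<close> is convex. A bounded \<open>k\<close> makes
  \<open>Q'\<close> Lipschitz, hence absolutely continuous, so the almost-everywhere criterion for
  monotonicity applies to \<open>f' - Q'\<close>.\<close>

lemma barrier_le:
  fixes f Q :: "real \<Rightarrow> real"
  assumes ac: "abs_cont_on {u..v} f'"
    and f: "\<And>t. t \<in> {u..v} \<Longrightarrow> (f has_real_derivative f' t) (at t within {u..v})"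
    and N: "negligible N"
    and f': "\<And>t. t \<in> {u..v} - N \<Longrightarrow> \<exists>D\<ge>- k t. (f' has_real_derivative D) (at t within {u..v})"
    and Q: "\<And>t. t \<in> {u..v} \<Longrightarrow> (Q has_real_derivative Q' t) (at t within {u..v})"
    and Q': "\<And>t. t \<in> {u..v} \<Longrightarrow> (Q' has_real_derivative - k t) (at t within {u..v})"
    and k: "\<And>t. t \<in> {u..v} \<Longrightarrow> \<bar>k t\<bar> \<le> C"
    and ends: "f u \<le> Q u" "f v \<le> Q v" and t: "t \<in> {u..v}"
  shows "f t \<le> Q t"
proof -
  \<comment> \<open>\<open>C + 1\<close> instead of \<open>C\<close>, because \<open>C\<close> may
    be 0 and \<open>abs_cont_on_lipschitz\<close> asks for a positive constant.\<close>
  have lip: "\<bar>- Q' z - - Q' y\<bar> \<le> (C + 1) * (z - y)" if yz: "y \<in> {u..v}" "z \<in> {u..v}" "y \<le> z" for y z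
  proof (cases "y = z")
    case False
    then obtain \<xi> where \<xi>: "y < \<xi>" "\<xi> < z" "Q' z - Q' y = (z - y) * - k \<xi>"
      using MVT_within[of y z "{u..v}" Q' "\<lambda>t. - k t"] Q' yz by auto
    then have "\<bar>- Q' z - - Q' y\<bar> = \<bar>(z - y) * k \<xi>\<bar>"
      by (simp add: abs_minus_commute)
    also have "\<dots> = (z - y) * \<bar>k \<xi>\<bar>"
      using yz by (simp add: abs_mult)
    also have "\<dots> \<le> (z - y) * (C + 1)"
      using k[of \<xi>] \<xi> yz by (intro mult_left_mono) auto
    finally show ?thesis by (simp add: mult.commute)
  qed auto
  have "C \<ge> 0"
    using k[OF t] by linarith
  then have acQ: "abs_cont_on {u..v} (\<lambda>t. - Q' t)"
    by (intro abs_cont_on_lipschitz[where C = "C + 1"] lip) auto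
  have ac': "abs_cont_on {u..v} (\<lambda>t. f' t - Q' t)"
    using abs_cont_on_add[OF ac acQ] by simp
  have "f t - Q t \<le> 0"
  proof (rule convex_le_zero[where d = "\<lambda>t. f t - Q t" and t = t and u = u and v = v and e = "\<lambda>t. f' t - Q' t"])
    show "((\<lambda>t. f t - Q t) has_real_derivative f' t - Q' t) (at t within {u..v})" if "t \<in> {u..v}" for t
      using DERIV_diff[OF f[OF that] Q[OF that]] .
    fix y z assume yz: "u < y" "y \<le> z" "z < v"
    show "f' y - Q' y \<le> f' z - Q' z"
    proof (rule abs_cont_on_mono_if_deriv_nonneg_ae[OF _ yz(2) N])
      show "abs_cont_on {y..z} (\<lambda>t. f' t - Q' t)"
        using yz by (intro abs_cont_on_subset[OF ac']) auto
      fix t assume t: "t \<in> {y..z} - N"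
      then have tin: "t \<in> {u..v} - N" "{y..z} \<subseteq> {u..v}"
        using yz by auto
      then obtain D where D: "D \<ge> - k t" "(f' has_real_derivative D) (at t within {u..v})"
        using f' by blast
      have "((\<lambda>t. f' t - Q' t) has_real_derivative D - - k t) (at t within {u..v})"
        using D Q'[of t] tin by (intro DERIV_diff) auto
      then show "\<exists>D\<ge>0. ((\<lambda>t. f' t - Q' t) has_real_derivative D) (at t within {y..z})"
        using D(1) tin by (intro exI[of _ "D - - k t"]) (auto intro: DERIV_subset)
    qed
  qed (use ends t in auto)
  then show ?thesis by simp
qed

lemma has_real_derivative_affine:
  fixes f :: "real \<Rightarrow> real"
  assumes "(f has_real_derivative D) (at (c + m * t) within S)" and "(\<lambda>t. c + m * t) ` T \<subseteq> S"
  shows "((\<lambda>t. f (c + m * t)) has_real_derivative m * D) (at t within T)"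
proof -
  have "(f has_real_derivative D) (at (c + m * t) within (\<lambda>t. c + m * t) ` T)"
    using assms by (rule DERIV_subset)
  moreover have "((\<lambda>t. c + m * t) has_real_derivative m) (at t within T)"
    by (auto intro!: derivative_eq_intros)
  ultimately show ?thesis
    using DERIV_image_chain[of f D "\<lambda>t. c + m * t" t T m] by (simp add: o_def mult.commute)
qed

text \<open>Two integrations keep \<open>f\<close> below the cubic 1 - t^2/2 + t^3/(6 w), whose
  value at \<open>w\<close> is 1 - w^2/3; this value cannot be below \<open>f w = 0\<close>. The
  lemma serves both the first zero of \<open>r_fun\<close> and, after a reflection, the widths
  \<open>varpi\<close>.\<close>

lemma square_le_three_if_concave_profile:
  fixes f :: "real \<Rightarrow> real"
  assumes w: "w > 0"
    and f: "\<And>t. t \<in> {0..w} \<Longrightarrow> (f has_real_derivative f' t) (at t within {0..w})"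
    and f': "\<And>t. t \<in> {0..w} \<Longrightarrow> (f' has_real_derivative - k t) (at t within {0..w})"
    and k: "\<And>t. t \<in> {0..w} \<Longrightarrow> 1 - t / w \<le> k t"
    and init: "f 0 = 1" "f' 0 = 0" and fw: "f w = 0"
  shows "w\<^sup>2 \<le> 3"
proof -
  let ?e = "\<lambda>t. f' t + t - t\<^sup>2 / (2 * w)"
  have e: "(?e has_real_derivative - k t + (1 - t / w)) (at t within {0..w})" if "t \<in> {0..w}" for t
    using w by (auto intro!: derivative_eq_intros f'[OF that] simp: field_simps)
  have e_le: "?e t \<le> 0" if t: "t \<in> {0..w}" for t
  proof (cases "t = 0")
    case False
    then obtain \<xi> where "0 < \<xi>" "\<xi> < t" "?e t - ?e 0 = (t - 0) * (- k \<xi> + (1 - \<xi> / w))"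
      using MVT_within[of 0 t "{0..w}" ?e "\<lambda>t. - k t + (1 - t / w)"] e t by auto
    moreover have "- k \<xi> + (1 - \<xi> / w) \<le> 0"
      using k[of \<xi>] calculation t by auto
    ultimately show ?thesis
      using init t by (metis (no_types, lifting) add_0 atLeastAtMost_iff diff_0_right diff_zero div_0
          mult_nonneg_nonpos power_zero_numeral)
  qed (use init in auto)
  let ?d = "\<lambda>t. f t + t\<^sup>2 / 2 - t ^ 3 / (6 * w)"
  have d: "(?d has_real_derivative ?e t) (at t within {0..w})" if "t \<in> {0..w}" for t
    using w by (auto intro!: derivative_eq_intros f[OF that] simp: field_simps power2_eq_square)
  obtain \<xi> where "0 < \<xi>" "\<xi> < w" "?d w - ?d 0 = (w - 0) * ?e \<xi>"
    using MVT_within[of 0 w "{0..w}" ?d ?e] d w by auto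
  moreover have "?e \<xi> \<le> 0"
    using e_le calculation by auto
  ultimately have "?d w - ?d 0 \<le> 0"
    using w by (metis diff_zero less_imp_le mult_nonneg_nonpos)
  then show ?thesis
    using init fw w by (simp add: power2_eq_square power3_eq_cube field_simps)
qed

section \<open>The function \<open>r\<^sub>\<Delta>\<close> and its first zero\<close>

text \<open>With \<open>n > 0\<close> the truncated power has no corner at \<open>c\<close>: there
  the difference quotient is the continuous function \<open>max 0 (z - c) ^ n\<close>, and
  Caratheodory's criterion applies.\<close>

lemma max_power_has_derivative:
  fixes c :: real
  assumes "n > 0"
  shows "((\<lambda>t. max 0 (t - c) ^ Suc n) has_real_derivative of_nat (Suc n) * max 0 (t - c) ^ n) (at t)"
proof -
  consider "t < c" | "t = c" | "t > c" by linarith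
  then show ?thesis
  proof cases
    case 1
    have "((\<lambda>t. 0) has_real_derivative of_nat (Suc n) * max 0 (t - c) ^ n) (at t)"
      using 1 assms by (simp add: max_def power_0_left)
    then show ?thesis
      by (rule has_field_derivative_transform_within_open[where S = "{..<c}"]) (use 1 in auto)
  next
    case 2
    let ?g = "\<lambda>z. max 0 (z - c) ^ n"
    have "isCont ?g c"
      by (intro continuous_intros)
    moreover have "max 0 (z - c) ^ Suc n - max 0 (c - c) ^ Suc n = ?g z * (z - c)" for z
      using assms by (cases "z \<le> c") (auto simp: max_def)
    ultimately show ?thesis
      unfolding 2 CARAT_DERIV using assms by (intro exI[of _ ?g]) auto
  next
    case 3
    have "((\<lambda>t. (t - c) ^ Suc n) has_real_derivative of_nat (Suc n) * max 0 (t - c) ^ n) (at t)"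
    proof -
      have "((\<lambda>t. t - c) has_real_derivative 1) (at t)"
        by (auto intro!: derivative_eq_intros)
      from DERIV_power_Suc[OF this, of n] show ?thesis
        using 3 by (simp add: max_def)
    qed
    then show ?thesis
      by (rule has_field_derivative_transform_within_open[where S = "{c<..}"]) (use 3 in auto)
  qed
qed

lemma max_power_fact_has_derivative:
  fixes a c :: real
  assumes "n > 0"
  shows "((\<lambda>t. a * max 0 (t - c) ^ Suc n / fact (Suc n)) has_real_derivative
    a * max 0 (t - c) ^ n / fact n) (at t)"
proof -
  have "((\<lambda>t. a * max 0 (t - c) ^ Suc n / fact (Suc n)) has_real_derivative
      a * (of_nat (Suc n) * max 0 (t - c) ^ n) / fact (Suc n)) (at t)"
    by (intro DERIV_cdivide DERIV_cmult max_power_has_derivative assms)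
  moreover have "a * (of_nat (Suc n) * max 0 (t - c) ^ n) / fact (Suc n) = a * max 0 (t - c) ^ n / fact n"
    unfolding fact_Suc by (simp only: mult.left_commute[of a] mult_divide_mult_cancel_left_if) simp
  ultimately show ?thesis by simp
qed

text \<open>The property that singles out \<open>r_fun\<close>, with the derivative named and the
  second derivative solved for. One-sided derivatives are essential: the second derivative jumps
  from 0 to -1 at the origin.\<close>

definition delay_cosine :: "real \<Rightarrow> (real \<Rightarrow> real) \<Rightarrow> (real \<Rightarrow> real) \<Rightarrow> bool" where
  "delay_cosine \<Delta> f f' \<longleftrightarrow> (\<forall>t\<le>0. f t = 1) \<and> f' 0 = 0 \<and>
     (\<forall>t\<ge>0. (f has_real_derivative f' t) (at t within {0..})) \<and>
     (\<forall>t\<ge>0. (f' has_real_derivative - f (t - \<Delta>)) (at t within {0..}))"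

text \<open>
  The solution is \<open>\<Sum>k. (-1)\<^sup>k (t - (k - 1) \<Delta>)\<^sub>+\<^bsup>2k\<^esup> / (2k)!\<close>, a locally finite sum when \<open>\<Delta> > 0\<close>.
\<close>

definition step_sum :: "real \<Rightarrow> (nat \<Rightarrow> real \<Rightarrow> real) \<Rightarrow> real \<Rightarrow> real" where
  "step_sum \<Delta> e t = (\<Sum>k<Suc (nat \<lceil>t / \<Delta>\<rceil>). e k t)"

definition delay_cosine_term :: "real \<Rightarrow> nat \<Rightarrow> real \<Rightarrow> real" where
  "delay_cosine_term \<Delta> k t = (-1) ^ k * max 0 (t - (real k - 1) * \<Delta>) ^ (2 * k) / fact (2 * k)"

text \<open>The case \<open>k = 0\<close> is separate because truncated subtraction would turn the
  exponent into 0 and the derivative of a constant into 1.\<close>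

definition delay_cosine_term' :: "real \<Rightarrow> nat \<Rightarrow> real \<Rightarrow> real" where
  "delay_cosine_term' \<Delta> k t =
     (if k = 0 then 0 else (-1) ^ k * max 0 (t - (real k - 1) * \<Delta>) ^ (2 * k - 1) / fact (2 * k - 1))"

text \<open>The number of summands in \<open>step_sum\<close> varies with the point. Any admissible
  \<open>N\<close> gives the same value, so one fixed finite sum can represent the function in a
  neighbourhood, where it is differentiated.\<close>

lemma step_sum_eq:
  assumes \<Delta>: "\<Delta> > 0" and "N > 0" and t: "t \<le> (real N - 1) * \<Delta>"
    and zero: "\<And>k t. \<lbrakk>k > 0; t \<le> (real k - 1) * \<Delta>\<rbrakk> \<Longrightarrow> e k t = 0"
  shows "step_sum \<Delta> e t = (\<Sum>k<N. e k t)"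
proof -
  let ?m = "Suc (nat \<lceil>t / \<Delta>\<rceil>)"
  have "t / \<Delta> \<le> real (nat \<lceil>t / \<Delta>\<rceil>)"
    by (rule real_nat_ceiling_ge)
  then have m: "t \<le> (real ?m - 1) * \<Delta>"
    using \<Delta> by (simp add: field_simps)
  have *: "(\<Sum>k<max M L. e k t) = (\<Sum>k<M. e k t)" if "M > 0" "t \<le> (real M - 1) * \<Delta>" for M L
  proof (rule sum.mono_neutral_right)
    show "\<forall>k\<in>{..<max M L} - {..<M}. e k t = 0"
    proof
      fix k assume "k \<in> {..<max M L} - {..<M}"
      then have "M \<le> k" by auto
      then have "(real M - 1) * \<Delta> \<le> (real k - 1) * \<Delta>"
        using \<Delta> by (intro mult_right_mono) auto
      then show "e k t = 0"
        using zero[of k t] that \<open>M \<le> k\<close> by auto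
    qed
  qed auto
  show ?thesis
    using *[of ?m N] *[of N ?m] m t \<open>N > 0\<close> by (simp add: step_sum_def max.commute)
qed

lemma step_sum_has_derivative:
  assumes \<Delta>: "\<Delta> > 0" and t: "t \<ge> 0" "t < (real N - 1) * \<Delta>"
    and zero: "\<And>k t. \<lbrakk>k > 0; t \<le> (real k - 1) * \<Delta>\<rbrakk> \<Longrightarrow> e k t = 0"
    and der: "\<And>k. (e k has_real_derivative e' k) (at t within {0..})"
  shows "(step_sum \<Delta> e has_real_derivative (\<Sum>k<N. e' k)) (at t within {0..})"
proof (rule has_field_derivative_transform_within[where d = "(real N - 1) * \<Delta> - t"])
  show "((\<lambda>t. \<Sum>k<N. e k t) has_real_derivative (\<Sum>k<N. e' k)) (at t within {0..})"
    by (intro DERIV_sum der)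
  have N: "N > 0"
    using t \<Delta> by (cases N) (auto simp: mult_less_0_iff)
  fix y assume "y \<in> {0..}" "dist y t < (real N - 1) * \<Delta> - t"
  then have "y \<le> (real N - 1) * \<Delta>"
    by (auto simp: dist_real_def)
  then show "(\<Sum>k<N. e k y) = step_sum \<Delta> e y"
    using step_sum_eq[of \<Delta> N y e] \<Delta> N zero by simp
qed (use t in auto)

lemma delay_cosine_exists:
  assumes \<Delta>: "\<Delta> > 0"
  shows "delay_cosine \<Delta> (step_sum \<Delta> (delay_cosine_term \<Delta>)) (step_sum \<Delta> (delay_cosine_term' \<Delta>))"
proof -
  let ?c = "delay_cosine_term \<Delta>" and ?c' = "delay_cosine_term' \<Delta>"
  have zero: "?c k t = 0" if "k > 0" "t \<le> (real k - 1) * \<Delta>" for k t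
    using that by (simp add: delay_cosine_term_def max_def)
  have zero': "?c' k t = 0" if "k > 0" "t \<le> (real k - 1) * \<Delta>" for k t
    using that by (simp add: delay_cosine_term'_def max_def)
  have c: "(?c k has_real_derivative ?c' k t) (at t within {0..})" for k t
  proof (cases k)
    case 0
    then show ?thesis
      by (simp add: delay_cosine_term_def[abs_def] delay_cosine_term'_def)
  next
    case (Suc j)
    have "?c k = (\<lambda>t. (-1) ^ k * max 0 (t - real j * \<Delta>) ^ Suc (2 * j + 1) / fact (Suc (2 * j + 1)))"
      unfolding delay_cosine_term_def[abs_def] Suc by simp
    moreover have "?c' k t = (-1) ^ k * max 0 (t - real j * \<Delta>) ^ (2 * j + 1) / fact (2 * j + 1)"
      unfolding delay_cosine_term'_def Suc by simp
    ultimately have "(?c k has_real_derivative ?c' k t) (at t)"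
      using max_power_fact_has_derivative[of "2 * j + 1"] by simp
    then show ?thesis
      by (rule has_field_derivative_at_within)
  qed
  define c'' where "c'' k t = (if k = 0 then 0 else - ?c (k - 1) (t - \<Delta>))" for k t
  have c': "(?c' k has_real_derivative c'' k t) (at t within {0..})" if t: "t \<ge> 0" for k t
  proof -
    consider "k = 0" | "k = 1" | j where "k = Suc (Suc j)"
      by (metis One_nat_def not0_implies_Suc)
    then show ?thesis
    proof cases
      case 1
      then show ?thesis
        by (simp add: delay_cosine_term'_def[abs_def] c''_def)
    next
      case 2
      \<comment> \<open>The first derivative of the term with \<open>k = 1\<close> is
        \<open>- max 0 t\<close>, which has a corner at 0; it agrees with \<open>- t\<close> on the
        half-line where the derivative is taken.\<close>
      have "((\<lambda>t. - t) has_real_derivative -1) (at t within {0..})"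
        by (auto intro!: derivative_eq_intros)
      then have "(?c' k has_real_derivative -1) (at t within {0..})"
        by (rule has_field_derivative_transform_within[where d = 1])
          (use 2 t in \<open>auto simp: delay_cosine_term'_def\<close>)
      then show ?thesis
        using 2 by (simp add: c''_def delay_cosine_term_def)
    next
      case (3 j)
      have "?c' k = (\<lambda>t. (-1) ^ k * max 0 (t - real (Suc j) * \<Delta>) ^ Suc (2 * j + 2) / fact (Suc (2 * j + 2)))"
        unfolding delay_cosine_term'_def[abs_def] 3 by simp
      moreover have "c'' k t = (-1) ^ k * max 0 (t - real (Suc j) * \<Delta>) ^ (2 * j + 2) / fact (2 * j + 2)"
      proof -
        have "max 0 (t - \<Delta> - real j * \<Delta>) = max 0 (t - (1 + real j) * \<Delta>)"
          by (simp add: algebra_simps)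
        moreover have "2 * Suc j = 2 * j + 2"
          by simp
        ultimately show ?thesis
          unfolding c''_def delay_cosine_term_def 3 by simp
      qed
      ultimately have "(?c' k has_real_derivative c'' k t) (at t)"
        using max_power_fact_has_derivative[of "2 * j + 2"] by simp
      then show ?thesis
        by (rule has_field_derivative_at_within)
    qed
  qed
  \<comment> \<open>Differentiating twice lowers the index by one, so \<open>N \<ge> 2\<close>
    leaves a nonempty sum of \<open>N - 1\<close> terms at the delayed argument.\<close>
  have large: "\<exists>N\<ge>2. t < (real N - 1) * \<Delta>" for t
  proof -
    obtain n :: nat where "t / \<Delta> < n"
      using reals_Archimedean2 by blast
    then have "t < n * \<Delta>"
      using \<Delta> by (simp add: field_simps)
    also have "\<dots> \<le> (real (n + 2) - 1) * \<Delta>"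
      using \<Delta> by (intro mult_right_mono) auto
    finally show ?thesis
      by (intro exI[of _ "n + 2"]) auto
  qed
  show ?thesis
    unfolding delay_cosine_def
  proof (intro conjI allI impI)
    show "step_sum \<Delta> ?c t = 1" if "t \<le> 0" for t
      using step_sum_eq[of \<Delta> 1 t ?c] \<Delta> zero that by (simp add: delay_cosine_term_def)
    show "step_sum \<Delta> ?c' 0 = 0"
      using step_sum_eq[of \<Delta> 1 0 ?c'] \<Delta> zero' by (simp add: delay_cosine_term'_def)
  next
    fix t :: real assume t: "t \<ge> 0"
    obtain N where N: "N \<ge> 2" "t < (real N - 1) * \<Delta>"
      using large by blast
    have N0: "N > 0" using N by simp
    have "step_sum \<Delta> ?c' t = (\<Sum>k<N. ?c' k t)"
      using step_sum_eq[of \<Delta> N t ?c'] \<Delta> zero' N N0 by simp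
    then show "(step_sum \<Delta> ?c has_real_derivative step_sum \<Delta> ?c' t) (at t within {0..})"
      using step_sum_has_derivative[of \<Delta> t N ?c "\<lambda>k. ?c' k t"] \<Delta> t N zero c by simp
    have "(\<Sum>k<N. c'' k t) = (\<Sum>k<N - 1. - ?c k (t - \<Delta>))"
    proof -
      obtain M where "N = Suc M"
        using N0 by (cases N) auto
      then show ?thesis
        by (simp only: sum.lessThan_Suc_shift) (simp add: c''_def)
    qed
    also have "\<dots> = - step_sum \<Delta> ?c (t - \<Delta>)"
      using step_sum_eq[of \<Delta> "N - 1" "t - \<Delta>" ?c] \<Delta> zero N by (simp add: sum_negf algebra_simps of_nat_diff)
    finally show "(step_sum \<Delta> ?c' has_real_derivative - step_sum \<Delta> ?c (t - \<Delta>)) (at t within {0..})"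
      using step_sum_has_derivative[of \<Delta> t N ?c' "\<lambda>k. c'' k t"] \<Delta> t N zero' c'[OF t] by simp
  qed
qed

text \<open>Method of steps: up to \<open>real (Suc n) * \<Delta>\<close> the delayed argument lies
  in the part where the two functions already agree, so their derivatives differ by a constant,
  which is 0.\<close>

lemma delay_cosine_unique:
  assumes \<Delta>: "\<Delta> > 0" and f: "delay_cosine \<Delta> f f'" and g: "delay_cosine \<Delta> g g'"
  shows "f = g"
proof -
  have "\<forall>t \<le> real n * \<Delta>. f t = g t" for n
  proof (induction n)
    case 0
    then show ?case
      using f g by (simp add: delay_cosine_def)
  next
    case (Suc n)
    let ?e = "\<lambda>t. f' t - g' t"
    have e: "(?e has_real_derivative 0) (at t within {0..})" if "t \<in> {0..real (Suc n) * \<Delta>}" for t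
    proof -
      have "(?e has_real_derivative - f (t - \<Delta>) - - g (t - \<Delta>)) (at t within {0..})"
        using f g that by (intro DERIV_diff) (auto simp: delay_cosine_def)
      moreover have "f (t - \<Delta>) = g (t - \<Delta>)"
        using Suc.IH that by (auto simp: algebra_simps)
      ultimately show ?thesis by simp
    qed
    have e0: "?e t = 0" if t: "t \<in> {0..real (Suc n) * \<Delta>}" for t
    proof (cases "t = 0")
      case False
      then obtain \<xi> where "?e t - ?e 0 = (t - 0) * 0"
        using MVT_within[of 0 t "{0..}" ?e "\<lambda>_. 0"] e t by auto
      then show ?thesis
        using f g by (simp add: delay_cosine_def)
    qed (use f g in \<open>simp add: delay_cosine_def\<close>)
    show ?case
    proof (intro allI impI)
      fix t assume t: "t \<le> real (Suc n) * \<Delta>"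
      show "f t = g t"
      proof (cases "t \<le> 0")
        case True
        then show ?thesis
          using f g by (simp add: delay_cosine_def)
      next
        case False
        have "((\<lambda>t. f t - g t) has_real_derivative ?e y) (at y within {0..})" if "y \<in> {0..t}" for y
          using f g that by (intro DERIV_diff) (auto simp: delay_cosine_def)
        then obtain \<xi> where "0 < \<xi>" "\<xi> < t" "(f t - g t) - (f 0 - g 0) = (t - 0) * ?e \<xi>"
          using MVT_within[of 0 t "{0..}" "\<lambda>t. f t - g t" ?e] False by auto
        then show ?thesis
          using e0[of \<xi>] t f g by (simp add: delay_cosine_def)
      qed
    qed
  qed
  moreover have "\<exists>n. t \<le> real n * \<Delta>" for t
    using \<Delta> by (metis ex_less_of_nat_mult less_imp_le)
  ultimately show ?thesis
    by (metis ext)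
qed

text \<open>The description of \<open>r_fun\<close> only asserts that a derivative exists. This
  fixes a witness, whose values are meaningful on the nonnegative half-line.\<close>

definition r_deriv :: "real \<Rightarrow> real \<Rightarrow> real" where
  "r_deriv \<Delta> = (SOME f'. delay_cosine \<Delta> (r_fun \<Delta>) f')"

lemma delay_cosine_r_fun:
  assumes "\<Delta> > 0"
  shows "delay_cosine \<Delta> (r_fun \<Delta>) (r_deriv \<Delta>)"
proof -
  let ?P = "\<lambda>f. \<exists>f'. delay_cosine \<Delta> f f'"
  have "\<exists>!f. ?P f"
    using delay_cosine_exists[OF assms] delay_cosine_unique[OF assms] by blast
  then have "?P (THE f. ?P f)"
    by (rule theI')
  moreover have "r_fun \<Delta> = (THE f. ?P f)"
  proof -
    have "(\<exists>D. (f' has_real_derivative D) F \<and> D + y = 0) \<longleftrightarrow> (f' has_real_derivative - y) F"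
      for f' :: "real \<Rightarrow> real" and y F
      by (simp add: add_eq_0_iff2)
    then show ?thesis
      unfolding r_fun_def delay_cosine_def by simp
  qed
  ultimately show ?thesis
    unfolding r_deriv_def by (metis someI_ex)
qed

section \<open>Monotonicity, concavity and first zero of \<open>r_fun\<close>\<close>

context
  fixes \<Delta> :: real
  assumes delay_pos: "\<Delta> > 0"
begin

lemma r_fun_nonpos: "t \<le> 0 \<Longrightarrow> r_fun \<Delta> t = 1"
  and r_deriv_0: "r_deriv \<Delta> 0 = 0"
  and r_fun_has_derivative: "t \<ge> 0 \<Longrightarrow> (r_fun \<Delta> has_real_derivative r_deriv \<Delta> t) (at t within {0..})"
  and r_deriv_has_derivative:
    "t \<ge> 0 \<Longrightarrow> (r_deriv \<Delta> has_real_derivative - r_fun \<Delta> (t - \<Delta>)) (at t within {0..})"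
  using delay_cosine_r_fun[OF delay_pos] by (auto simp: delay_cosine_def)

lemma continuous_on_r_fun_nonneg: "continuous_on {0..} (r_fun \<Delta>)"
  using r_fun_has_derivative by (intro DERIV_continuous_on) auto

lemma continuous_on_r_fun: "continuous_on S (r_fun \<Delta>)"
proof -
  have "continuous_on {..0} (r_fun \<Delta>)"
    by (rule continuous_on_eq[OF continuous_on_const[of _ 1]]) (simp add: r_fun_nonpos)
  then have "continuous_on ({..0} \<union> {0..}) (r_fun \<Delta>)"
    by (intro continuous_on_closed_Un continuous_on_r_fun_nonneg) auto
  then show ?thesis
    by (rule continuous_on_subset) auto
qed

lemma r_deriv_neg_if:
  assumes "t > 0" and "\<And>y. y < t \<Longrightarrow> r_fun \<Delta> y > 0"
  shows "r_deriv \<Delta> t < 0"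
proof -
  obtain \<xi> where "0 < \<xi>" "\<xi> < t" "r_deriv \<Delta> t - r_deriv \<Delta> 0 = (t - 0) * - r_fun \<Delta> (\<xi> - \<Delta>)"
    using MVT_within[of 0 t "{0..}" "r_deriv \<Delta>" "\<lambda>t. - r_fun \<Delta> (t - \<Delta>)"]
      r_deriv_has_derivative assms by auto
  moreover have "r_fun \<Delta> (\<xi> - \<Delta>) > 0"
    using assms calculation delay_pos by auto
  ultimately show ?thesis
    using assms r_deriv_0 by (simp add: mult_less_0_iff)
qed

lemma r_deriv_antimono_if:
  assumes "0 \<le> u" "u \<le> v" and "\<And>y. y < v \<Longrightarrow> r_fun \<Delta> y > 0"
  shows "r_deriv \<Delta> v \<le> r_deriv \<Delta> u"
proof (cases "u = v")
  case False
  then obtain \<xi> where \<xi>: "u < \<xi>" "\<xi> < v" "r_deriv \<Delta> v - r_deriv \<Delta> u = (v - u) * - r_fun \<Delta> (\<xi> - \<Delta>)"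
    using MVT_within[of u v "{0..}" "r_deriv \<Delta>" "\<lambda>t. - r_fun \<Delta> (t - \<Delta>)"]
      r_deriv_has_derivative assms by auto
  then have "0 < r_fun \<Delta> (\<xi> - \<Delta>)"
    using assms delay_pos by auto
  then have "(v - u) * - r_fun \<Delta> (\<xi> - \<Delta>) \<le> 0"
    using assms by (intro mult_nonneg_nonpos) auto
  then show ?thesis
    using \<xi> by linarith
qed auto

lemma r_fun_pos_if_nonzero:
  assumes "\<And>y. \<lbrakk>0 < y; y \<le> t\<rbrakk> \<Longrightarrow> r_fun \<Delta> y \<noteq> 0"
  shows "r_fun \<Delta> t > 0"
proof (rule ccontr)
  assume *: "\<not> r_fun \<Delta> t > 0"
  then have "t > 0"
    using r_fun_nonpos[of t] by (cases "t \<le> 0") auto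
  then obtain y where "0 \<le> y" "y \<le> t" "r_fun \<Delta> y = 0"
    using IVT2'[of "r_fun \<Delta>" t 0 0] * r_fun_nonpos[of 0] continuous_on_r_fun by auto
  then show False
    using assms[of y] r_fun_nonpos[of 0] by (cases "y = 0") auto
qed

lemma r_fun_has_zero: "\<exists>t>0. r_fun \<Delta> t = 0"
proof (rule ccontr)
  assume "\<not> ?thesis"
  then have pos: "r_fun \<Delta> t > 0" for t
    using r_fun_pos_if_nonzero by blast
  define m where "m = r_deriv \<Delta> 1"
  have m: "m < 0"
    unfolding m_def using pos by (intro r_deriv_neg_if) auto
  \<comment> \<open>Here the line of slope \<open>m\<close> through the point of the graph over 1
    has come down to -1, and \<open>r_fun\<close> lies below that line.\<close>
  define t where "t = 1 + (r_fun \<Delta> 1 + 1) / (- m)"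
  have t1: "t > 1"
    using m pos[of 1] by (simp add: t_def divide_pos_neg)
  obtain \<xi> where \<xi>: "1 < \<xi>" "\<xi> < t" "r_fun \<Delta> t - r_fun \<Delta> 1 = (t - 1) * r_deriv \<Delta> \<xi>"
    using MVT_within[of 1 t "{0..}" "r_fun \<Delta>" "r_deriv \<Delta>"] r_fun_has_derivative t1 by auto
  have "r_deriv \<Delta> \<xi> \<le> m"
    unfolding m_def using pos \<xi> by (intro r_deriv_antimono_if) auto
  then have "(t - 1) * r_deriv \<Delta> \<xi> \<le> (t - 1) * m"
    using t1 by (intro mult_left_mono) auto
  also have "\<dots> = - (r_fun \<Delta> 1 + 1)"
    using m by (simp add: t_def)
  finally show False
    using \<xi> pos[of t] by linarith
qed

text \<open>\<open>LEAST\<close> on the reals requires an attained infimum. The zeros in the closed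
  half-line form a closed set, and 0 is not among them because \<open>r_fun\<close> equals 1
  there.\<close>

lemma vartheta_is_first_zero:
  "vartheta \<Delta> > 0 \<and> r_fun \<Delta> (vartheta \<Delta>) = 0 \<and> (\<forall>t>0. r_fun \<Delta> t = 0 \<longrightarrow> vartheta \<Delta> \<le> t)"
proof -
  let ?A = "{t \<in> {0..}. r_fun \<Delta> t = 0}"
  have A: "?A = {t. 0 < t \<and> r_fun \<Delta> t = 0}"
    using r_fun_nonpos[of 0] by (auto simp: less_le)
  have "closed ?A"
    by (intro continuous_closed_preimage_constant continuous_on_r_fun) auto
  moreover have ne: "?A \<noteq> {}" and bdd: "bdd_below ?A"
    using r_fun_has_zero A by (auto intro: bdd_belowI[of _ 0])
  ultimately have inA: "Inf ?A \<in> ?A"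
    by (intro closed_contains_Inf)
  then have "vartheta \<Delta> = Inf ?A"
    unfolding vartheta_def using A bdd by (intro Least_equality) (auto intro!: cInf_lower)
  then show ?thesis
    using inA A bdd by (auto intro!: cInf_lower)
qed

lemma vartheta_pos: "vartheta \<Delta> > 0"
  and r_fun_vartheta: "r_fun \<Delta> (vartheta \<Delta>) = 0"
  using vartheta_is_first_zero by auto

lemma r_fun_pos: "t < vartheta \<Delta> \<Longrightarrow> r_fun \<Delta> t > 0"
  using vartheta_is_first_zero by (intro r_fun_pos_if_nonzero) force

lemma r_fun_nonneg: "t \<le> vartheta \<Delta> \<Longrightarrow> r_fun \<Delta> t \<ge> 0"
  using r_fun_pos r_fun_vartheta by (cases "t = vartheta \<Delta>") (auto simp: less_le)

lemma r_fun_strict_antimono: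
  assumes "0 \<le> u" "u < v" "v \<le> vartheta \<Delta>"
  shows "r_fun \<Delta> v < r_fun \<Delta> u"
proof -
  obtain \<xi> where \<xi>: "u < \<xi>" "\<xi> < v" "r_fun \<Delta> v - r_fun \<Delta> u = (v - u) * r_deriv \<Delta> \<xi>"
    using MVT_within[of u v "{0..}" "r_fun \<Delta>" "r_deriv \<Delta>"] r_fun_has_derivative assms by auto
  moreover have "r_deriv \<Delta> \<xi> < 0"
    using \<xi> assms by (intro r_deriv_neg_if r_fun_pos) auto
  ultimately show ?thesis
    using assms by (smt (verit) mult_pos_neg)
qed

lemma r_fun_antimono:
  assumes "u \<le> v" "v \<le> vartheta \<Delta>"
  shows "r_fun \<Delta> v \<le> r_fun \<Delta> u"
proof -
  consider "u = v" | "v \<le> 0" | "u \<le> 0" "0 < v" | "0 < u" "u < v"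
    using assms by linarith
  then show ?thesis
    using r_fun_strict_antimono[of 0 v] r_fun_strict_antimono[of u v] assms
      r_fun_nonpos[of u] r_fun_nonpos[of v] r_fun_nonpos[of 0]
    by cases auto
qed

lemma r_fun_le_1: "t \<le> vartheta \<Delta> \<Longrightarrow> r_fun \<Delta> t \<le> 1"
  using r_fun_antimono[of "min t 0" t] r_fun_nonpos[of "min t 0"] by auto

lemma r_fun_less_1: "\<lbrakk>0 < t; t \<le> vartheta \<Delta>\<rbrakk> \<Longrightarrow> r_fun \<Delta> t < 1"
  using r_fun_strict_antimono[of 0 t] r_fun_nonpos[of 0] by auto

text \<open>Concavity: up to the first zero the second derivative is minus a delayed value that is
  still positive.\<close>

lemma r_fun_ge_chord:
  assumes "t \<in> {0..vartheta \<Delta>}"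
  shows "1 - t / vartheta \<Delta> \<le> r_fun \<Delta> t"
proof -
  let ?d = "\<lambda>t. 1 - t / vartheta \<Delta> - r_fun \<Delta> t"
  have "?d t \<le> 0"
  proof (rule convex_le_zero[where d = ?d and t = t and u = 0 and v = "vartheta \<Delta>"
        and e = "\<lambda>t. - (1 / vartheta \<Delta>) - r_deriv \<Delta> t"])
    fix t assume "t \<in> {0..vartheta \<Delta>}"
    then have "(r_fun \<Delta> has_real_derivative r_deriv \<Delta> t) (at t within {0..vartheta \<Delta>})"
      using r_fun_has_derivative[of t] by (auto intro: DERIV_subset)
    then show "(?d has_real_derivative - (1 / vartheta \<Delta>) - r_deriv \<Delta> t) (at t within {0..vartheta \<Delta>})"
      using vartheta_pos by (auto intro!: derivative_eq_intros)
  qed (use assms vartheta_pos r_fun_vartheta r_fun_nonpos[of 0] in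
      \<open>auto intro!: r_deriv_antimono_if r_fun_pos\<close>)
  then show ?thesis by simp
qed

lemma vartheta_square_le_3: "(vartheta \<Delta>)\<^sup>2 \<le> 3"
proof (rule square_le_three_if_concave_profile)
  fix t assume t: "t \<in> {0..vartheta \<Delta>}"
  show "(r_fun \<Delta> has_real_derivative r_deriv \<Delta> t) (at t within {0..vartheta \<Delta>})"
    using t r_fun_has_derivative[of t] by (auto intro: DERIV_subset)
  show "(r_deriv \<Delta> has_real_derivative - r_fun \<Delta> (t - \<Delta>)) (at t within {0..vartheta \<Delta>})"
    using t r_deriv_has_derivative[of t] by (auto intro: DERIV_subset)
  have "1 - t / vartheta \<Delta> \<le> r_fun \<Delta> t"
    by (rule r_fun_ge_chord[OF t])
  also have "\<dots> \<le> r_fun \<Delta> (t - \<Delta>)"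
    using t delay_pos by (intro r_fun_antimono) auto
  finally show "1 - t / vartheta \<Delta> \<le> r_fun \<Delta> (t - \<Delta>)" .
qed (auto simp: vartheta_pos r_fun_nonpos r_deriv_0 r_fun_vartheta)

end

section \<open>The functions \<open>\<beta>\<^sub>n\<close> and the numbers \<open>\<varpi>\<^sub>n\<close>\<close>

text \<open>
  Everything about the functions \<open>\<beta>\<^sub>n\<close> is expressed in the variable \<open>\<sigma> = -v \<ge> 0\<close>, in which
  \<open>B \<sigma> = \<beta>\<^bsub>n+1\<^esub> (-\<sigma>)\<close> increases from \<open>0\<close> to \<open>1\<close> on \<open>[0, \<varpi>\<^sub>n]\<close> and solves \<open>B'' = - k\<close>.
\<close>

definition rise_profile :: "(real \<Rightarrow> real) \<Rightarrow> real \<Rightarrow> (real \<Rightarrow> real) \<Rightarrow> (real \<Rightarrow> real) \<Rightarrow> bool" where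
  "rise_profile k w B B' \<longleftrightarrow> 0 < w \<and> B 0 = 0 \<and> B' w = 0 \<and> (\<forall>\<sigma>\<ge>w. B \<sigma> = 1) \<and>
     (\<forall>\<sigma>\<in>{0..w}. (B has_real_derivative B' \<sigma>) (at \<sigma> within {0..w})) \<and>
     (\<forall>\<sigma>\<in>{0..w}. (B' has_real_derivative - k \<sigma>) (at \<sigma> within {0..w}))"

lemma rise_profileD:
  assumes "rise_profile k w B B'"
  shows "0 < w" "B 0 = 0" "B' w = 0" "\<And>\<sigma>. w \<le> \<sigma> \<Longrightarrow> B \<sigma> = 1"
    "\<And>\<sigma>. \<sigma> \<in> {0..w} \<Longrightarrow> (B has_real_derivative B' \<sigma>) (at \<sigma> within {0..w})"
    "\<And>\<sigma>. \<sigma> \<in> {0..w} \<Longrightarrow> (B' has_real_derivative - k \<sigma>) (at \<sigma> within {0..w})"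
  using assms by (auto simp: rise_profile_def)

lemma antiderivative_nonneg_exists:
  fixes k :: "real \<Rightarrow> real"
  assumes "continuous_on {0..} k"
  obtains G where "G 0 = 0" "\<And>t. t \<ge> 0 \<Longrightarrow> (G has_real_derivative k t) (at t within {0..})"
proof (rule that[of "\<lambda>u. integral {0..u} k"])
  show "integral {0..0} k = 0" by simp
  fix t :: real assume t: "t \<ge> 0"
  have "((\<lambda>u. integral {0..u} k) has_real_derivative k t) (at t within {0..t + 1})"
    using t by (intro integral_has_real_derivative continuous_on_subset[OF assms]) auto
  moreover have "at t within {0..t + 1} = at t within {0..}"
    by (rule at_within_nhd[where S = "{..<t + 1}"]) auto
  ultimately show "((\<lambda>u. integral {0..u} k) has_real_derivative k t) (at t within {0..})"
    by simp
qed

text \<open>Expresses the iterated integral through two successive antiderivatives of the reflected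
  kernel, which makes its dependence on both \<open>w\<close> and \<sigma> differentiable by
  inspection.\<close>

lemma double_integral_eq:
  fixes K :: "real \<Rightarrow> real"
  assumes G: "\<And>t. t \<ge> 0 \<Longrightarrow> (G has_real_derivative K (- t)) (at t within {0..})"
    and H: "\<And>t. t \<ge> 0 \<Longrightarrow> (H has_real_derivative G t) (at t within {0..})"
    and \<sigma>: "0 \<le> \<sigma>" "\<sigma> \<le> w"
  shows "integral {-w..-\<sigma>} (\<lambda>u. integral {-w..u} K) = (w - \<sigma>) * G w - (H w - H \<sigma>)"
proof -
  have inner: "integral {-w..u} K = G w - G (- u)" if u: "-w \<le> u" "u \<le> 0" for u
  proof (rule integral_unique)
    have "(K has_integral (- G (- u)) - (- G (- (- w)))) {- w..u}"
    proof (rule fundamental_theorem_of_calculus[OF u(1)])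
      fix v assume v: "v \<in> {-w..u}"
      then have "((\<lambda>t. G (0 + (-1) * t)) has_real_derivative (-1) * K (- (- v))) (at v within {-w..u})"
        using u by (intro has_real_derivative_affine[where S = "{0..}"]) (use G[of "- v"] in auto)
      then show "((\<lambda>v. - G (- v)) has_vector_derivative K v) (at v within {-w..u})"
        using DERIV_minus by (force simp: has_real_derivative_iff_has_vector_derivative[symmetric])
    qed
    then show "(K has_integral G w - G (- u)) {-w..u}" by simp
  qed
  have "((\<lambda>u. integral {-w..u} K) has_integral
      ((- \<sigma>) * G w + H (- (- \<sigma>))) - ((- w) * G w + H (- (- w)))) {-w..-\<sigma>}"
  proof (rule fundamental_theorem_of_calculus)
    fix u assume u: "u \<in> {-w..-\<sigma>}"
    have "((\<lambda>t. H (0 + (-1) * t)) has_real_derivative (-1) * G (- u)) (at u within {-w..-\<sigma>})"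
      using u \<sigma> by (intro has_real_derivative_affine[where S = "{0..}"]) (use H[of "- u"] in auto)
    then have "((\<lambda>u. u * G w + H (- u)) has_real_derivative G w - G (- u)) (at u within {-w..-\<sigma>})"
      by (auto intro!: derivative_eq_intros)
    then show "((\<lambda>u. u * G w + H (- u)) has_vector_derivative integral {-w..u} K) (at u within {-w..-\<sigma>})"
      using inner[of u] u \<sigma> by (simp add: has_real_derivative_iff_has_vector_derivative)
  qed (use \<sigma> in auto)
  then show ?thesis
    by (simp add: integral_unique algebra_simps)
qed

text \<open>As a function of \<open>w\<close>, the double integral up to 0 has derivative
  \<open>w * K (- w)\<close>. Positivity of \<open>K\<close> makes the solution of the equation
  unique, and \<open>K = 1\<close> far away makes the value 1 attainable; together they justify the
  definite description in \<open>varpi_of\<close>.\<close>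

lemma rise_profile_exists:
  fixes K :: "real \<Rightarrow> real"
  assumes cont: "continuous_on {..0} K" and pos: "\<And>v. v < 0 \<Longrightarrow> K v > 0"
    and far: "\<And>v. v \<le> - W \<Longrightarrow> K v = 1"
  defines "w \<equiv> THE w. 0 < w \<and> integral {-w..0} (\<lambda>u. integral {-w..u} K) = 1"
  shows "\<exists>B'. rise_profile (\<lambda>\<sigma>. K (- \<sigma>)) w
     (\<lambda>\<sigma>. if - \<sigma> \<le> - w then 1 else 1 - integral {-w..-\<sigma>} (\<lambda>u. integral {-w..u} K)) B'"
proof -
  have "continuous_on {0..} (\<lambda>\<sigma>. K (- \<sigma>))"
    by (rule continuous_on_compose2[OF cont]) (auto intro: continuous_intros)
  then obtain G where G0: "G 0 = 0"
    and G: "\<And>t. t \<ge> 0 \<Longrightarrow> (G has_real_derivative K (- t)) (at t within {0..})"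
    using antiderivative_nonneg_exists by blast
  have "continuous_on {0..} G"
    using G by (intro DERIV_continuous_on) auto
  then obtain H where H0: "H 0 = 0"
    and H: "\<And>t. t \<ge> 0 \<Longrightarrow> (H has_real_derivative G t) (at t within {0..})"
    using antiderivative_nonneg_exists by blast
  define F where "F w = w * G w - H w" for w
  have eqF: "integral {-w..0} (\<lambda>u. integral {-w..u} K) = F w" if "w \<ge> 0" for w
    using double_integral_eq[OF G H, of 0 w] that H0 by (simp add: F_def)
  have F: "(F has_real_derivative t * K (- t)) (at t within {0..})" if "t \<ge> 0" for t
    unfolding F_def[abs_def] using G[OF that] H[OF that] by (auto intro!: derivative_eq_intros)
  have F_less: "F u < F v" if uv: "0 \<le> u" "u < v" for u v
  proof -
    obtain \<xi> where \<xi>: "u < \<xi>" "\<xi> < v" "F v - F u = (v - u) * (\<xi> * K (- \<xi>))"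
      using MVT_within[of u v "{0..}" F "\<lambda>t. t * K (- t)"] F uv by auto
    have "(v - u) * (\<xi> * K (- \<xi>)) > 0"
      using pos[of "- \<xi>"] \<xi> uv by (intro mult_pos_pos) auto
    then show ?thesis using \<xi> by linarith
  qed
  \<comment> \<open>Beyond \<open>V\<close> the derivative of \<open>F\<close> is its own argument
    and exceeds 1, so one further unit of length brings \<open>F\<close> above 1.\<close>
  define V where "V = max W 1"
  have "V \<ge> 1"
    by (simp add: V_def)
  have "1 \<le> F (V + 1)"
  proof -
    have "(F has_real_derivative t * K (- t)) (at t within {0..})" if "t \<in> {V..V + 1}" for t
      using F[of t] that \<open>V \<ge> 1\<close> by simp
    moreover have "V < V + 1" "{V..V + 1} \<subseteq> {0..}"
      using \<open>V \<ge> 1\<close> by auto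
    ultimately obtain \<xi> where \<xi>: "V < \<xi>" "F (V + 1) - F V = (V + 1 - V) * (\<xi> * K (- \<xi>))"
      using MVT_within[of V "V + 1" "{0..}" F "\<lambda>t. t * K (- t)"] by blast
    have "W \<le> V"
      by (simp add: V_def)
    then have "K (- \<xi>) = 1"
      using \<xi>(1) by (intro far) linarith
    then have "F (V + 1) = F V + \<xi>"
      using \<xi>(2) by simp
    moreover have "F 0 < F V"
      using F_less[of 0 V] \<open>V \<ge> 1\<close> by linarith
    moreover have "F 0 = 0"
      using H0 by (simp add: F_def)
    ultimately show ?thesis
      using \<xi>(1) \<open>V \<ge> 1\<close> by linarith
  qed
  moreover have "continuous_on {0..V + 1} F"
    using F by (intro continuous_on_subset[OF DERIV_continuous_on, of "{0..}"]) auto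
  moreover have "F 0 = 0"
    using H0 by (simp add: F_def)
  ultimately obtain w0 where w0: "0 \<le> w0" "F w0 = 1"
    using IVT'[of F 0 1 "V + 1"] by (auto simp: V_def)
  then have "w0 > 0"
    using \<open>F 0 = 0\<close> by (cases "w0 = 0") auto
  have uniq: "w' = w0" if "w' > 0" "F w' = 1" for w'
    using F_less[of w' w0] F_less[of w0 w'] that w0 by linarith
  have "w = w0"
    unfolding w_def
  proof (rule the_equality)
    show "0 < w0 \<and> integral {-w0..0} (\<lambda>u. integral {-w0..u} K) = 1"
      using \<open>w0 > 0\<close> w0 eqF[of w0] by simp
    show "w' = w0" if "0 < w' \<and> integral {-w'..0} (\<lambda>u. integral {-w'..u} K) = 1" for w'
      using that eqF[of w'] by (intro uniq) auto
  qed
  then have w: "0 < w" "F w = 1"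
    using w0 \<open>w0 > 0\<close> by auto
  let ?B = "\<lambda>\<sigma>. if - \<sigma> \<le> - w then 1 else 1 - integral {-w..-\<sigma>} (\<lambda>u. integral {-w..u} K)"
  have B: "?B \<sigma> = 1 - ((w - \<sigma>) * G w - (H w - H \<sigma>))" if "\<sigma> \<in> {0..w}" for \<sigma>
    using double_integral_eq[OF G H, of \<sigma> w] that by (cases "\<sigma> = w") auto
  have "rise_profile (\<lambda>\<sigma>. K (- \<sigma>)) w ?B (\<lambda>\<sigma>. G w - G \<sigma>)"
    unfolding rise_profile_def
  proof (intro conjI ballI allI impI)
    show "?B 0 = 0"
      using B[of 0] w H0 by (simp add: F_def)
  next
    fix \<sigma> assume \<sigma>: "\<sigma> \<in> {0..w}"
    have Gw: "(G has_real_derivative K (- \<sigma>)) (at \<sigma> within {0..w})"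
      and Hw: "(H has_real_derivative G \<sigma>) (at \<sigma> within {0..w})"
      using G[of \<sigma>] H[of \<sigma>] \<sigma> by (auto intro: DERIV_subset)
    have "((\<lambda>\<sigma>. 1 - ((w - \<sigma>) * G w - (H w - H \<sigma>))) has_real_derivative G w - G \<sigma>) (at \<sigma> within {0..w})"
      by (auto intro!: derivative_eq_intros Hw)
    then show "(?B has_real_derivative G w - G \<sigma>) (at \<sigma> within {0..w})"
      by (rule has_field_derivative_transform_within[where d = 1]) (use \<sigma> B in auto)
    show "((\<lambda>\<sigma>. G w - G \<sigma>) has_real_derivative - K (- \<sigma>)) (at \<sigma> within {0..w})"
      by (auto intro!: derivative_eq_intros Gw)
  qed (use w in auto)
  then show ?thesis by blast
qed

section \<open>Shape and comparison of rise profiles\<close>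

context
  fixes k w B B'
  assumes profile: "rise_profile k w B B'" and k_pos: "\<And>\<sigma>. \<sigma> > 0 \<Longrightarrow> k \<sigma> > 0"
begin

lemma rise_profile_deriv_antimono:
  assumes "0 \<le> u" "u < v" "v \<le> w"
  shows "B' v < B' u"
proof -
  obtain \<xi> where "u < \<xi>" "\<xi> < v" "B' v - B' u = (v - u) * - k \<xi>"
    using MVT_within[of u v "{0..w}" B' "\<lambda>\<sigma>. - k \<sigma>"] rise_profileD(6)[OF profile] assms by auto
  moreover have "(v - u) * k \<xi> > 0"
    using k_pos[of \<xi>] calculation assms by (intro mult_pos_pos) auto
  ultimately show ?thesis by simp
qed

lemma rise_profile_strict_mono:
  assumes "0 \<le> u" "u < v" "v \<le> w"
  shows "B u < B v"
proof -
  obtain \<xi> where "u < \<xi>" "\<xi> < v" "B v - B u = (v - u) * B' \<xi>"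
    using MVT_within[of u v "{0..w}" B B'] rise_profileD(5)[OF profile] assms by auto
  moreover have "B' \<xi> > 0"
    using rise_profile_deriv_antimono[of \<xi> w] rise_profileD(3)[OF profile] calculation assms by auto
  then have "(v - u) * B' \<xi> > 0"
    using assms by (intro mult_pos_pos) auto
  ultimately show ?thesis by simp
qed

lemma rise_profile_mono:
  assumes "0 \<le> u" "u \<le> v"
  shows "B u \<le> B v"
proof -
  consider "u = v" | "v \<le> w" "u < v" | "u < w" "w \<le> v" | "w \<le> u"
    using assms by linarith
  then show ?thesis
    using rise_profile_strict_mono[of u v] rise_profile_strict_mono[of u w] rise_profileD(4)[OF profile] assms
    by cases (auto simp: less_imp_le)
qed

lemma rise_profile_less_1: "\<lbrakk>0 \<le> \<sigma>; \<sigma> < w\<rbrakk> \<Longrightarrow> B \<sigma> < 1"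
  using rise_profile_strict_mono[of \<sigma> w] rise_profileD(4)[OF profile, of w] by simp

lemma rise_profile_le_1: "0 \<le> \<sigma> \<Longrightarrow> B \<sigma> \<le> 1"
  using rise_profile_less_1[of \<sigma>] rise_profileD(4)[OF profile, of \<sigma>] by (cases "\<sigma> < w") auto

lemma rise_profile_pos: "\<sigma> > 0 \<Longrightarrow> B \<sigma> > 0"
  using rise_profile_strict_mono[of 0 \<sigma>] rise_profileD(2,4)[OF profile] by (cases "\<sigma> \<le> w") auto

lemma continuous_on_rise_profile: "continuous_on {0..} B"
proof -
  have "continuous_on {0..w} B"
    using rise_profileD(5)[OF profile] by (intro DERIV_continuous_on) auto
  moreover have "continuous_on {w..} B"
    using rise_profileD(4)[OF profile] by (intro continuous_on_eq[OF continuous_on_const[of _ 1]]) auto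
  ultimately have "continuous_on ({0..w} \<union> {w..}) B"
    by (intro continuous_on_closed_Un) auto
  then show ?thesis
    by (rule continuous_on_subset) auto
qed

lemma rise_profile_ge_chord:
  assumes "\<sigma> \<in> {0..w}"
  shows "\<sigma> / w \<le> B \<sigma>"
proof -
  have "\<sigma> / w - B \<sigma> \<le> 0"
  proof (rule convex_le_zero[where d = "\<lambda>\<sigma>. \<sigma> / w - B \<sigma>" and t = \<sigma> and u = 0 and v = w
        and e = "\<lambda>\<sigma>. 1 / w - B' \<sigma>"])
    fix t assume "t \<in> {0..w}"
    then show "((\<lambda>\<sigma>. \<sigma> / w - B \<sigma>) has_real_derivative 1 / w - B' t) (at t within {0..w})"
      using rise_profileD(5)[OF profile, of t] rise_profileD(1)[OF profile]
      by (auto intro!: derivative_eq_intros)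
  next
    fix y z assume "0 < y" "y \<le> z" "z < w"
    then show "1 / w - B' y \<le> 1 / w - B' z"
      using rise_profile_deriv_antimono[of y z] by (cases "y = z") auto
  qed (use assms rise_profileD[OF profile] in auto)
  then show ?thesis by simp
qed

text \<open>Read backwards from its top, a rise profile starts at height 1 with slope 0 and falls to
  0 at distance \<open>w\<close>, so the estimate for falling profiles applies.\<close>

lemma rise_profile_width_square_le_3:
  assumes ge: "\<And>\<sigma>. \<sigma> \<in> {0..w} \<Longrightarrow> \<sigma> / w \<le> k \<sigma>"
  shows "w\<^sup>2 \<le> 3"
proof (rule square_le_three_if_concave_profile)
  fix t assume t: "t \<in> {0..w}"
  have "((\<lambda>t. B (w + (-1) * t)) has_real_derivative (-1) * B' (w + (-1) * t)) (at t within {0..w})"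
    by (rule has_real_derivative_affine[where S = "{0..w}"])
      (use t rise_profileD(5)[OF profile, of "w - t"] in auto)
  then show "((\<lambda>t. B (w - t)) has_real_derivative - B' (w - t)) (at t within {0..w})"
    by simp
  have "((\<lambda>t. B' (w + (-1) * t)) has_real_derivative (-1) * - k (w + (-1) * t)) (at t within {0..w})"
    by (rule has_real_derivative_affine[where S = "{0..w}"])
      (use t rise_profileD(6)[OF profile, of "w - t"] in auto)
  then show "((\<lambda>t. - B' (w - t)) has_real_derivative - k (w - t)) (at t within {0..w})"
    using DERIV_minus by fastforce
  show "1 - t / w \<le> k (w - t)"
    using ge[of "w - t"] t rise_profileD(1)[OF profile] by (simp add: diff_divide_distrib)
qed (use rise_profileD[OF profile] in auto)

lemma rise_profile_le_linear:
  assumes k_le: "\<And>\<sigma>. \<sigma> \<ge> 0 \<Longrightarrow> k \<sigma> \<le> 1" and "\<sigma> \<ge> 0"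
  shows "B \<sigma> \<le> w * \<sigma>"
proof -
  have *: "B \<sigma> \<le> w * \<sigma>" if \<sigma>: "0 < \<sigma>" "\<sigma> \<le> w" for \<sigma>
  proof -
    obtain \<xi> where \<xi>: "0 < \<xi>" "\<xi> < \<sigma>" "B \<sigma> - B 0 = (\<sigma> - 0) * B' \<xi>"
      using MVT_within[of 0 \<sigma> "{0..w}" B B'] rise_profileD(5)[OF profile] \<sigma> by auto
    obtain \<eta> where \<eta>: "\<xi> < \<eta>" "\<eta> < w" "B' w - B' \<xi> = (w - \<xi>) * - k \<eta>"
      using MVT_within[of \<xi> w "{0..w}" B' "\<lambda>\<sigma>. - k \<sigma>"] rise_profileD(6)[OF profile] \<xi> \<sigma> by auto
    have "B' \<xi> = (w - \<xi>) * k \<eta>"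
      using \<eta> rise_profileD(3)[OF profile] by simp
    also have "\<dots> \<le> (w - \<xi>) * 1"
      using k_le[of \<eta>] \<xi> \<eta> by (intro mult_left_mono) auto
    finally have "B' \<xi> \<le> w"
      using \<xi> by simp
    then have "\<sigma> * B' \<xi> \<le> \<sigma> * w"
      using \<sigma> by (intro mult_left_mono) auto
    then show ?thesis
      using \<xi> rise_profileD(2)[OF profile] by (simp add: mult.commute)
  qed
  show ?thesis
  proof (cases "\<sigma> \<le> w")
    case True
    then show ?thesis
      using *[of \<sigma>] assms rise_profileD(2)[OF profile] by (cases "\<sigma> = 0") auto
  next
    case False
    have "B \<sigma> = B w"
      using False rise_profileD(4)[OF profile] by simp
    also have "\<dots> \<le> w * w"
      using *[of w] rise_profileD(1)[OF profile] by simp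
    also have "\<dots> \<le> w * \<sigma>"
      using False rise_profileD(1)[OF profile] by (intro mult_left_mono) auto
    finally show ?thesis .
  qed
qed

end

text \<open>A larger kernel bends the graph more and reaches the top sooner. The difference
  \<open>B2 - B1\<close> is convex on the common interval. If \<open>w2 < w1\<close>, then at
  \<open>w2\<close> the slope of \<open>B1\<close> is still positive while that of \<open>B2\<close>
  is 0; hence \<open>B2 - B1\<close> decreases from 0 up to \<open>w2\<close>, and \<open>B1\<close>
  would exceed 1 there.\<close>

lemma rise_profile_compare:
  assumes 1: "rise_profile k1 w1 B1 B1'" and pos1: "\<And>\<sigma>. \<sigma> > 0 \<Longrightarrow> k1 \<sigma> > 0"
    and 2: "rise_profile k2 w2 B2 B2'" and pos2: "\<And>\<sigma>. \<sigma> > 0 \<Longrightarrow> k2 \<sigma> > 0"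
    and le: "\<And>\<sigma>. \<sigma> \<ge> 0 \<Longrightarrow> k2 \<sigma> \<le> k1 \<sigma>"
  shows "w1 \<le> w2" and "\<sigma> \<ge> 0 \<Longrightarrow> B2 \<sigma> \<le> B1 \<sigma>"
proof -
  define m where "m = min w1 w2"
  have m: "m > 0" "m \<le> w1" "m \<le> w2"
    using rise_profileD(1)[OF 1] rise_profileD(1)[OF 2] by (auto simp: m_def)
  have d: "((\<lambda>\<sigma>. B2 \<sigma> - B1 \<sigma>) has_real_derivative B2' \<sigma> - B1' \<sigma>) (at \<sigma> within {0..m})"
    if "\<sigma> \<in> {0..m}" for \<sigma>
    using that m rise_profileD(5)[OF 1, of \<sigma>] rise_profileD(5)[OF 2, of \<sigma>]
    by (intro DERIV_diff) (auto intro: DERIV_subset)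
  have e: "((\<lambda>\<sigma>. B2' \<sigma> - B1' \<sigma>) has_real_derivative - k2 \<sigma> - - k1 \<sigma>) (at \<sigma> within {0..m})"
    if "\<sigma> \<in> {0..m}" for \<sigma>
    using that m rise_profileD(6)[OF 1, of \<sigma>] rise_profileD(6)[OF 2, of \<sigma>]
    by (intro DERIV_diff) (auto intro: DERIV_subset)
  have e_mono: "B2' y - B1' y \<le> B2' z - B1' z" if yz: "0 \<le> y" "y \<le> z" "z \<le> m" for y z
  proof (cases "y = z")
    case False
    then obtain \<xi> where \<xi>: "y < \<xi>" "\<xi> < z"
      "(B2' z - B1' z) - (B2' y - B1' y) = (z - y) * (- k2 \<xi> - - k1 \<xi>)"
      using MVT_within[of y z "{0..m}" "\<lambda>\<sigma>. B2' \<sigma> - B1' \<sigma>" "\<lambda>\<sigma>. - k2 \<sigma> - - k1 \<sigma>"] e yz by auto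
    have "(z - y) * (- k2 \<xi> - - k1 \<xi>) \<ge> 0"
      using le[of \<xi>] \<xi> yz by (intro mult_nonneg_nonneg) auto
    then show ?thesis
      using \<xi>(3) by linarith
  qed simp
  show w: "w1 \<le> w2"
  proof (rule ccontr)
    assume "\<not> w1 \<le> w2"
    then have w: "w2 < w1" and mw: "m = w2"
      by (auto simp: m_def)
    obtain \<xi> where \<xi>: "0 < \<xi>" "\<xi> < w2" "(B2 w2 - B1 w2) - (B2 0 - B1 0) = (w2 - 0) * (B2' \<xi> - B1' \<xi>)"
      using MVT_within[of 0 w2 "{0..m}" "\<lambda>\<sigma>. B2 \<sigma> - B1 \<sigma>" "\<lambda>\<sigma>. B2' \<sigma> - B1' \<sigma>"] d mw m by auto
    have "B1' w2 > 0"
      using rise_profile_deriv_antimono[OF 1 pos1, of w2 w1] w m mw rise_profileD(3)[OF 1] by auto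
    then have "B2' \<xi> - B1' \<xi> < 0"
      using e_mono[of \<xi> w2] \<xi> mw rise_profileD(3)[OF 2] by simp
    then have "(w2 - 0) * (B2' \<xi> - B1' \<xi>) < 0"
      using m mw by (simp add: mult_pos_neg)
    then have "B2 w2 < B1 w2"
      using \<xi>(3) rise_profileD(2)[OF 1] rise_profileD(2)[OF 2] by linarith
    then show False
      using rise_profileD(4)[OF 2, of w2] rise_profile_le_1[OF 1 pos1, of w2] m mw by simp
  qed
  show "B2 \<sigma> \<le> B1 \<sigma>" if \<sigma>: "\<sigma> \<ge> 0"
  proof (cases "\<sigma> \<le> w1")
    case True
    have "m = w1"
      using w by (simp add: m_def)
    have "B2 \<sigma> - B1 \<sigma> \<le> 0"
    proof (rule convex_le_zero[where d = "\<lambda>\<sigma>. B2 \<sigma> - B1 \<sigma>" and t = \<sigma> and u = 0 and v = m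
          and e = "\<lambda>\<sigma>. B2' \<sigma> - B1' \<sigma>"])
      show "B2 m - B1 m \<le> 0"
        using rise_profileD(4)[OF 1, of w1] rise_profile_le_1[OF 2 pos2, of m] m \<open>m = w1\<close> by simp
    qed (use True \<sigma> \<open>m = w1\<close> d e_mono rise_profileD(2)[OF 1] rise_profileD(2)[OF 2] in auto)
    then show ?thesis by simp
  next
    case False
    then show ?thesis
      using rise_profileD(4)[OF 1, of \<sigma>] rise_profile_le_1[OF 2 pos2 \<sigma>] by simp
  qed
qed

declare beta_seq.simps(2) [simp del]

section \<open>The functions \<open>beta_seq\<close> as rise profiles\<close>

context
  fixes \<Delta> :: real
  assumes delay_pos: "\<Delta> > 0"
begin

abbreviation (input) \<beta> :: "nat \<Rightarrow> real \<Rightarrow> real" where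
  "\<beta> n \<sigma> \<equiv> beta_seq 1 \<Delta> n (- \<sigma>)"

abbreviation (input) kernel :: "nat \<Rightarrow> real \<Rightarrow> real" where
  "kernel n \<sigma> \<equiv> Psi_kernel 1 \<Delta> (beta_seq 1 \<Delta> n) (- \<sigma>)"

text \<open>The cut-off by the indicator creates no jump: at \<open>v = - \<Delta>\<close> the
  argument of \<open>r_fun\<close> is its zero \<open>vartheta \<Delta>\<close>. Clamping the
  argument there has the same effect and shows the kernel to be continuous.\<close>

lemma r_fun_indicator_eq:
  assumes "v \<le> 0"
  shows "r_fun \<Delta> (vartheta \<Delta> - v - \<Delta>) * indicator {-\<Delta>..0} v = r_fun \<Delta> (min (vartheta \<Delta>) (vartheta \<Delta> - v - \<Delta>))"
  using assms r_fun_vartheta[OF delay_pos] by (cases "v = - \<Delta>") (auto simp: min_def indicator_def)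

lemma Psi_kernel_eq:
  "v \<le> 0 \<Longrightarrow> Psi_kernel \<rho> \<Delta> b v = max (b v) (\<rho> * r_fun \<Delta> (min (vartheta \<Delta>) (vartheta \<Delta> - v - \<Delta>)))"
  unfolding Psi_kernel_def mult.assoc by (simp add: r_fun_indicator_eq)

lemma rise_profile_beta_seq_step:
  assumes cont: "continuous_on {..0} (beta_seq 1 \<Delta> n)"
    and pos: "\<And>v. v < 0 \<Longrightarrow> beta_seq 1 \<Delta> n v > 0"
    and far: "\<And>v. v \<le> - W \<Longrightarrow> beta_seq 1 \<Delta> n v = 1"
  shows "\<exists>B'. rise_profile (kernel n) (varpi 1 \<Delta> n) (\<beta> (Suc n)) B'"
proof -
  let ?K = "Psi_kernel 1 \<Delta> (beta_seq 1 \<Delta> n)"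
  have "continuous_on {..0} ?K"
  proof (rule continuous_on_eq)
    show "continuous_on {..0} (\<lambda>v. max (beta_seq 1 \<Delta> n v) (1 * r_fun \<Delta> (min (vartheta \<Delta>) (vartheta \<Delta> - v - \<Delta>))))"
      by (intro continuous_intros cont continuous_on_compose2[OF continuous_on_r_fun[OF delay_pos, of UNIV]]) auto
  qed (simp add: Psi_kernel_eq)
  moreover have "?K v > 0" if "v < 0" for v
    using pos[OF that] by (auto simp: Psi_kernel_def less_max_iff_disj)
  moreover have "?K v = 1" if "v \<le> - max W \<Delta>" for v
    using that far[of v] delay_pos r_fun_vartheta[OF delay_pos] by (simp add: Psi_kernel_eq min_def)
  ultimately have "\<exists>B'. rise_profile (kernel n) (varpi_of 1 \<Delta> (beta_seq 1 \<Delta> n))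
      (\<lambda>\<sigma>. if - \<sigma> \<le> - varpi_of 1 \<Delta> (beta_seq 1 \<Delta> n) then 1
        else 1 - integral {- varpi_of 1 \<Delta> (beta_seq 1 \<Delta> n)..-\<sigma>}
           (\<lambda>u. integral {- varpi_of 1 \<Delta> (beta_seq 1 \<Delta> n)..u} ?K)) B'"
    unfolding varpi_of_def by (rule rise_profile_exists[where W = "max W \<Delta>"]) auto
  then show ?thesis
    by (simp add: varpi_def Let_def beta_seq.simps(2))
qed

text \<open>The invariant that keeps the recursion going: continuity for the antiderivatives,
  positivity for uniqueness of the next width, and the value 1 far away for its existence.\<close>

lemma beta_seq_admissible:
  "continuous_on {..0} (beta_seq 1 \<Delta> n) \<and> (\<forall>v<0. beta_seq 1 \<Delta> n v > 0) \<and>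
   (\<exists>W. \<forall>v\<le>-W. beta_seq 1 \<Delta> n v = 1)"
proof (induction n)
  case (Suc n)
  then obtain B' where B': "rise_profile (kernel n) (varpi 1 \<Delta> n) (\<beta> (Suc n)) B'"
    using rise_profile_beta_seq_step by blast
  have kpos: "kernel n \<sigma> > 0" if "\<sigma> > 0" for \<sigma>
    using Suc that by (auto simp: Psi_kernel_def less_max_iff_disj)
  have "continuous_on {..0} (\<lambda>v. (\<lambda>\<sigma>. \<beta> (Suc n) \<sigma>) (- v))"
    by (rule continuous_on_compose2[OF continuous_on_rise_profile[OF B' kpos]])
      (auto intro: continuous_intros)
  moreover have "beta_seq 1 \<Delta> (Suc n) v > 0" if "v < 0" for v
    using rise_profile_pos[OF B' kpos, of "- v"] that by simp
  moreover have "beta_seq 1 \<Delta> (Suc n) v = 1" if "v \<le> - varpi 1 \<Delta> n" for v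
    using rise_profileD(4)[OF B', of "- v"] that by simp
  ultimately show ?case
    by auto
qed auto

lemma rise_profile_beta_seq: "\<exists>B'. rise_profile (kernel n) (varpi 1 \<Delta> n) (\<beta> (Suc n)) B'"
  using beta_seq_admissible[of n] rise_profile_beta_seq_step by blast

lemma kernel_pos: "\<sigma> > 0 \<Longrightarrow> kernel n \<sigma> > 0"
  using beta_seq_admissible[of n] by (auto simp: Psi_kernel_def less_max_iff_disj)

lemma beta_seq_le_1:
  assumes "\<sigma> \<ge> 0"
  shows "\<beta> n \<sigma> \<le> 1"
proof (cases n)
  case (Suc m)
  obtain B' where B': "rise_profile (kernel m) (varpi 1 \<Delta> m) (\<beta> (Suc m)) B'"
    using rise_profile_beta_seq by blast
  show ?thesis
    using rise_profile_le_1[OF B' kernel_pos assms] Suc by simp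
qed simp

lemma beta_seq_mono:
  assumes "0 \<le> u" "u \<le> v"
  shows "\<beta> n u \<le> \<beta> n v"
proof (cases n)
  case (Suc m)
  obtain B' where B': "rise_profile (kernel m) (varpi 1 \<Delta> m) (\<beta> (Suc m)) B'"
    using rise_profile_beta_seq by blast
  show ?thesis
    using rise_profile_mono[OF B' kernel_pos assms] Suc by simp
qed simp

lemma beta_seq_Suc_0: "beta_seq 1 \<Delta> (Suc n) 0 = 0"
proof -
  obtain B' where B': "rise_profile (kernel n) (varpi 1 \<Delta> n) (\<beta> (Suc n)) B'"
    using rise_profile_beta_seq by blast
  show ?thesis
    using rise_profileD(2)[OF B'] by simp
qed

lemma beta_seq_nonneg: "\<sigma> \<ge> 0 \<Longrightarrow> \<beta> n \<sigma> \<ge> 0"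
proof (cases n)
  case (Suc m)
  assume "\<sigma> \<ge> 0"
  then have "beta_seq 1 \<Delta> n (- 0) \<le> \<beta> n \<sigma>"
    by (intro beta_seq_mono) auto
  moreover have "beta_seq 1 \<Delta> n (- 0) = 0"
    unfolding Suc by (simp add: beta_seq_Suc_0)
  ultimately show ?thesis by linarith
qed simp

lemma beta_seq_Suc_less_1:
  assumes "0 \<le> \<sigma>" "\<sigma> < varpi 1 \<Delta> n"
  shows "\<beta> (Suc n) \<sigma> < 1"
proof -
  obtain B' where B': "rise_profile (kernel n) (varpi 1 \<Delta> n) (\<beta> (Suc n)) B'"
    using rise_profile_beta_seq by blast
  show ?thesis
    using rise_profile_less_1[OF B' kernel_pos assms] .
qed

lemma kernel_le_1: "\<sigma> \<ge> 0 \<Longrightarrow> kernel n \<sigma> \<le> 1"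
  using beta_seq_le_1[of \<sigma> n] r_fun_le_1[OF delay_pos, of "min (vartheta \<Delta>) (vartheta \<Delta> - - \<sigma> - \<Delta>)"]
  by (subst Psi_kernel_eq) auto

lemma varpi_pos: "varpi 1 \<Delta> n > 0"
proof -
  obtain B' where B': "rise_profile (kernel n) (varpi 1 \<Delta> n) (\<beta> (Suc n)) B'"
    using rise_profile_beta_seq by blast
  show ?thesis
    using rise_profileD(1)[OF B'] .
qed

text \<open>A smaller function gives a smaller kernel, and by comparison a longer rise and again a
  smaller function. The induction starts since the first profile is at most 1, the constant value of
  \<open>beta_seq\<close> at index 0.\<close>

lemma varpi_le_Suc: "varpi 1 \<Delta> n \<le> varpi 1 \<Delta> (Suc n)"
proof -
  have step: "varpi 1 \<Delta> n \<le> varpi 1 \<Delta> (Suc n) \<and> (\<forall>\<sigma>\<ge>0. \<beta> (Suc (Suc n)) \<sigma> \<le> \<beta> (Suc n) \<sigma>)"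
    if IH: "\<And>\<sigma>. \<sigma> \<ge> 0 \<Longrightarrow> \<beta> (Suc n) \<sigma> \<le> \<beta> n \<sigma>" for n
  proof -
    obtain B1' where 1: "rise_profile (kernel n) (varpi 1 \<Delta> n) (\<beta> (Suc n)) B1'"
      using rise_profile_beta_seq by blast
    obtain B2' where 2: "rise_profile (kernel (Suc n)) (varpi 1 \<Delta> (Suc n)) (\<beta> (Suc (Suc n))) B2'"
      using rise_profile_beta_seq by blast
    have "kernel (Suc n) \<sigma> \<le> kernel n \<sigma>" if "\<sigma> \<ge> 0" for \<sigma>
      using IH[OF that] unfolding Psi_kernel_def by (intro max.mono) auto
    then show ?thesis
      using rise_profile_compare[OF 1 kernel_pos 2 kernel_pos] by simp
  qed
  have dec: "\<forall>\<sigma>\<ge>0. \<beta> (Suc n) \<sigma> \<le> \<beta> n \<sigma>" for n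
  proof (induction n)
    case 0
    then show ?case
      using beta_seq_le_1[of _ 1] by simp
  next
    case (Suc n)
    then show ?case using step[of n] by blast
  qed
  show "varpi 1 \<Delta> n \<le> varpi 1 \<Delta> (Suc n)"
    using step dec by blast
qed

text \<open>For positive \<open>n\<close> the function \<beta> lies above the chord belonging to the
  previous width. As widths increase, that chord is steeper than the one to be beaten, so the kernel
  satisfies the chord condition and the square of the width is at most 3.\<close>

lemma varpi_le_2: "varpi 1 \<Delta> n \<le> 2"
proof -
  obtain B' where B': "rise_profile (kernel n) (varpi 1 \<Delta> n) (\<beta> (Suc n)) B'"
    using rise_profile_beta_seq by blast
  have "(varpi 1 \<Delta> n)\<^sup>2 \<le> 3"
  proof (rule rise_profile_width_square_le_3[OF B' kernel_pos])
    fix \<sigma> assume \<sigma>: "\<sigma> \<in> {0..varpi 1 \<Delta> n}"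
    have "\<sigma> / varpi 1 \<Delta> n \<le> \<beta> n \<sigma>"
    proof (cases n)
      case 0
      then show ?thesis
        using \<sigma> varpi_pos[of n] by (simp add: field_simps)
    next
      case (Suc m)
      obtain B1' where 1: "rise_profile (kernel m) (varpi 1 \<Delta> m) (\<beta> (Suc m)) B1'"
        using rise_profile_beta_seq by blast
      show ?thesis
      proof (cases "\<sigma> \<le> varpi 1 \<Delta> m")
        case True
        have "\<sigma> / varpi 1 \<Delta> n \<le> \<sigma> / varpi 1 \<Delta> m"
          using varpi_le_Suc[of m] varpi_pos[of m] \<sigma> Suc by (intro divide_left_mono) auto
        also have "\<dots> \<le> \<beta> (Suc m) \<sigma>"
          using rise_profile_ge_chord[OF 1 kernel_pos, of \<sigma>] True \<sigma> by auto
        finally show ?thesis using Suc by simp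
      next
        case False
        then have "\<beta> (Suc m) \<sigma> = 1"
          using rise_profileD(4)[OF 1] by auto
        then show ?thesis
          using \<sigma> varpi_pos[of n] Suc by (simp add: field_simps)
      qed
    qed
    also have "\<dots> \<le> kernel n \<sigma>"
      by (simp add: Psi_kernel_def)
    finally show "\<sigma> / varpi 1 \<Delta> n \<le> kernel n \<sigma>" .
  qed
  then have "(varpi 1 \<Delta> n)\<^sup>2 \<le> 2\<^sup>2" by simp
  then show ?thesis
    by (rule power2_le_imp_le) simp
qed

lemma beta_seq_Suc_le_linear: "\<sigma> \<ge> 0 \<Longrightarrow> \<beta> (Suc n) \<sigma> \<le> 2 * \<sigma>"
proof -
  assume \<sigma>: "\<sigma> \<ge> 0"
  obtain B' where B': "rise_profile (kernel n) (varpi 1 \<Delta> n) (\<beta> (Suc n)) B'"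
    using rise_profile_beta_seq by blast
  have "\<beta> (Suc n) \<sigma> \<le> varpi 1 \<Delta> n * \<sigma>"
    by (rule rise_profile_le_linear[OF B' kernel_pos kernel_le_1 \<sigma>])
  also have "\<dots> \<le> 2 * \<sigma>"
    using \<sigma> varpi_le_2[of n] by (intro mult_right_mono) auto
  finally show ?thesis .
qed

lemma varpi_tendsto_Psi: "varpi 1 \<Delta> \<longlonglongrightarrow> Psi 1 \<Delta>"
  and varpi_le_Psi: "varpi 1 \<Delta> n \<le> Psi 1 \<Delta>"
proof -
  have inc: "incseq (varpi 1 \<Delta>)"
    by (intro incseq_SucI varpi_le_Suc)
  moreover have "varpi 1 \<Delta> n \<le> 2" for n
    by (rule varpi_le_2)
  ultimately have "convergent (varpi 1 \<Delta>)"
    using incseq_convergent[of "varpi 1 \<Delta>" 2] convergentI by metis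
  then show lim: "varpi 1 \<Delta> \<longlonglongrightarrow> Psi 1 \<Delta>"
    unfolding Psi_def by (simp add: convergent_LIMSEQ_iff)
  show "varpi 1 \<Delta> n \<le> Psi 1 \<Delta>"
    using incseq_le[OF inc lim] .
qed

end

section \<open>Semicycles of the delay equation\<close>

text \<open>Forgetting \<open>p\<close> and the actual delay leaves a condition that survives a
  change of sign of \<open>x\<close> and a later starting point. The first reduces negative
  semicycles to positive ones, the second restarts the contraction argument.\<close>

definition delay_inequality :: "real \<Rightarrow> real \<Rightarrow> (real \<Rightarrow> real) \<Rightarrow> (real \<Rightarrow> real) \<Rightarrow> bool" where
  "delay_inequality \<Delta> s x x' \<longleftrightarrow>
     (\<forall>t\<ge>s - \<Delta>. (x has_real_derivative x' t) (at t within {s - \<Delta>..})) \<and>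
     (\<forall>b. abs_cont_on {s - \<Delta>..b} x') \<and>
     (\<exists>N. negligible N \<and> (\<forall>t\<in>{s..} - N. \<exists>D. (x' has_real_derivative D) (at t) \<and>
        (\<exists>u\<in>{t - \<Delta>..t}. \<bar>D\<bar> \<le> \<bar>x u\<bar>)))"

lemma delay_inequalityD:
  assumes "delay_inequality \<Delta> s x x'"
  shows "s - \<Delta> \<le> t \<Longrightarrow> (x has_real_derivative x' t) (at t within {s - \<Delta>..})"
    and "abs_cont_on {s - \<Delta>..b} x'"
  using assms by (simp_all add: delay_inequality_def)

lemma delay_inequality_uminus:
  assumes "delay_inequality \<Delta> s x x'"
  shows "delay_inequality \<Delta> s (\<lambda>t. - x t) (\<lambda>t. - x' t)"
proof -
  obtain N where N: "negligible N"
    "\<And>t. t \<in> {s..} - N \<Longrightarrow> \<exists>D. (x' has_real_derivative D) (at t) \<and> (\<exists>u\<in>{t - \<Delta>..t}. \<bar>D\<bar> \<le> \<bar>x u\<bar>)"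
    using assms unfolding delay_inequality_def by blast
  have "\<exists>D. ((\<lambda>t. - x' t) has_real_derivative D) (at t) \<and> (\<exists>u\<in>{t - \<Delta>..t}. \<bar>D\<bar> \<le> \<bar>- x u\<bar>)"
    if t: "t \<in> {s..} - N" for t
  proof -
    obtain D u where "(x' has_real_derivative D) (at t)" "u \<in> {t - \<Delta>..t}" "\<bar>D\<bar> \<le> \<bar>x u\<bar>"
      using N(2)[OF t] by blast
    then show ?thesis
      by (intro exI[of _ "- D"] conjI bexI[of _ u]) (simp_all add: DERIV_minus)
  qed
  moreover have "((\<lambda>t. - x t) has_real_derivative - x' t) (at t within {s - \<Delta>..})" if "t \<ge> s - \<Delta>" for t
    using assms that unfolding delay_inequality_def by (simp add: DERIV_minus)
  moreover have "abs_cont_on {s - \<Delta>..b} (\<lambda>t. - x' t)" for b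
    using assms unfolding delay_inequality_def by (simp add: abs_cont_on_uminus)
  ultimately show ?thesis
    unfolding delay_inequality_def using N(1) by (intro conjI allI impI exI[of _ N] ballI)
qed

lemma delay_inequality_later:
  assumes di: "delay_inequality \<Delta> s x x'" and T: "s \<le> T"
  shows "delay_inequality \<Delta> T x x'"
proof -
  obtain N where N: "negligible N"
    "\<forall>t\<in>{s..} - N. \<exists>D. (x' has_real_derivative D) (at t) \<and> (\<exists>u\<in>{t - \<Delta>..t}. \<bar>D\<bar> \<le> \<bar>x u\<bar>)"
    using di unfolding delay_inequality_def by blast
  show ?thesis
    unfolding delay_inequality_def
  proof (intro conjI allI impI exI[of _ N])
    show "(x has_real_derivative x' t) (at t within {T - \<Delta>..})" if "T - \<Delta> \<le> t" for t
      using T that by (intro DERIV_subset[OF delay_inequalityD(1)[OF di]]) auto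
    show "abs_cont_on {T - \<Delta>..b} x'" for b
      using T by (intro abs_cont_on_subset[OF delay_inequalityD(2)[OF di]]) auto
    show "\<forall>t\<in>{T..} - N. \<exists>D. (x' has_real_derivative D) (at t) \<and> (\<exists>u\<in>{t - \<Delta>..t}. \<bar>D\<bar> \<le> \<bar>x u\<bar>)"
      using N(2) T by auto
  qed (rule N)
qed

lemma delay_inequality_continuous_on:
  assumes "delay_inequality \<Delta> s x x'" and "S \<subseteq> {s - \<Delta>..}"
  shows "continuous_on S x"
proof -
  have "(x has_real_derivative x' t) (at t within {s - \<Delta>..})" if "t \<in> {s - \<Delta>..}" for t
    using assms that unfolding delay_inequality_def by simp
  then have "continuous_on {s - \<Delta>..} x"
    by (rule DERIV_continuous_on)
  then show ?thesis
    using assms(2) by (rule continuous_on_subset)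
qed

text \<open>\<open>k\<close> has to dominate on the whole window of length \<Delta> because the
  position of the delayed argument inside it is unknown. The window contains \<open>t\<close>
  itself, so \<open>k\<close> is nonnegative and an upper bound suffices to make it bounded.\<close>

lemma delay_barrier:
  assumes di: "delay_inequality \<Delta> s x x'" and \<Delta>: "0 \<le> \<Delta>" and "s \<le> u"
    and past: "\<And>t y. \<lbrakk>t \<in> {u..v}; y \<in> {t - \<Delta>..t}\<rbrakk> \<Longrightarrow> \<bar>x y\<bar> \<le> k t"
    and k: "\<And>t. t \<in> {u..v} \<Longrightarrow> k t \<le> C"
    and Q: "\<And>t. t \<in> {u..v} \<Longrightarrow> (Q has_real_derivative Q' t) (at t within {u..v})"
    and Q': "\<And>t. t \<in> {u..v} \<Longrightarrow> (Q' has_real_derivative - k t) (at t within {u..v})"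
    and ends: "x u \<le> Q u" "x v \<le> Q v" and t: "t \<in> {u..v}"
  shows "x t \<le> Q t"
proof -
  obtain N where N: "negligible N"
    "\<And>t. t \<in> {s..} - N \<Longrightarrow> \<exists>D. (x' has_real_derivative D) (at t) \<and> (\<exists>u\<in>{t - \<Delta>..t}. \<bar>D\<bar> \<le> \<bar>x u\<bar>)"
    using di unfolding delay_inequality_def by blast
  show ?thesis
  proof (rule barrier_le[where f = x and Q = Q and t = t and u = u and v = v and f' = x' and N = N and k = k and Q' = Q' and C = C])
    show "abs_cont_on {u..v} x'"
      using \<Delta> \<open>s \<le> u\<close> by (intro abs_cont_on_subset[OF delay_inequalityD(2)[OF di]]) auto
    show "(x has_real_derivative x' t) (at t within {u..v})" if "t \<in> {u..v}" for t
      using that \<Delta> \<open>s \<le> u\<close> by (intro DERIV_subset[OF delay_inequalityD(1)[OF di]]) auto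
    show "\<exists>D\<ge>- k t. (x' has_real_derivative D) (at t within {u..v})" if tN: "t \<in> {u..v} - N" for t
    proof -
      obtain D y where D: "(x' has_real_derivative D) (at t)" "y \<in> {t - \<Delta>..t}" "\<bar>D\<bar> \<le> \<bar>x y\<bar>"
        using N(2)[of t] tN \<open>s \<le> u\<close> by auto
      moreover have "\<bar>x y\<bar> \<le> k t"
        using past[of t y] D tN by auto
      ultimately show ?thesis
        by (intro exI[of _ D]) (auto intro: has_field_derivative_at_within)
    qed
    show "\<bar>k t\<bar> \<le> C" if "t \<in> {u..v}" for t
      using past[of t t] k[of t] that \<Delta> by auto
  qed (use N Q Q' ends t in auto)
qed

lemma delay_barrier_abs:
  assumes di: "delay_inequality \<Delta> s x x'" and \<Delta>: "0 \<le> \<Delta>" and "s \<le> u"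
    and past: "\<And>t y. \<lbrakk>t \<in> {u..v}; y \<in> {t - \<Delta>..t}\<rbrakk> \<Longrightarrow> \<bar>x y\<bar> \<le> k t"
    and k: "\<And>t. t \<in> {u..v} \<Longrightarrow> k t \<le> C"
    and Q: "\<And>t. t \<in> {u..v} \<Longrightarrow> (Q has_real_derivative Q' t) (at t within {u..v})"
    and Q': "\<And>t. t \<in> {u..v} \<Longrightarrow> (Q' has_real_derivative - k t) (at t within {u..v})"
    and ends: "\<bar>x u\<bar> \<le> Q u" "\<bar>x v\<bar> \<le> Q v" and t: "t \<in> {u..v}"
  shows "\<bar>x t\<bar> \<le> Q t"
proof -
  have "x t \<le> Q t"
    by (rule delay_barrier[OF di \<Delta> \<open>s \<le> u\<close> past k Q Q' _ _ t]) (use ends in auto)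
  moreover have "- x t \<le> Q t"
    by (rule delay_barrier[OF delay_inequality_uminus[OF di] \<Delta> \<open>s \<le> u\<close> _ k Q Q' _ _ t])
      (use past ends in auto)
  ultimately show ?thesis by linarith
qed

text \<open>The end points are the last zero before \<open>t\<close> and the first one after it.
  Compactness provides them even if zeros accumulate elsewhere.\<close>

lemma semicycle_around:
  assumes cont: "continuous_on {t0..} x" and "x t0 = 0" and osc: "oscillatory x"
    and dom: "{t0..} \<subseteq> S" and t: "t0 \<le> t" "x t \<noteq> 0"
  obtains a b where "semicycle S x a b" "t0 \<le> a" "a < t" "t < b"
proof -
  obtain z where z: "z \<ge> t" "x z = 0"
    using osc unfolding oscillatory_def by blast
  let ?A = "{y \<in> {t0..t}. x y = 0}" and ?B = "{y \<in> {t..z}. x y = 0}"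
  have "closed ?A" "closed ?B"
    using t by (intro continuous_closed_preimage_constant continuous_on_subset[OF cont]; auto)+
  then have "compact ?A" "compact ?B"
    by (auto simp: compact_eq_bounded_closed intro: bounded_subset[OF bounded_closed_interval])
  moreover have "?A \<noteq> {}" "?B \<noteq> {}"
    using assms(2) t z by auto
  ultimately obtain a b where a: "a \<in> ?A" "\<forall>y\<in>?A. y \<le> a" and b: "b \<in> ?B" "\<forall>y\<in>?B. b \<le> y"
    using compact_attains_sup[of ?A] compact_attains_inf[of ?B] by blast
  have "a < t" "t < b"
    using a(1) b(1) t by (auto simp: less_le)
  moreover have "x y \<noteq> 0" if "a < y" "y < b" for y
    using bspec[OF a(2), of y] bspec[OF b(2), of y] that a(1) b(1) by (cases "y \<le> t") auto
  ultimately have "semicycle S x a b"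
    using a(1) b(1) dom unfolding semicycle_def by auto
  then show ?thesis
    using that \<open>a < t\<close> \<open>t < b\<close> a(1) by auto
qed

lemma semicycle_sign:
  assumes sc: "semicycle S x a b" and cont: "continuous_on {a..b} x"
  shows "(\<forall>t\<in>{a<..<b}. x t > 0) \<or> (\<forall>t\<in>{a<..<b}. - x t > 0)"
proof (rule ccontr)
  assume "\<not> ?thesis"
  then obtain y z where yz: "y \<in> {a<..<b}" "z \<in> {a<..<b}" "x y \<le> 0" "x z \<ge> 0"
    by (auto simp: not_less)
  have "connected (x ` {a<..<b})"
    by (intro connected_continuous_image continuous_on_subset[OF cont]) auto
  then have "0 \<in> x ` {a<..<b}"
    using yz connectedD_interval[of "x ` {a<..<b}" "x y" "x z" 0] by auto
  then show False
    using sc unfolding semicycle_def by auto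
qed

section \<open>Estimates before and after a zero, for positive delay\<close>

context
  fixes \<Delta> :: real
  assumes delay_pos: "\<Delta> > 0"
begin

text \<open>The barrier drops from \<open>S\<close> to 0 during the last stretch of length
  \<open>vartheta \<Delta>\<close> before \<open>a\<close>; the distance required between
  \<open>s\<close> and \<open>a\<close> places this stretch where the differential inequality
  holds.\<close>

lemma bound_before_zero:
  assumes di: "delay_inequality \<Delta> s x x'" and a: "s + vartheta \<Delta> \<le> a" and "x a = 0"
    and S: "\<And>y. y \<in> {s - \<Delta>..a} \<Longrightarrow> \<bar>x y\<bar> \<le> S" and y: "y \<in> {s - \<Delta>..a}"
  shows "\<bar>x y\<bar> \<le> S * r_fun \<Delta> (vartheta \<Delta> + y - a)"
proof -
  let ?\<theta> = "vartheta \<Delta>" and ?q = "(vartheta \<Delta>)\<^sup>2 / 8"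
  note r_nonneg = r_fun_nonneg[OF delay_pos] and \<theta>_pos = vartheta_pos[OF delay_pos]
  have S0: "S \<ge> 0"
    using S[OF y] by linarith
  text \<open>
    If the bound holds up to an error \<open>\<kappa>\<close>, then the barrier \<open>S r(\<theta>) + \<kappa> \<theta> (\<vartheta> - \<theta>) / 2\<close> improves the
    error to \<open>\<kappa> \<vartheta>\<^sup>2 / 8\<close>, and \<open>\<vartheta>\<^sup>2 \<le> 3\<close>.
  \<close>
  have approx: "\<forall>y\<in>{s - \<Delta>..a}. \<bar>x y\<bar> \<le> S * r_fun \<Delta> (?\<theta> + y - a) + S * ?q ^ n" for n
  proof (induction n)
    case 0
    show ?case
    proof
      fix y assume y: "y \<in> {s - \<Delta>..a}"
      have "0 \<le> S * r_fun \<Delta> (?\<theta> + y - a)"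
        using y S0 by (intro mult_nonneg_nonneg r_nonneg) auto
      then show "\<bar>x y\<bar> \<le> S * r_fun \<Delta> (?\<theta> + y - a) + S * ?q ^ 0"
        using S[OF y] by simp
    qed
  next
    case (Suc n)
    define \<kappa> where "\<kappa> = S * ?q ^ n"
    have \<kappa>: "\<kappa> \<ge> 0"
      using S0 by (simp add: \<kappa>_def)
    show ?case
    proof
      fix y assume y: "y \<in> {s - \<Delta>..a}"
      show "\<bar>x y\<bar> \<le> S * r_fun \<Delta> (?\<theta> + y - a) + S * ?q ^ Suc n"
      proof (cases "y \<le> a - ?\<theta>")
        case True
        then have "S * r_fun \<Delta> (?\<theta> + y - a) = S"
          using r_fun_nonpos[OF delay_pos, of "?\<theta> + y - a"] by simp
        moreover have "0 \<le> S * ?q ^ Suc n"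
          using S0 by (intro mult_nonneg_nonneg zero_le_power) auto
        ultimately show ?thesis
          using S[OF y] by linarith
      next
        case False
        define \<alpha> where "\<alpha> = a - ?\<theta>"
        have \<theta>_eq: "?\<theta> + z - a = z - \<alpha>" for z
          by (simp add: \<alpha>_def)
        have \<alpha>: "s \<le> \<alpha>" "\<alpha> < a"
          using a \<theta>_pos by (auto simp: \<alpha>_def)
        have sub: "(\<lambda>t. - \<alpha> + 1 * t) ` {\<alpha>..a} \<subseteq> {0..}"
          by auto
        define Q where "Q t = S * r_fun \<Delta> (t - \<alpha>) + \<kappa> * ((t - \<alpha>) * (a - t) / 2)" for t
        have "\<bar>x y\<bar> \<le> Q y"
        proof (rule delay_barrier_abs[where Q' = "\<lambda>t. S * r_deriv \<Delta> (t - \<alpha>) + \<kappa> * (a - t - ?\<theta> / 2)"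
              and k = "\<lambda>t. S * r_fun \<Delta> (t - \<alpha> - \<Delta>) + \<kappa>" and C = "S + \<kappa>"
              and u = \<alpha> and v = a and t = y and x = x and Q = Q, OF di])
          fix t z assume t: "t \<in> {\<alpha>..a}" and z: "z \<in> {t - \<Delta>..t}"
          have "z \<in> {s - \<Delta>..a}"
            using t z \<alpha> by auto
          then have "\<bar>x z\<bar> \<le> S * r_fun \<Delta> (z - \<alpha>) + \<kappa>"
            using Suc.IH unfolding \<theta>_eq \<kappa>_def by blast
          also have "S * r_fun \<Delta> (z - \<alpha>) \<le> S * r_fun \<Delta> (t - \<alpha> - \<Delta>)"
            using t z by (intro mult_left_mono r_fun_antimono[OF delay_pos] S0) (auto simp: \<alpha>_def)
          finally show "\<bar>x z\<bar> \<le> S * r_fun \<Delta> (t - \<alpha> - \<Delta>) + \<kappa>" by simp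
        next
          fix t assume t: "t \<in> {\<alpha>..a}"
          have "S * r_fun \<Delta> (t - \<alpha> - \<Delta>) \<le> S * 1"
            using t delay_pos by (intro mult_left_mono r_fun_le_1[OF delay_pos] S0) (auto simp: \<alpha>_def)
          then show "S * r_fun \<Delta> (t - \<alpha> - \<Delta>) + \<kappa> \<le> S + \<kappa>" by simp
        next
          fix t assume "t \<in> {\<alpha>..a}"
          then have t: "- \<alpha> + 1 * t \<ge> 0" by simp
          have p: "((\<lambda>t. (t - \<alpha>) * (a - t) / 2) has_real_derivative a - t - ?\<theta> / 2) (at t within {\<alpha>..a})"
            by (auto intro!: derivative_eq_intros simp: \<alpha>_def field_simps)
          have p': "((\<lambda>t. a - t - ?\<theta> / 2) has_real_derivative -1) (at t within {\<alpha>..a})"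
            by (auto intro!: derivative_eq_intros)
          show "(Q has_real_derivative S * r_deriv \<Delta> (t - \<alpha>) + \<kappa> * (a - t - ?\<theta> / 2)) (at t within {\<alpha>..a})"
            using DERIV_add[OF DERIV_cmult[OF has_real_derivative_affine[OF r_fun_has_derivative[OF delay_pos t] sub], of S]
                DERIV_cmult[OF p, of \<kappa>]]
            unfolding Q_def[abs_def] by simp
          show "((\<lambda>t. S * r_deriv \<Delta> (t - \<alpha>) + \<kappa> * (a - t - ?\<theta> / 2)) has_real_derivative
              - (S * r_fun \<Delta> (t - \<alpha> - \<Delta>) + \<kappa>)) (at t within {\<alpha>..a})"
            using DERIV_add[OF DERIV_cmult[OF has_real_derivative_affine[OF r_deriv_has_derivative[OF delay_pos t] sub], of S]
                DERIV_cmult[OF p', of \<kappa>]]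
            by simp
        next
          show "\<bar>x \<alpha>\<bar> \<le> Q \<alpha>"
            using S[of \<alpha>] \<alpha> delay_pos r_fun_nonpos[OF delay_pos, of 0] by (simp add: Q_def)
          have "a - \<alpha> = ?\<theta>"
            by (simp add: \<alpha>_def)
          then show "\<bar>x a\<bar> \<le> Q a"
            using \<open>x a = 0\<close> r_fun_vartheta[OF delay_pos] by (simp add: Q_def)
        qed (use delay_pos \<alpha> y False in \<open>auto simp: \<alpha>_def\<close>)
        also have "Q y \<le> S * r_fun \<Delta> (?\<theta> + y - a) + S * ?q ^ Suc n"
        proof -
          have "0 \<le> ((y - \<alpha>) - (a - y))\<^sup>2"
            by simp
          moreover have "((y - \<alpha>) - (a - y))\<^sup>2 = (a - \<alpha>)\<^sup>2 - 4 * ((y - \<alpha>) * (a - y))"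
            by (simp add: power2_eq_square algebra_simps)
          moreover have "(a - \<alpha>)\<^sup>2 = ?\<theta>\<^sup>2"
            by (simp add: \<alpha>_def)
          ultimately have "(y - \<alpha>) * (a - y) / 2 \<le> ?q"
            by linarith
          then have "\<kappa> * ((y - \<alpha>) * (a - y) / 2) \<le> \<kappa> * ?q"
            using \<kappa> by (rule mult_left_mono)
          moreover have "\<kappa> * ?q = S * ?q ^ Suc n"
            by (simp add: \<kappa>_def)
          ultimately show ?thesis
            unfolding Q_def \<theta>_eq by linarith
        qed
        finally show ?thesis .
      qed
    qed
  qed
  have "?q \<le> 3 / 8"
    using vartheta_square_le_3[OF delay_pos] by simp
  then have "(\<lambda>n. ?q ^ n) \<longlonglongrightarrow> 0"
    by (intro LIMSEQ_power_zero) (simp add: power2_eq_square)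
  then have "(\<lambda>n. S * r_fun \<Delta> (?\<theta> + y - a) + S * ?q ^ n) \<longlonglongrightarrow> S * r_fun \<Delta> (?\<theta> + y - a) + S * 0"
    by (intro tendsto_add tendsto_mult tendsto_const)
  then have "\<bar>x y\<bar> \<le> S * r_fun \<Delta> (?\<theta> + y - a) + S * 0"
    by (rule LIMSEQ_le_const) (use approx y in blast)
  then show ?thesis by simp
qed

text \<open>The origin of the maximum in \<open>Psi_kernel\<close>. A delayed argument after
  \<open>a\<close> is covered by the increasing bound with \<beta>; one before \<open>a\<close> is
  covered by the bound with \<open>r_fun\<close>, and then \<open>t\<close> is within \<Delta> of
  \<open>a\<close>, so the indicator is 1. The ratio \<open>S / M\<close> is kept because
  \<open>S < M\<close> will yield the strict gain.\<close>

lemma past_le_kernel: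
  assumes M: "M > 0" and a: "s \<le> a"
    and before: "\<And>y. y \<in> {s - \<Delta>..a} \<Longrightarrow> \<bar>x y\<bar> \<le> S * r_fun \<Delta> (vartheta \<Delta> + y - a)" and S0: "S \<ge> 0"
    and after: "\<And>y. y \<in> {a..b} \<Longrightarrow> \<bar>x y\<bar> \<le> M * beta_seq 1 \<Delta> n (- (y - a))"
    and t: "t \<in> {a..b}" and y: "y \<in> {t - \<Delta>..t}"
  shows "\<bar>x y\<bar> \<le> M * Psi_kernel (S / M) \<Delta> (beta_seq 1 \<Delta> n) (- (t - a))"
proof (cases "y \<ge> a")
  case True
  have "\<bar>x y\<bar> \<le> M * beta_seq 1 \<Delta> n (- (y - a))"
    using True t y by (intro after) auto
  also have "\<dots> \<le> M * beta_seq 1 \<Delta> n (- (t - a))"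
    using True y M by (intro mult_left_mono beta_seq_mono[OF delay_pos]) auto
  also have "\<dots> \<le> M * Psi_kernel (S / M) \<Delta> (beta_seq 1 \<Delta> n) (- (t - a))"
    using M by (intro mult_left_mono) (auto simp: Psi_kernel_def)
  finally show ?thesis .
next
  case False
  have "\<bar>x y\<bar> \<le> S * r_fun \<Delta> (vartheta \<Delta> + y - a)"
    using False t y a by (intro before) auto
  also have "\<dots> \<le> S * r_fun \<Delta> (vartheta \<Delta> - (- (t - a)) - \<Delta>)"
    using False t y by (intro mult_left_mono r_fun_antimono[OF delay_pos] S0) auto
  also have "\<dots> = M * (S / M * r_fun \<Delta> (vartheta \<Delta> - (- (t - a)) - \<Delta>) * indicator {-\<Delta>..0} (- (t - a)))"
    using False t y M by simp
  also have "\<dots> \<le> M * Psi_kernel (S / M) \<Delta> (beta_seq 1 \<Delta> n) (- (t - a))"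
    using M unfolding Psi_kernel_def by (intro mult_left_mono max.cobounded2) auto
  finally show ?thesis .
qed

lemma Psi_kernel_mono_rho:
  assumes "\<rho> \<le> \<rho>'" and "\<sigma> \<ge> 0"
  shows "Psi_kernel \<rho> \<Delta> b (- \<sigma>) \<le> Psi_kernel \<rho>' \<Delta> b (- \<sigma>)"
proof -
  have "\<rho> * r_fun \<Delta> (min (vartheta \<Delta>) (vartheta \<Delta> - - \<sigma> - \<Delta>))
      \<le> \<rho>' * r_fun \<Delta> (min (vartheta \<Delta>) (vartheta \<Delta> - - \<sigma> - \<Delta>))"
    using assms by (intro mult_right_mono r_fun_nonneg[OF delay_pos]) auto
  then show ?thesis
    using assms(2) by (subst (1 2) Psi_kernel_eq[OF delay_pos]) auto
qed

text \<open>The recursion for \<open>beta_seq\<close> is the barrier problem itself: a bound with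
  index \<open>n\<close> on the past makes the profile with index \<open>Suc n\<close> a
  barrier.\<close>

lemma semicycle_rise_le:
  assumes di: "delay_inequality \<Delta> s x x'" and a: "s \<le> a" and ab: "a \<le> b"
    and before: "\<And>y. y \<in> {s - \<Delta>..a} \<Longrightarrow> \<bar>x y\<bar> \<le> S * r_fun \<Delta> (vartheta \<Delta> + y - a)" and S0: "S \<ge> 0"
    and x: "\<And>y. y \<in> {a..b} \<Longrightarrow> 0 \<le> x y" "\<And>y. y \<in> {a..b} \<Longrightarrow> x y \<le> M" "x a = 0" "x b = 0"
    and M: "M > 0" "S \<le> M" and t: "t \<in> {a..b}"
  shows "x t \<le> M * beta_seq 1 \<Delta> n (- (t - a))"
proof -
  have "\<forall>t\<in>{a..b}. x t \<le> M * beta_seq 1 \<Delta> n (- (t - a))"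
  proof (induction n)
    case 0
    then show ?case using x by simp
  next
    case (Suc n)
    let ?w = "varpi 1 \<Delta> n"
    obtain B' where B': "rise_profile (\<lambda>\<sigma>. Psi_kernel 1 \<Delta> (beta_seq 1 \<Delta> n) (- \<sigma>)) ?w
        (\<lambda>\<sigma>. beta_seq 1 \<Delta> (Suc n) (- \<sigma>)) B'"
      using rise_profile_beta_seq[OF delay_pos] by blast
    show ?case
    proof
      fix t assume t: "t \<in> {a..b}"
      show "x t \<le> M * beta_seq 1 \<Delta> (Suc n) (- (t - a))"
      proof (cases "t \<ge> a + ?w")
        case True
        then have "beta_seq 1 \<Delta> (Suc n) (- (t - a)) = 1"
          by (intro rise_profileD(4)[OF B']) auto
        then show ?thesis using x(2)[OF t] by simp
      next
        case False
        \<comment> \<open>At the right end either \<open>x\<close> is 0, if the semicycle ends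
          first, or the profile has reached 1 and the bound \<open>M\<close> applies.\<close>
        define v where "v = min b (a + ?w)"
        have sub: "{a..v} \<subseteq> {a..b}" "(\<lambda>t. - a + 1 * t) ` {a..v} \<subseteq> {0..?w}"
          by (auto simp: v_def)
        show ?thesis
        proof (rule delay_barrier[where k = "\<lambda>t. M * Psi_kernel 1 \<Delta> (beta_seq 1 \<Delta> n) (- (t - a))"
              and Q' = "\<lambda>t. M * B' (t - a)" and C = M and u = a and v = v and t = t and x = x
              and Q = "\<lambda>t. M * beta_seq 1 \<Delta> (Suc n) (- (t - a))", OF di _ a])
          fix t y assume ty: "t \<in> {a..v}" "y \<in> {t - \<Delta>..t}"
          have "\<bar>x y\<bar> \<le> M * Psi_kernel (S / M) \<Delta> (beta_seq 1 \<Delta> n) (- (t - a))"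
            using Suc.IH x(1) ty sub by (intro past_le_kernel[OF M(1) a before S0]) auto
          also have "\<dots> \<le> M * Psi_kernel 1 \<Delta> (beta_seq 1 \<Delta> n) (- (t - a))"
            using M ty by (intro mult_left_mono Psi_kernel_mono_rho) auto
          finally show "\<bar>x y\<bar> \<le> M * Psi_kernel 1 \<Delta> (beta_seq 1 \<Delta> n) (- (t - a))" .
        next
          fix t assume ty: "t \<in> {a..v}"
          have "M * Psi_kernel 1 \<Delta> (beta_seq 1 \<Delta> n) (- (t - a)) \<le> M * 1"
            using M ty by (intro mult_left_mono kernel_le_1[OF delay_pos]) auto
          then show "M * Psi_kernel 1 \<Delta> (beta_seq 1 \<Delta> n) (- (t - a)) \<le> M" by simp
        next
          fix t assume ty: "t \<in> {a..v}"
          have in': "- a + 1 * t \<in> {0..?w}"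
            using ty sub by auto
          show "((\<lambda>t. M * beta_seq 1 \<Delta> (Suc n) (- (t - a))) has_real_derivative M * B' (t - a)) (at t within {a..v})"
            using DERIV_cmult[OF has_real_derivative_affine[OF rise_profileD(5)[OF B' in'] sub(2)], of M]
            by simp
          show "((\<lambda>t. M * B' (t - a)) has_real_derivative
              - (M * Psi_kernel 1 \<Delta> (beta_seq 1 \<Delta> n) (- (t - a)))) (at t within {a..v})"
            using DERIV_cmult[OF has_real_derivative_affine[OF rise_profileD(6)[OF B' in'] sub(2)], of M]
            by simp
        next
          show "x a \<le> M * beta_seq 1 \<Delta> (Suc n) (- (a - a))"
            using x(3) beta_seq_Suc_0[OF delay_pos] by simp
          show "x v \<le> M * beta_seq 1 \<Delta> (Suc n) (- (v - a))"
          proof (cases "b \<le> a + ?w")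
            case True
            have "0 \<le> M * beta_seq 1 \<Delta> (Suc n) (- (b - a))"
              using M ab by (intro mult_nonneg_nonneg beta_seq_nonneg[OF delay_pos]) auto
            then show ?thesis
              using True x(4) by (simp add: v_def)
          next
            case False
            then have "beta_seq 1 \<Delta> (Suc n) (- (v - a)) = 1"
              by (intro rise_profileD(4)[OF B']) (auto simp: v_def)
            moreover have "v \<in> {a..b}"
              using False ab varpi_pos[OF delay_pos, of n] by (auto simp: v_def)
            ultimately show ?thesis
              using x(2)[of v] by simp
          qed
        qed (use delay_pos t False in \<open>auto simp: v_def\<close>)
      qed
    qed
  qed
  then show ?thesis using t by blast
qed

end

section \<open>One-sided powers and the equation without delay\<close>

lemma max_reflected_power_has_derivative:
  fixes e :: real
  assumes "n > 0"
  shows "((\<lambda>t. max 0 (e - t) ^ Suc n) has_real_derivative - (of_nat (Suc n) * max 0 (e - t) ^ n)) (at t within T)"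
proof -
  have "((\<lambda>z. max 0 (z - 0) ^ Suc n) has_real_derivative of_nat (Suc n) * max 0 (e + (-1) * t - 0) ^ n)
      (at (e + (-1) * t) within UNIV)"
    by (rule max_power_has_derivative[OF assms])
  from has_real_derivative_affine[OF this, of T] show ?thesis
    by simp
qed

text \<open>Let \<mu> be the largest ratio of \<open>x\<close> to a cosine centred at the midpoint;
  on an interval shorter than \<pi> this cosine is positive even at the ends. Subtracting its end
  value leaves the second derivative unchanged, so the lowered cosine is still a barrier, which
  fails where the ratio is attained.\<close>

lemma no_semicycle_shorter_than_pi:
  assumes di: "delay_inequality 0 s x x'" and a: "s \<le> a" and ab: "a < b" "b - a < pi"
    and x: "\<And>t. t \<in> {a<..<b} \<Longrightarrow> x t > 0" "x a = 0" "x b = 0"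
  shows False
proof -
  define m where "m = (a + b) / 2"
  define \<phi> where "\<phi> t = cos (t - m)" for t
  have \<phi>_pos: "\<phi> t > 0" if "t \<in> {a..b}" for t
    unfolding \<phi>_def using that ab by (intro cos_gt_zero_pi) (auto simp: m_def field_simps)
  have "continuous_on {a..b} x"
    using a by (intro delay_inequality_continuous_on[OF di]) auto
  moreover have "continuous_on {a..b} \<phi>"
    unfolding \<phi>_def by (intro continuous_intros)
  ultimately have "continuous_on {a..b} (\<lambda>t. x t / \<phi> t)"
    using \<phi>_pos by (intro continuous_on_divide) force+
  then obtain t1 where t1: "t1 \<in> {a..b}" "\<forall>t\<in>{a..b}. x t / \<phi> t \<le> x t1 / \<phi> t1"
    using continuous_attains_sup[of "{a..b}" "\<lambda>t. x t / \<phi> t"] ab by auto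
  define \<mu> where "\<mu> = x t1 / \<phi> t1"
  have m: "m \<in> {a<..<b}"
    using ab by (auto simp: m_def)
  have "0 < x m / \<phi> m"
    using x(1)[OF m] \<phi>_pos[of m] m by simp
  also have "\<dots> \<le> \<mu>"
    using t1(2) m by (simp add: \<mu>_def)
  finally have \<mu>: "\<mu> > 0" .
  have le: "x t \<le> \<mu> * \<phi> t" if "t \<in> {a..b}" for t
  proof -
    have "x t / \<phi> t \<le> \<mu>"
      using t1(2) that by (simp add: \<mu>_def)
    then show ?thesis
      using \<phi>_pos[OF that] by (simp add: pos_divide_le_eq)
  qed
  have nonneg: "x t \<ge> 0" if "t \<in> {a..b}" for t
    using x(1)[of t] x(2,3) that by (cases "t = a \<or> t = b") auto
  have \<phi>a: "\<phi> a = \<phi> b"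
  proof -
    have "a - m = - (b - m)"
      by (simp add: m_def field_simps)
    then show ?thesis
      by (simp only: \<phi>_def cos_minus)
  qed
  have "x t1 \<le> \<mu> * (\<phi> t1 - \<phi> b)"
  proof (rule delay_barrier[where k = "\<lambda>t. \<mu> * \<phi> t" and C = \<mu> and Q' = "\<lambda>t. \<mu> * - sin (t - m)"
        and u = a and v = b and x = x and t = t1 and Q = "\<lambda>t. \<mu> * (\<phi> t - \<phi> b)", OF di _ a])
    fix t y assume t: "t \<in> {a..b}" and "y \<in> {t - 0..t}"
    then have "y = t" by simp
    then show "\<bar>x y\<bar> \<le> \<mu> * \<phi> t"
      using le[OF t] nonneg[OF t] by simp
  next
    fix t assume "t \<in> {a..b}"
    have "\<phi> t \<le> 1"
      by (simp add: \<phi>_def)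
    then show "\<mu> * \<phi> t \<le> \<mu>"
      using \<mu> by simp
    show "((\<lambda>t. \<mu> * (\<phi> t - \<phi> b)) has_real_derivative \<mu> * - sin (t - m)) (at t within {a..b})"
      unfolding \<phi>_def by (auto intro!: derivative_eq_intros)
    show "((\<lambda>t. \<mu> * - sin (t - m)) has_real_derivative - (\<mu> * \<phi> t)) (at t within {a..b})"
      unfolding \<phi>_def by (auto intro!: derivative_eq_intros)
  qed (use x t1 \<phi>a in auto)
  moreover have "x t1 = \<mu> * \<phi> t1"
    using \<phi>_pos[OF t1(1)] by (simp add: \<mu>_def)
  moreover have "\<mu> * \<phi> b > 0"
    using \<mu> \<phi>_pos[of b] ab by simp
  ultimately show False
    by (simp add: right_diff_distrib)
qed

section \<open>Strict estimates and contraction on short semicycles\<close>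

context
  fixes \<Delta> :: real
  assumes delay_pos: "\<Delta> > 0"
begin

text \<open>Close to the zero the term with \<open>r_fun\<close> dominates, because profiles of
  positive index grow there at most like 2 \<sigma>, uniformly in \<open>n\<close>; so a factor
  \<rho> below 1 lowers the kernel. The loss is stated as a wedge and not as a jump, so that the
  derivative of the corrected barrier stays differentiable everywhere.\<close>

lemma Psi_kernel_gap:
  assumes \<rho>: "0 \<le> \<rho>" "\<rho> < 1"
  obtains \<delta> \<kappa> where "0 < \<delta>" "\<delta> \<le> 1" "\<delta> < varpi 1 \<Delta> 0" "0 < \<kappa>"
    "\<And>n \<sigma>. \<sigma> \<ge> 0 \<Longrightarrow> Psi_kernel \<rho> \<Delta> (beta_seq 1 \<Delta> (Suc n)) (- \<sigma>)
       \<le> Psi_kernel 1 \<Delta> (beta_seq 1 \<Delta> (Suc n)) (- \<sigma>) - \<kappa> * max 0 (\<delta> - \<sigma>)"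
proof -
  define g where "g = r_fun \<Delta> (vartheta \<Delta> - \<Delta> / 2)"
  have g: "0 < g" "g \<le> 1"
    unfolding g_def using delay_pos by (auto intro: r_fun_pos[OF delay_pos] r_fun_le_1[OF delay_pos])
  \<comment> \<open>\<open>\<Delta> / 2\<close> keeps the term with \<open>r_fun\<close> at least
    \<open>g\<close>; \<open>g / 4\<close> and the slope 2 keep the profile at most
    \<open>g / 2\<close>; the last bound ends the wedge before the top of every profile.\<close>
  define \<delta> where "\<delta> = min (min (\<Delta> / 2) (g / 4)) (varpi 1 \<Delta> 0 / 2)"
  have \<delta>: "0 < \<delta>" "\<delta> \<le> \<Delta> / 2" "\<delta> \<le> g / 4" "\<delta> < varpi 1 \<Delta> 0"
    using g delay_pos varpi_pos[OF delay_pos, of 0] by (auto simp: \<delta>_def min_def)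
  define \<kappa> where "\<kappa> = (1 - \<rho>) / 2 * g"
  have \<kappa>: "\<kappa> > 0"
    using \<rho> g by (simp add: \<kappa>_def)
  have "Psi_kernel \<rho> \<Delta> (beta_seq 1 \<Delta> (Suc n)) (- \<sigma>)
      \<le> Psi_kernel 1 \<Delta> (beta_seq 1 \<Delta> (Suc n)) (- \<sigma>) - \<kappa> * max 0 (\<delta> - \<sigma>)" if \<sigma>: "\<sigma> \<ge> 0" for n \<sigma>
  proof (cases "\<sigma> < \<delta>")
    case False
    then show ?thesis
      using Psi_kernel_mono_rho[OF delay_pos, of \<rho> 1 \<sigma>] \<rho> \<sigma> by simp
  next
    case True
    define G where "G = r_fun \<Delta> (vartheta \<Delta> - (- \<sigma>) - \<Delta>)"
    have G: "g \<le> G"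
      unfolding g_def G_def using True \<delta> \<sigma> by (intro r_fun_antimono[OF delay_pos]) auto
    have b: "beta_seq 1 \<Delta> (Suc n) (- \<sigma>) \<le> g / 2"
      using beta_seq_Suc_le_linear[OF delay_pos \<sigma>, of n] True \<delta> by linarith
    have ind: "indicator {-\<Delta>..0} (- \<sigma>) = (1::real)"
      using True \<delta> \<sigma> by simp
    have \<rho>G: "0 \<le> \<rho> * G" "\<rho> * G \<le> 1 * G" "(1 - \<rho>) * g \<le> (1 - \<rho>) * G"
      using \<rho> g G by (auto intro: mult_left_mono mult_right_mono)
    define H where "H = \<rho> * G"
    have H: "0 \<le> H" "H \<le> G"
      using \<rho>G by (simp_all add: H_def)
    have "max (beta_seq 1 \<Delta> (Suc n) (- \<sigma>)) H \<le> (G + H) / 2"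
    proof (rule max.boundedI)
      show "beta_seq 1 \<Delta> (Suc n) (- \<sigma>) \<le> (G + H) / 2"
        using b G H by argo
      show "H \<le> (G + H) / 2"
        using H by argo
    qed
    also have "(G + H) / 2 = (1 + \<rho>) / 2 * G"
      by (simp add: H_def field_simps)
    finally have "Psi_kernel \<rho> \<Delta> (beta_seq 1 \<Delta> (Suc n)) (- \<sigma>) \<le> (1 + \<rho>) / 2 * G"
      unfolding Psi_kernel_def ind G_def[symmetric] H_def mult_1_right .
    moreover have "G \<le> Psi_kernel 1 \<Delta> (beta_seq 1 \<Delta> (Suc n)) (- \<sigma>)"
      unfolding Psi_kernel_def ind G_def[symmetric] by simp
    moreover have "(1 + \<rho>) / 2 * G = G - (1 - \<rho>) / 2 * G"
      by (simp add: field_simps)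
    moreover have "\<kappa> \<le> (1 - \<rho>) / 2 * G"
      using \<rho>G by (simp add: \<kappa>_def)
    moreover have "\<kappa> * max 0 (\<delta> - \<sigma>) \<le> \<kappa> * 1"
      using \<kappa> \<delta> g \<sigma> by (intro mult_left_mono) auto
    ultimately show ?thesis by linarith
  qed
  then show ?thesis
    using that \<delta> \<kappa> g by force
qed

text \<open>Otherwise the rise would take exactly \<Psi>, since it takes at least every
  \<open>varpi\<close>. The gap then puts \<open>x\<close> below a line of slope \<mu> ending at the
  maximum, which is incompatible with a zero derivative at that interior maximum.\<close>

lemma semicycle_rise_longer_than_Psi:
  assumes di: "delay_inequality \<Delta> s x x'" and a: "s \<le> a"
    and before: "\<And>y. y \<in> {s - \<Delta>..a} \<Longrightarrow> \<bar>x y\<bar> \<le> S * r_fun \<Delta> (vartheta \<Delta> + y - a)"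
    and S: "0 \<le> S" "S < M"
    and x: "\<And>y. y \<in> {a..b} \<Longrightarrow> 0 \<le> x y" "\<And>y. y \<in> {a..b} \<Longrightarrow> x y \<le> M" "x a = 0" "x b = 0"
    and m: "a < m" "m < b" "x m = M"
  shows "Psi 1 \<Delta> < m - a"
proof (rule ccontr)
  assume "\<not> Psi 1 \<Delta> < m - a"
  have M: "M > 0"
    using S by simp
  have rise: "x t \<le> M * beta_seq 1 \<Delta> n (- (t - a))" if "t \<in> {a..b}" for t n
    using m S by (intro semicycle_rise_le[OF delay_pos di a _ before S(1) x M _ that]) auto
  have "varpi 1 \<Delta> n \<le> m - a" for n
  proof (rule ccontr)
    assume "\<not> varpi 1 \<Delta> n \<le> m - a"
    then have "M * beta_seq 1 \<Delta> (Suc n) (- (m - a)) < M * 1"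
      using m M by (intro mult_strict_left_mono beta_seq_Suc_less_1[OF delay_pos]) auto
    then show False
      using rise[of m "Suc n"] m by simp
  qed
  then have "Psi 1 \<Delta> \<le> m - a"
    by (intro LIMSEQ_le_const2[OF varpi_tendsto_Psi[OF delay_pos]]) auto
  then have Psi_eq: "Psi 1 \<Delta> = m - a"
    using \<open>\<not> Psi 1 \<Delta> < m - a\<close> by simp
  obtain \<delta> \<kappa> where \<delta>: "0 < \<delta>" "\<delta> \<le> 1" "\<delta> < varpi 1 \<Delta> 0" and \<kappa>: "0 < \<kappa>"
    and gap: "\<And>n \<sigma>. \<sigma> \<ge> 0 \<Longrightarrow> Psi_kernel (S / M) \<Delta> (beta_seq 1 \<Delta> (Suc n)) (- \<sigma>)
       \<le> Psi_kernel 1 \<Delta> (beta_seq 1 \<Delta> (Suc n)) (- \<sigma>) - \<kappa> * max 0 (\<delta> - \<sigma>)"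
    using Psi_kernel_gap[of "S / M"] S M by auto
  have \<delta>_varpi: "\<delta> < varpi 1 \<Delta> n" for n
    using \<delta>(3) lift_Suc_mono_le[of "varpi 1 \<Delta>" 0 n] varpi_le_Suc[OF delay_pos] by fastforce
  \<comment> \<open>\<open>\<delta> ^ 3 / 12\<close> is a lower bound for the slope \<open>c\<close>
    below that is valid for all \<open>n\<close>, because all widths are at most 2; the line must
    not flatten in the limit.\<close>
  define \<mu> where "\<mu> = M * \<kappa> * (\<delta> ^ 3 / 12)"
  have \<mu>: "\<mu> > 0"
    using M \<kappa> \<delta> by (simp add: \<mu>_def)
  text \<open>
    Near the zero \<open>a\<close> the past is strictly below the barrier, which pushes the barrier down by
    \<open>\<kappa> \<phi>\<close>, where \<open>\<phi>'' = - (\<delta> - \<sigma>)\<^sub>+\<close> and \<open>\<phi>\<close> vanishes at \<open>0\<close> and at \<open>\<varpi>\<^sub>n\<close>.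
  \<close>
  have cone: "x (a + \<sigma>) \<le> M - \<mu> * (varpi 1 \<Delta> (Suc n) - \<sigma>)"
    if \<sigma>: "\<delta> \<le> \<sigma>" "\<sigma> \<le> varpi 1 \<Delta> (Suc n)" for n \<sigma>
  proof -
    let ?w = "varpi 1 \<Delta> (Suc n)" and ?K = "\<lambda>t. Psi_kernel 1 \<Delta> (beta_seq 1 \<Delta> (Suc n)) (- (t - a))"
    define e where "e = a + \<delta>"
    obtain B' where B': "rise_profile (\<lambda>\<sigma>. Psi_kernel 1 \<Delta> (beta_seq 1 \<Delta> (Suc n)) (- \<sigma>)) ?w
        (\<lambda>\<sigma>. beta_seq 1 \<Delta> (Suc (Suc n)) (- \<sigma>)) B'"
      using rise_profile_beta_seq[OF delay_pos] by blast
    \<comment> \<open>The slope for which the linear part cancels the cubic part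
      \<open>\<delta> ^ 3 / 6\<close> at the zero \<open>a\<close>.\<close>
    define c where "c = \<delta> ^ 3 / (6 * ?w)"
    have w: "0 < ?w" "?w \<le> 2" "?w \<le> m - a" "\<delta> < ?w"
      using varpi_pos[OF delay_pos] varpi_le_2[OF delay_pos] varpi_le_Psi[OF delay_pos, of "Suc n"]
        Psi_eq \<delta>_varpi by auto
    have sub: "(\<lambda>t. - a + 1 * t) ` {a..a + ?w} \<subseteq> {0..?w}"
      by auto
    define \<phi> where "\<phi> t = c * (?w - (t - a)) - max 0 (e - t) ^ 3 / 6" for t
    define Q where "Q t = M * (beta_seq 1 \<Delta> (Suc (Suc n)) (- (t - a)) - \<kappa> * \<phi> t)" for t
    have "x (a + \<sigma>) \<le> Q (a + \<sigma>)"
    proof (rule delay_barrier[where k = "\<lambda>t. M * (?K t - \<kappa> * max 0 (e - t))"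
          and Q' = "\<lambda>t. M * (B' (t - a) - \<kappa> * (- c + max 0 (e - t) ^ 2 / 2))" and C = M
          and u = a and v = "a + ?w" and t = "a + \<sigma>" and x = x and Q = Q, OF di _ a])
      fix t y assume t: "t \<in> {a..a + ?w}" and y: "y \<in> {t - \<Delta>..t}"
      have ab: "t \<in> {a..b}"
        using t w m by auto
      have "\<bar>x y\<bar> \<le> M * Psi_kernel (S / M) \<Delta> (beta_seq 1 \<Delta> (Suc n)) (- (t - a))"
      proof (rule past_le_kernel[OF delay_pos M a before S(1) _ ab y])
        show "\<bar>x z\<bar> \<le> M * beta_seq 1 \<Delta> (Suc n) (- (z - a))" if "z \<in> {a..b}" for z
          using rise[OF that, of "Suc n"] x(1)[OF that] by simp
      qed
      also have "\<dots> \<le> M * (?K t - \<kappa> * max 0 (\<delta> - (t - a)))"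
        using t M by (intro mult_left_mono gap) auto
      also have "\<delta> - (t - a) = e - t"
        by (simp add: e_def)
      finally show "\<bar>x y\<bar> \<le> M * (?K t - \<kappa> * max 0 (e - t))" .
    next
      fix t assume t: "t \<in> {a..a + ?w}"
      have "?K t \<le> 1"
        using t by (intro kernel_le_1[OF delay_pos]) auto
      moreover have "0 \<le> \<kappa> * max 0 (e - t)"
        using \<kappa> by simp
      ultimately have "M * (?K t - \<kappa> * max 0 (e - t)) \<le> M * 1"
        using M by (intro mult_left_mono) auto
      then show "M * (?K t - \<kappa> * max 0 (e - t)) \<le> M" by simp
    next
      fix t assume t: "t \<in> {a..a + ?w}"
      have in': "- a + 1 * t \<in> {0..?w}"
        using t by auto
      have d1: "((\<lambda>t. beta_seq 1 \<Delta> (Suc (Suc n)) (- (t - a))) has_real_derivative B' (t - a)) (at t within {a..a + ?w})"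
        using has_real_derivative_affine[OF rise_profileD(5)[OF B' in'] sub] by simp
      have d2: "((\<lambda>t. B' (t - a)) has_real_derivative - ?K t) (at t within {a..a + ?w})"
        using has_real_derivative_affine[OF rise_profileD(6)[OF B' in'] sub] by simp
      have d3: "((\<lambda>t. max 0 (e - t) ^ 3) has_real_derivative - (3 * max 0 (e - t) ^ 2)) (at t within {a..a + ?w})"
        using max_reflected_power_has_derivative[of 2 e t] by (simp add: numeral_3_eq_3 numeral_2_eq_2)
      have d4: "((\<lambda>t. max 0 (e - t) ^ 2) has_real_derivative - (2 * max 0 (e - t))) (at t within {a..a + ?w})"
        using max_reflected_power_has_derivative[of 1 e t] by (simp add: numeral_2_eq_2)
      have "((\<lambda>t. c * (?w - (t - a))) has_real_derivative - c) (at t within {a..a + ?w})"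
        by (auto intro!: derivative_eq_intros)
      from DERIV_diff[OF this DERIV_cdivide[OF d3, of 6]]
      have d5: "(\<phi> has_real_derivative - c + max 0 (e - t) ^ 2 / 2) (at t within {a..a + ?w})"
        unfolding \<phi>_def[abs_def] by simp
      from DERIV_cmult[OF DERIV_diff[OF d1 DERIV_cmult[OF d5, of \<kappa>]], of M]
      show "(Q has_real_derivative M * (B' (t - a) - \<kappa> * (- c + max 0 (e - t) ^ 2 / 2))) (at t within {a..a + ?w})"
        unfolding Q_def[abs_def] .
      have "((\<lambda>t. - c + max 0 (e - t) ^ 2 / 2) has_real_derivative 0 + - (2 * max 0 (e - t)) / 2) (at t within {a..a + ?w})"
        by (intro DERIV_add DERIV_const DERIV_cdivide d4)
      from DERIV_cmult[OF DERIV_diff[OF d2 DERIV_cmult[OF this, of \<kappa>]], of M]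
      show "((\<lambda>t. M * (B' (t - a) - \<kappa> * (- c + max 0 (e - t) ^ 2 / 2))) has_real_derivative
          - (M * (?K t - \<kappa> * max 0 (e - t)))) (at t within {a..a + ?w})"
        by (simp add: algebra_simps)
    next
      have "\<phi> a = 0"
        using w \<delta> by (simp add: \<phi>_def c_def e_def)
      then show "x a \<le> Q a"
        using x(3) beta_seq_Suc_0[OF delay_pos] by (simp add: Q_def)
      have "\<phi> (a + ?w) = 0"
        using w by (simp add: \<phi>_def e_def)
      moreover have "beta_seq 1 \<Delta> (Suc (Suc n)) (- (a + ?w - a)) = 1"
        by (intro rise_profileD(4)[OF B']) auto
      moreover have "x (a + ?w) \<le> M"
        using w m by (intro x(2)) auto
      ultimately show "x (a + ?w) \<le> Q (a + ?w)"
        by (simp add: Q_def)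
    qed (use delay_pos \<sigma> \<delta> in auto)
    also have "\<dots> = M * beta_seq 1 \<Delta> (Suc (Suc n)) (- \<sigma>) - M * \<kappa> * (c * (?w - \<sigma>))"
      using \<sigma> by (simp add: Q_def \<phi>_def e_def algebra_simps)
    also have "\<dots> \<le> M - \<mu> * (?w - \<sigma>)"
    proof -
      have "\<delta> ^ 3 / 12 \<le> c"
        unfolding c_def using w \<delta> by (intro divide_left_mono) auto
      then have "M * \<kappa> * ((\<delta> ^ 3 / 12) * (?w - \<sigma>)) \<le> M * \<kappa> * (c * (?w - \<sigma>))"
        using M \<kappa> \<sigma> by (intro mult_left_mono mult_right_mono) auto
      moreover have "M * beta_seq 1 \<Delta> (Suc (Suc n)) (- \<sigma>) \<le> M * 1"
        using M \<sigma> \<delta> by (intro mult_left_mono beta_seq_le_1[OF delay_pos]) auto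
      ultimately show ?thesis
        by (simp add: \<mu>_def)
    qed
    finally show ?thesis .
  qed
  have cone_limit: "x (a + \<sigma>) \<le> M - \<mu> * (m - a - \<sigma>)" if \<sigma>: "\<delta> \<le> \<sigma>" "\<sigma> < m - a" for \<sigma>
  proof -
    have lim: "(\<lambda>n. varpi 1 \<Delta> (Suc n)) \<longlonglongrightarrow> m - a"
      using LIMSEQ_Suc[OF varpi_tendsto_Psi[OF delay_pos]] Psi_eq by simp
    then have "(\<lambda>n. M - \<mu> * (varpi 1 \<Delta> (Suc n) - \<sigma>)) \<longlonglongrightarrow> M - \<mu> * (m - a - \<sigma>)"
      by (intro tendsto_diff tendsto_mult tendsto_const)
    moreover have "\<forall>\<^sub>F n in sequentially. \<sigma> < varpi 1 \<Delta> (Suc n)"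
      using order_tendstoD(1)[OF lim \<sigma>(2)] .
    then have "\<forall>\<^sub>F n in sequentially. x (a + \<sigma>) \<le> M - \<mu> * (varpi 1 \<Delta> (Suc n) - \<sigma>)"
      by eventually_elim (use cone \<sigma> in auto)
    ultimately show ?thesis
      by (intro tendsto_lowerbound) auto
  qed
  have deriv: "(x has_real_derivative x' m) (at m)"
  proof -
    have "(x has_real_derivative x' m) (at m within {s - \<Delta>..})"
      using m a delay_pos by (intro delay_inequalityD(1)[OF di]) auto
    moreover have "at m within {s - \<Delta>..} = at m"
      using m a delay_pos by (intro at_within_interior) simp
    ultimately show ?thesis by simp
  qed
  have "x' m = 0"
  proof (rule DERIV_local_max[OF deriv])
    show "0 < min (m - a) (b - m)"
      using m by simp
    show "\<forall>y. \<bar>m - y\<bar> < min (m - a) (b - m) \<longrightarrow> x y \<le> x m"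
      unfolding m(3) by (intro allI impI x(2)) (auto simp: abs_less_iff)
  qed
  then have "((\<lambda>t. x t - \<mu> * t) has_real_derivative - \<mu>) (at m)"
    using deriv by (auto intro!: derivative_eq_intros)
  then obtain d where d: "d > 0" "\<And>h. \<lbrakk>h > 0; h < d\<rbrakk> \<Longrightarrow> x m - \<mu> * m < x (m - h) - \<mu> * (m - h)"
    using DERIV_neg_dec_left[of "\<lambda>t. x t - \<mu> * t" "- \<mu>" m] \<mu> by auto
  define h where "h = min (d / 2) (m - a - \<delta>)"
  have "\<delta> < m - a"
    using \<delta>_varpi[of 0] varpi_le_Psi[OF delay_pos, of 0] Psi_eq by simp
  then have h: "0 < h" "h < d" "\<delta> \<le> m - a - h"
    using d(1) by (auto simp: h_def)
  have "x (m - h) \<le> M - \<mu> * h"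
    using cone_limit[of "m - a - h"] h by (simp add: algebra_simps)
  moreover have "x m - \<mu> * m < x (m - h) - \<mu> * (m - h)"
    using d(2) h by blast
  ultimately show False
    using m(3) by (simp add: algebra_simps)
qed

lemma semicycle_bound_preserved:
  assumes di: "delay_inequality \<Delta> s x x'" and a: "s + vartheta \<Delta> \<le> a" and ab: "a < b"
    and pos: "\<And>t. t \<in> {a<..<b} \<Longrightarrow> x t > 0" and zeros: "x a = 0" "x b = 0"
    and S: "\<And>y. y \<in> {s - \<Delta>..a} \<Longrightarrow> \<bar>x y\<bar> \<le> S"
    and short: "b - a \<le> Psi 1 \<Delta> + vartheta \<Delta>" and t: "t \<in> {a..b}"
  shows "x t \<le> S"
proof -
  have sa: "s \<le> a" "a \<in> {s - \<Delta>..a}"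
    using a vartheta_pos[OF delay_pos] delay_pos by auto
  have nonneg: "x y \<ge> 0" if "y \<in> {a..b}" for y
    using pos[of y] zeros that by (cases "y = a \<or> y = b") auto
  have "continuous_on {a..b} x"
    using sa by (intro delay_inequality_continuous_on[OF di]) auto
  then obtain m where m: "m \<in> {a..b}" "\<forall>y\<in>{a..b}. x y \<le> x m"
    using continuous_attains_sup[of "{a..b}" x] ab by auto
  have "x m \<le> S"
  proof (rule ccontr)
    assume "\<not> x m \<le> S"
    then have M: "S < x m" by simp
    have S0: "S \<ge> 0"
      using S[OF sa(2)] by linarith
    have mab: "a < m" "m < b"
      using m(1) M S0 zeros by (auto simp: less_le)
    have "Psi 1 \<Delta> < m - a"
      by (rule semicycle_rise_longer_than_Psi[OF di sa(1) bound_before_zero[OF delay_pos di a zeros(1) S]])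
        (use S0 M nonneg m mab zeros in auto)
    \<comment> \<open>For the fall, the estimate before a zero is applied at \<open>b\<close> with
      the bound \<open>x m\<close>. This bound is attained at \<open>m\<close>, so
      \<open>r_fun\<close> cannot be below 1 there.\<close>
    moreover have "vartheta \<Delta> \<le> b - m"
    proof (rule ccontr)
      assume "\<not> vartheta \<Delta> \<le> b - m"
      then have "r_fun \<Delta> (vartheta \<Delta> + m - b) < 1"
        using mab by (intro r_fun_less_1[OF delay_pos]) auto
      then have "x m * r_fun \<Delta> (vartheta \<Delta> + m - b) < x m * 1"
        using M S0 by (intro mult_strict_left_mono) auto
      moreover have "\<bar>x m\<bar> \<le> x m * r_fun \<Delta> (vartheta \<Delta> + m - b)"
      proof (rule bound_before_zero[OF delay_pos di _ zeros(2)])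
        fix y assume y: "y \<in> {s - \<Delta>..b}"
        show "\<bar>x y\<bar> \<le> x m"
          using S[of y] M nonneg[of y] m(2) y by (cases "y \<le> a") auto
      qed (use a ab mab sa in auto)
      ultimately show False by simp
    qed
    ultimately show False
      using short by simp
  qed
  then show ?thesis
    using m(2) t by force
qed

text \<open>The factor is chosen before the solution and the semicycle, so that it can be iterated.
  A finite index with \<open>varpi\<close> already above \<open>c - vartheta \<Delta>\<close>
  replaces \<Psi>; every point is then well before the top of the rise barrier or well after the
  start of the fall, where the barriers are below 1 by a fixed amount.\<close>

lemma short_semicycles_contract:
  assumes c: "c < Psi 1 \<Delta> + vartheta \<Delta>"
  shows "\<exists>q. 0 < q \<and> q < 1 \<and> (\<forall>s x x' a b S t. delay_inequality \<Delta> s x x' \<longrightarrow>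
     s + vartheta \<Delta> \<le> a \<longrightarrow> a < b \<longrightarrow> (\<forall>t\<in>{a<..<b}. x t > 0) \<longrightarrow> x a = 0 \<longrightarrow> x b = 0 \<longrightarrow> 0 < S \<longrightarrow>
     (\<forall>y\<ge>s - \<Delta>. \<bar>x y\<bar> \<le> S) \<longrightarrow> b - a < c \<longrightarrow> t \<in> {a<..<b} \<longrightarrow> x t \<le> q * S)"
proof -
  have "\<forall>\<^sub>F n in sequentially. c - vartheta \<Delta> < varpi 1 \<Delta> n"
    using c by (intro order_tendstoD(1)[OF varpi_tendsto_Psi[OF delay_pos]]) auto
  then obtain n where n: "c - vartheta \<Delta> < varpi 1 \<Delta> n"
    by (auto dest: eventually_happens'[OF sequentially_bot])
  \<comment> \<open>Half of the surplus length is granted to each of the two cases; the other bounds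
    keep \<open>r_fun \<Delta> \<delta>\<close> positive and
    \<open>varpi 1 \<Delta> n - \<delta>\<close> nonnegative.\<close>
  define \<delta> where "\<delta> = min ((varpi 1 \<Delta> n + vartheta \<Delta> - c) / 2) (min (vartheta \<Delta> / 2) (varpi 1 \<Delta> n))"
  have \<theta>: "vartheta \<Delta> > 0"
    by (rule vartheta_pos[OF delay_pos])
  have "\<delta> \<le> (varpi 1 \<Delta> n + vartheta \<Delta> - c) / 2"
    unfolding \<delta>_def by (rule min.cobounded1)
  then have \<delta>: "0 < \<delta>" "\<delta> < vartheta \<Delta>" "\<delta> \<le> varpi 1 \<Delta> n" "c \<le> varpi 1 \<Delta> n + vartheta \<Delta> - 2 * \<delta>"
    using n \<theta> varpi_pos[OF delay_pos, of n] by (auto simp: \<delta>_def min_less_iff_disj)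
  define q where "q = max (r_fun \<Delta> \<delta>) (beta_seq 1 \<Delta> (Suc n) (- (varpi 1 \<Delta> n - \<delta>)))"
  have q: "0 < q" "q < 1"
    unfolding q_def using r_fun_pos[OF delay_pos, of \<delta>] r_fun_less_1[OF delay_pos, of \<delta>]
      beta_seq_Suc_less_1[OF delay_pos, of "varpi 1 \<Delta> n - \<delta>" n] \<delta>
    by (auto simp: less_max_iff_disj)
  show ?thesis
  proof (intro exI[of _ q] conjI allI impI q)
    fix s x x' a b S t
    assume di: "delay_inequality \<Delta> s x x'" and a: "s + vartheta \<Delta> \<le> a" and ab: "a < b"
      and pos: "\<forall>t\<in>{a<..<b}. x t > 0" and zeros: "x a = 0" "x b = 0" and S0: "0 < S"
      and S: "\<forall>y\<ge>s - \<Delta>. \<bar>x y\<bar> \<le> S" and short: "b - a < c" and t: "t \<in> {a<..<b}"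
    have sa: "s \<le> a"
      using a \<theta> by simp
    consider "t - a \<le> varpi 1 \<Delta> n - \<delta>" | "b - t \<le> vartheta \<Delta> - \<delta>"
      using short \<delta>(4) by linarith
    then show "x t \<le> q * S"
    proof cases
      case 1
      have "x t \<le> S * beta_seq 1 \<Delta> (Suc n) (- (t - a))"
      proof (rule semicycle_rise_le[OF delay_pos di sa])
        show "\<bar>x y\<bar> \<le> S * r_fun \<Delta> (vartheta \<Delta> + y - a)" if "y \<in> {s - \<Delta>..a}" for y
          using that S by (intro bound_before_zero[OF delay_pos di a zeros(1)]) auto
        show "0 \<le> x y" if "y \<in> {a..b}" for y
          using bspec[OF pos, of y] zeros that by (cases "y = a \<or> y = b") auto
        show "x y \<le> S" if "y \<in> {a..b}" for y
          using S[rule_format, of y] that sa delay_pos by auto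
      qed (use ab zeros S0 t in auto)
      also have "\<dots> \<le> S * beta_seq 1 \<Delta> (Suc n) (- (varpi 1 \<Delta> n - \<delta>))"
        using 1 t S0 by (intro mult_left_mono beta_seq_mono[OF delay_pos]) auto
      also have "\<dots> \<le> S * q"
        using S0 by (intro mult_left_mono) (auto simp: q_def)
      finally show ?thesis by (simp add: mult.commute)
    next
      case 2
      have "\<bar>x t\<bar> \<le> S * r_fun \<Delta> (vartheta \<Delta> + t - b)"
        using a ab S t sa delay_pos by (intro bound_before_zero[OF delay_pos di _ zeros(2)]) auto
      also have "\<dots> \<le> S * r_fun \<Delta> \<delta>"
        using 2 t S0 by (intro mult_left_mono r_fun_antimono[OF delay_pos]) auto
      also have "\<dots> \<le> S * q"
        using S0 by (intro mult_left_mono) (auto simp: q_def)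
      finally show ?thesis by (simp add: mult.commute)
    qed
  qed
qed

end

section \<open>From the equation to the global statements\<close>

lemma solution_delay_inequality:
  assumes [measurable]: "\<tau> \<in> borel_measurable lebesgue"
    and \<tau>: "\<And>t. 0 \<le> \<tau> t" "esssup lebesgue (\<lambda>t. ereal (\<tau> t)) < \<infinity>"
    and p: "esssup lebesgue (\<lambda>t. ereal \<bar>p t\<bar>) \<le> 1"
    and sol: "is_solution p \<tau> s x"
  shows "0 \<le> tau_max \<tau> s" and "\<exists>x'. delay_inequality (tau_max \<tau> s) s x x'"
proof -
  let ?M = "lebesgue_on {s..}" and ?\<Delta> = "tau_max \<tau> s"
  define E where "E = esssup ?M (\<lambda>t. ereal (\<tau> t))"
  have restrict: "(AE t in ?M. P t) \<longleftrightarrow> (AE t in lebesgue. t \<in> {s..} \<longrightarrow> P t)" for P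
    by (rule AE_restrict_space_iff) simp
  have meas: "(\<lambda>t. ereal (\<tau> t)) \<in> borel_measurable ?M"
    by (intro measurable_restrict_space1) simp
  have "E \<le> esssup lebesgue (\<lambda>t. ereal (\<tau> t))"
    unfolding E_def
  proof (rule esssup_I[OF meas])
    have "AE t in lebesgue. ereal (\<tau> t) \<le> esssup lebesgue (\<lambda>t. ereal (\<tau> t))"
      by (rule esssup_AE)
    then show "AE t in ?M. ereal (\<tau> t) \<le> esssup lebesgue (\<lambda>t. ereal (\<tau> t))"
      unfolding restrict by eventually_elim auto
  qed
  then have "E < \<infinity>"
    using \<tau>(2) by (rule le_less_trans)
  \<comment> \<open>On a null space the essential supremum of the constant 0 would not be 0;
    positive measure of the half-line makes the maximal delay nonnegative.\<close>
  have "emeasure ?M (space ?M) \<noteq> 0"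
  proof -
    have "emeasure lebesgue {s..s + 1} \<le> emeasure lebesgue {s..}"
      by (intro emeasure_mono) auto
    then show ?thesis
      by (auto simp: emeasure_restrict_space space_restrict_space)
  qed
  then have "esssup ?M (\<lambda>t. ereal 0) = ereal 0"
    by (rule esssup_const)
  moreover have "esssup ?M (\<lambda>t. ereal 0) \<le> E"
    unfolding E_def using \<tau>(1) by (intro esssup_mono) auto
  ultimately have "0 \<le> E"
    by (simp add: zero_ereal_def)
  then have E: "E = ereal ?\<Delta>" and \<Delta>: "0 \<le> ?\<Delta>"
    using \<open>E < \<infinity>\<close> unfolding tau_max_def E_def[symmetric] by (cases E; simp)+
  show "0 \<le> ?\<Delta>" by (rule \<Delta>)
  obtain x' where x': "\<forall>t\<ge>s - ?\<Delta>. (x has_real_derivative x' t) (at t within {s - ?\<Delta>..})"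
    "abs_cont_from (s - ?\<Delta>) x'"
    "AE t in ?M. \<exists>x''. (x' has_real_derivative x'') (at t) \<and> x'' + p t * x (t - \<tau> t) = 0"
    using sol unfolding is_solution_def Let_def by blast
  have "AE t in lebesgue. t \<in> {s..} \<longrightarrow>
      (\<exists>D. (x' has_real_derivative D) (at t) \<and> (\<exists>u\<in>{t - ?\<Delta>..t}. \<bar>D\<bar> \<le> \<bar>x u\<bar>))"
  proof -
    have "AE t in lebesgue. t \<in> {s..} \<longrightarrow> ereal (\<tau> t) \<le> E"
      unfolding restrict[symmetric] E_def by (rule esssup_AE)
    moreover have "AE t in lebesgue. ereal \<bar>p t\<bar> \<le> esssup lebesgue (\<lambda>t. ereal \<bar>p t\<bar>)"
      by (rule esssup_AE)
    moreover have "AE t in lebesgue. t \<in> {s..} \<longrightarrow>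
        (\<exists>x''. (x' has_real_derivative x'') (at t) \<and> x'' + p t * x (t - \<tau> t) = 0)"
      using x'(3) unfolding restrict .
    ultimately show ?thesis
    proof (eventually_elim, intro impI)
      fix t
      assume "t \<in> {s..} \<longrightarrow> ereal (\<tau> t) \<le> E" "ereal \<bar>p t\<bar> \<le> esssup lebesgue (\<lambda>t. ereal \<bar>p t\<bar>)"
        "t \<in> {s..} \<longrightarrow> (\<exists>x''. (x' has_real_derivative x'') (at t) \<and> x'' + p t * x (t - \<tau> t) = 0)"
        and t: "t \<in> {s..}"
      then obtain D where D: "(x' has_real_derivative D) (at t)" "D + p t * x (t - \<tau> t) = 0"
        and "\<tau> t \<le> ?\<Delta>"
        using E by auto
      have "ereal \<bar>p t\<bar> \<le> 1"
        using \<open>ereal \<bar>p t\<bar> \<le> esssup lebesgue (\<lambda>t. ereal \<bar>p t\<bar>)\<close> p by (rule order_trans)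
      then have "\<bar>p t\<bar> \<le> 1"
        by (simp add: one_ereal_def)
      have "\<bar>D\<bar> = \<bar>p t\<bar> * \<bar>x (t - \<tau> t)\<bar>"
        using D(2) by (simp add: abs_mult[symmetric] eq_neg_iff_add_eq_0[symmetric])
      also have "\<dots> \<le> 1 * \<bar>x (t - \<tau> t)\<bar>"
        using \<open>\<bar>p t\<bar> \<le> 1\<close> by (intro mult_right_mono) auto
      finally have "\<bar>D\<bar> \<le> \<bar>x (t - \<tau> t)\<bar>" by simp
      moreover have "t - \<tau> t \<in> {t - ?\<Delta>..t}"
        using \<tau>(1)[of t] \<open>\<tau> t \<le> ?\<Delta>\<close> by simp
      ultimately show "\<exists>D. (x' has_real_derivative D) (at t) \<and> (\<exists>u\<in>{t - ?\<Delta>..t}. \<bar>D\<bar> \<le> \<bar>x u\<bar>)"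
        using D(1) by blast
    qed
  qed
  then obtain N where N: "negligible N" "{t. \<not> (t \<in> {s..} \<longrightarrow>
      (\<exists>D. (x' has_real_derivative D) (at t) \<and> (\<exists>u\<in>{t - ?\<Delta>..t}. \<bar>D\<bar> \<le> \<bar>x u\<bar>)))} \<subseteq> N"
    unfolding eventually_ae_filter_negligible by blast
  have "delay_inequality ?\<Delta> s x x'"
    unfolding delay_inequality_def
  proof (intro conjI exI[of _ N])
    show "\<forall>t\<in>{s..} - N. \<exists>D. (x' has_real_derivative D) (at t) \<and> (\<exists>u\<in>{t - ?\<Delta>..t}. \<bar>D\<bar> \<le> \<bar>x u\<bar>)"
      using N(2) by blast
  qed (use x' N(1) in \<open>simp_all add: abs_cont_from_def\<close>)
  then show "\<exists>x'. delay_inequality ?\<Delta> s x x'" by blast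
qed

lemma short_semicycles_imp_bounded:
  assumes \<Delta>: "\<Delta> > 0" and di: "delay_inequality \<Delta> s x x'" and osc: "oscillatory x"
    and short: "\<And>a b. semicycle {s - \<Delta>..} x a b \<Longrightarrow> b - a \<le> Psi 1 \<Delta> + vartheta \<Delta>"
  shows "\<exists>S>0. \<forall>t\<ge>s - \<Delta>. \<bar>x t\<bar> \<le> S"
proof -
  have \<theta>: "vartheta \<Delta> > 0"
    by (rule vartheta_pos[OF \<Delta>])
  have cont: "continuous_on A x" if "A \<subseteq> {s - \<Delta>..}" for A
    using that by (rule delay_inequality_continuous_on[OF di])
  obtain t0 where t0: "t0 \<ge> s + vartheta \<Delta>" "x t0 = 0"
    using osc unfolding oscillatory_def by blast
  have attain: "\<exists>y\<in>{s - \<Delta>..a}. \<forall>z\<in>{s - \<Delta>..a}. \<bar>x z\<bar> \<le> \<bar>x y\<bar>" if "s \<le> a" for a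
    using that \<Delta> by (intro continuous_attains_sup continuous_on_rabs cont) auto
  obtain y0 where y0: "\<forall>z\<in>{s - \<Delta>..t0}. \<bar>x z\<bar> \<le> \<bar>x y0\<bar>"
    using attain[of t0] t0 \<theta> by auto
  \<comment> \<open>The summand 1 keeps \<open>S\<close> positive even if \<open>x\<close> vanishes
    up to \<open>t0\<close>.\<close>
  define S where "S = \<bar>x y0\<bar> + 1"
  have "\<bar>x t1\<bar> \<le> S" if t1: "t1 \<ge> s - \<Delta>" for t1
  proof (rule ccontr)
    assume "\<not> \<bar>x t1\<bar> \<le> S"
    then have big: "S < \<bar>x t1\<bar>" by simp
    have "t1 > t0"
    proof (rule ccontr)
      assume "\<not> t1 > t0"
      then have "\<bar>x t1\<bar> \<le> \<bar>x y0\<bar>"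
        using y0 t1 by auto
      then show False
        using big by (simp add: S_def)
    qed
    \<comment> \<open>The first time at which the large value is reached replaces an induction over
      successive semicycles, which could not be numbered if zeros accumulate.\<close>
    let ?A = "{t \<in> {t0..t1}. \<bar>x t\<bar> \<in> {\<bar>x t1\<bar>..}}"
    have "closed ?A"
      using t0 \<theta> \<Delta> by (intro continuous_closed_preimage[unfolded vimage_def Int_def, simplified]
          continuous_on_rabs cont) auto
    then have "compact ?A"
      by (auto simp: compact_eq_bounded_closed intro: bounded_subset[OF bounded_closed_interval[of t0 t1]])
    moreover have "?A \<noteq> {}"
      using \<open>t1 > t0\<close> by auto
    ultimately obtain T where T: "T \<in> ?A" "\<forall>t\<in>?A. T \<le> t"
      using compact_attains_inf[of ?A] by blast
    have xT: "\<bar>x t1\<bar> \<le> \<bar>x T\<bar>" "t0 \<le> T" "T \<le> t1"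
      using T(1) by auto
    have below: "\<bar>x y\<bar> < \<bar>x t1\<bar>" if y: "s - \<Delta> \<le> y" "y < T" for y
    proof (cases "y \<le> t0")
      case True
      then have "\<bar>x y\<bar> \<le> \<bar>x y0\<bar>"
        using y0 y by auto
      then show ?thesis
        using big by (simp add: S_def)
    next
      case False
      show ?thesis
      proof (rule ccontr)
        assume "\<not> ?thesis"
        then have "y \<in> ?A"
          using False y xT by auto
        then show False
          using T(2) y by auto
      qed
    qed
    have "x T \<noteq> 0"
      using xT(1) big by (auto simp: S_def)
    obtain a b where ab: "semicycle {s - \<Delta>..} x a b" "t0 \<le> a" "a < T" "T < b"
    proof (rule semicycle_around[of t0 x "{s - \<Delta>..}" T])
      show "continuous_on {t0..} x" "{t0..} \<subseteq> {s - \<Delta>..}"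
        using t0 \<theta> \<Delta> by (auto intro!: cont)
    qed (use t0 osc xT \<open>x T \<noteq> 0\<close> that in auto)
    have sa: "s + vartheta \<Delta> \<le> a"
      using t0 ab by simp
    obtain y where y: "y \<in> {s - \<Delta>..a}" "\<forall>z\<in>{s - \<Delta>..a}. \<bar>x z\<bar> \<le> \<bar>x y\<bar>"
      using attain[of a] sa \<theta> by auto
    have past: "\<And>z. z \<in> {s - \<Delta>..a} \<Longrightarrow> \<bar>x z\<bar> \<le> \<bar>x y\<bar>"
      using y(2) by blast
    have sc: "a < b" "x a = 0" "x b = 0"
      using ab(1) unfolding semicycle_def by auto
    have Tab: "T \<in> {a..b}" "T \<in> {a<..<b}"
      using ab by auto
    have "continuous_on {a..b} x"
      using sa \<theta> \<Delta> by (intro cont) auto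
    from semicycle_sign[OF ab(1) this] have "\<bar>x T\<bar> \<le> \<bar>x y\<bar>"
    proof
      assume pos: "\<forall>t\<in>{a<..<b}. x t > 0"
      then have "x T \<le> \<bar>x y\<bar>"
        by (intro semicycle_bound_preserved[OF \<Delta> di sa sc(1) _ sc(2,3) past short[OF ab(1)] Tab(1)]) auto
      then show ?thesis
        using pos Tab(2) by force
    next
      assume neg: "\<forall>t\<in>{a<..<b}. - x t > 0"
      then have "- x T \<le> \<bar>x y\<bar>"
        using sc past
        by (intro semicycle_bound_preserved[OF \<Delta> delay_inequality_uminus[OF di] sa sc(1) _ _ _ _ short[OF ab(1)] Tab(1)]) auto
      then show ?thesis
        using neg Tab(2) by force
    qed
    moreover have "\<bar>x y\<bar> < \<bar>x t1\<bar>"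
      using y(1) ab by (intro below) auto
    ultimately show False
      using xT(1) by simp
  qed
  then show ?thesis
    by (intro exI[of _ S]) (auto simp: S_def)
qed

lemma strictly_short_semicycles_imp_tendsto_0:
  assumes \<Delta>: "\<Delta> > 0" and di: "delay_inequality \<Delta> s x x'" and osc: "oscillatory x"
    and bound: "0 < S" "\<And>t. t \<ge> s - \<Delta> \<Longrightarrow> \<bar>x t\<bar> \<le> S"
    and c: "c < Psi 1 \<Delta> + vartheta \<Delta>"
    and short: "\<And>a b. semicycle {s - \<Delta>..} x a b \<Longrightarrow> b - a < c"
  shows "(x \<longlongrightarrow> 0) at_top"
proof -
  have \<theta>: "vartheta \<Delta> > 0"
    by (rule vartheta_pos[OF \<Delta>])
  obtain q where q: "0 < q" "q < 1"
    and contract: "\<forall>s x x' a b S t. delay_inequality \<Delta> s x x' \<longrightarrow>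
       s + vartheta \<Delta> \<le> a \<longrightarrow> a < b \<longrightarrow> (\<forall>t\<in>{a<..<b}. x t > 0) \<longrightarrow> x a = 0 \<longrightarrow> x b = 0 \<longrightarrow> 0 < S \<longrightarrow>
       (\<forall>y\<ge>s - \<Delta>. \<bar>x y\<bar> \<le> S) \<longrightarrow> b - a < c \<longrightarrow> t \<in> {a<..<b} \<longrightarrow> x t \<le> q * S"
    using short_semicycles_contract[OF \<Delta> c] by blast
  have decay: "\<exists>T\<ge>s - \<Delta>. \<forall>t\<ge>T. \<bar>x t\<bar> \<le> q ^ n * S" for n
  proof (induction n)
    case 0
    then show ?case using bound(2) by auto
  next
    case (Suc n)
    then obtain T where T: "T \<ge> s - \<Delta>" "\<forall>t\<ge>T. \<bar>x t\<bar> \<le> q ^ n * S"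
      by blast
    \<comment> \<open>Restarting at \<open>T + \<Delta>\<close> makes the history begin at
      \<open>T\<close>, from where the improved bound is known.\<close>
    have di': "delay_inequality \<Delta> (T + \<Delta>) x x'"
      using T by (intro delay_inequality_later[OF di]) simp
    have past: "\<And>y. y \<ge> T + \<Delta> - \<Delta> \<Longrightarrow> \<bar>x y\<bar> \<le> q ^ n * S"
      using T(2) by simp
    have Sn: "0 < q ^ n * S"
      using q bound(1) by simp
    obtain t0 where t0: "t0 \<ge> T + \<Delta> + vartheta \<Delta>" "x t0 = 0"
      using osc unfolding oscillatory_def by blast
    have "\<bar>x t\<bar> \<le> q * (q ^ n * S)" if t: "t \<ge> t0" for t
    proof (cases "x t = 0")
      case True
      then show ?thesis using q Sn by simp
    next
      case False
      obtain a b where ab: "semicycle {s - \<Delta>..} x a b" "t0 \<le> a" "a < t" "t < b"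
      proof (rule semicycle_around[of t0 x "{s - \<Delta>..}" t])
        show "continuous_on {t0..} x" "{t0..} \<subseteq> {s - \<Delta>..}"
          using t0 T \<theta> \<Delta> by (auto intro!: delay_inequality_continuous_on[OF di])
      qed (use t0 osc t False that in auto)
      have sc: "a < b" "x a = 0" "x b = 0"
        using ab(1) unfolding semicycle_def by auto
      have a: "T + \<Delta> + vartheta \<Delta> \<le> a" and tab: "t \<in> {a<..<b}"
        using t0 ab by auto
      have "continuous_on {a..b} x"
        using a T \<theta> \<Delta> by (intro delay_inequality_continuous_on[OF di]) auto
      from semicycle_sign[OF ab(1) this] show ?thesis
      proof
        assume pos: "\<forall>t\<in>{a<..<b}. x t > 0"
        then have "x t \<le> q * (q ^ n * S)"
          by (intro contract[rule_format, OF di' a sc(1) _ sc(2,3) Sn past short[OF ab(1)] tab]) auto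
        then show ?thesis
          using pos tab by force
      next
        assume neg: "\<forall>t\<in>{a<..<b}. - x t > 0"
        then have "- x t \<le> q * (q ^ n * S)"
          using sc past
          by (intro contract[rule_format, OF delay_inequality_uminus[OF di'] a sc(1) _ _ _ Sn _ short[OF ab(1)] tab]) auto
        then show ?thesis
          using neg tab by force
      qed
    qed
    moreover have "t0 \<ge> s - \<Delta>"
      using t0 T \<theta> \<Delta> by simp
    ultimately show ?case
      by (intro exI[of _ t0]) (auto simp: mult.assoc)
  qed
  show ?thesis
  proof (rule tendstoI)
    fix \<epsilon> :: real assume \<epsilon>: "\<epsilon> > 0"
    obtain n where "q ^ n < \<epsilon> / S"
      using real_arch_pow_inv[of "\<epsilon> / S" q] \<epsilon> bound(1) q by auto
    then have n: "q ^ n * S < \<epsilon>"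
      using bound(1) by (simp add: field_simps)
    obtain T where T: "\<forall>t\<ge>T. \<bar>x t\<bar> \<le> q ^ n * S"
      using decay by blast
    show "\<forall>\<^sub>F t in at_top. dist (x t) 0 < \<epsilon>"
      unfolding eventually_at_top_linorder using T n by (intro exI[of _ T]) force
  qed
qed

text \<open>All semicycles are assumed shorter than \<pi> and none can be, so there is no semicycle
  at all: a nonzero value after the first chosen zero would lie in one.\<close>

lemma undelayed_short_semicycles_imp_eventually_0:
  assumes di: "delay_inequality 0 s x x'" and osc: "oscillatory x"
    and short: "\<And>a b. semicycle {s..} x a b \<Longrightarrow> b - a < pi"
  obtains t0 where "t0 \<ge> s" "\<And>t. t \<ge> t0 \<Longrightarrow> x t = 0"
proof -
  obtain t0 where t0: "t0 \<ge> s" "x t0 = 0"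
    using osc unfolding oscillatory_def by blast
  have "x t = 0" if t: "t \<ge> t0" for t
  proof (rule ccontr)
    assume nz: "x t \<noteq> 0"
    obtain a b where ab: "semicycle {s..} x a b" "t0 \<le> a"
    proof (rule semicycle_around[of t0 x "{s..}" t])
      show "continuous_on {t0..} x"
        using t0 by (intro delay_inequality_continuous_on[OF di]) auto
    qed (use t0 osc t nz that in auto)
    have sc: "a < b" "x a = 0" "x b = 0"
      using ab(1) unfolding semicycle_def by auto
    have sa: "s \<le> a"
      using t0 ab by simp
    then have "continuous_on {a..b} x"
      by (intro delay_inequality_continuous_on[OF di]) auto
    from semicycle_sign[OF ab(1) this] show False
    proof
      assume "\<forall>t\<in>{a<..<b}. x t > 0"
      then show False
        using no_semicycle_shorter_than_pi[OF di sa sc(1) short[OF ab(1)]] sc by blast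
    next
      assume "\<forall>t\<in>{a<..<b}. - x t > 0"
      then show False
        using no_semicycle_shorter_than_pi[OF delay_inequality_uminus[OF di] sa sc(1) short[OF ab(1)]] sc
        by simp
    qed
  qed
  then show ?thesis
    using that t0 by blast
qed

theorem theorem14:
  fixes p \<tau> x :: "real \<Rightarrow> real" and s :: real
  defines "\<tau>\<^sub>m \<equiv> tau_max \<tau> s"
  assumes "p \<in> borel_measurable lebesgue"
    and "\<tau> \<in> borel_measurable lebesgue"
    and "\<And>t. 0 \<le> \<tau> t"
    and "esssup lebesgue (\<lambda>t. ereal (\<tau> t)) < \<infinity>"
    and "esssup lebesgue (\<lambda>t. ereal \<bar>p t\<bar>) \<le> 1"
    and "is_solution p \<tau> s x"
    and "oscillatory x"
    and "\<tau>\<^sub>m > 0 \<Longrightarrow>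
           \<forall>a b. semicycle {s - \<tau>\<^sub>m..} x a b \<longrightarrow> b - a \<le> Psi 1 \<tau>\<^sub>m + vartheta \<tau>\<^sub>m"
    and "\<tau>\<^sub>m = 0 \<Longrightarrow> \<forall>a b. semicycle {s - \<tau>\<^sub>m..} x a b \<longrightarrow> b - a < pi"
  shows "bounded (x ` {s - \<tau>\<^sub>m..}) \<and>
         ((\<exists>c. 0 < c \<and> c < Psi 1 \<tau>\<^sub>m + vartheta \<tau>\<^sub>m \<and>
               (\<forall>a b. semicycle {s - \<tau>\<^sub>m..} x a b \<longrightarrow> b - a < c))
          \<longrightarrow> (x \<longlongrightarrow> 0) at_top)"
proof -
  have "0 \<le> \<tau>\<^sub>m"
    unfolding \<tau>\<^sub>m_def by (rule solution_delay_inequality(1)[OF assms(3-7)])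
  obtain x' where di: "delay_inequality \<tau>\<^sub>m s x x'"
    unfolding \<tau>\<^sub>m_def using solution_delay_inequality(2)[OF assms(3-7)] by blast
  show ?thesis
  proof (cases "\<tau>\<^sub>m = 0")
    case True
    have di0: "delay_inequality 0 s x x'"
      using di True by simp
    obtain t0 where t0: "t0 \<ge> s" "\<And>t. t \<ge> t0 \<Longrightarrow> x t = 0"
      using undelayed_short_semicycles_imp_eventually_0[OF di0 assms(8)] assms(10)[OF True] True
      by auto
    have "compact (x ` {s..t0})"
      by (intro compact_continuous_image delay_inequality_continuous_on[OF di0]) auto
    then have "bounded (insert 0 (x ` {s..t0}))"
      by (simp add: compact_imp_bounded)
    moreover have "x t \<in> insert 0 (x ` {s..t0})" if "t \<ge> s" for t
      using t0(2)[of t] that by (cases "t \<le> t0") auto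
    then have "x ` {s - \<tau>\<^sub>m..} \<subseteq> insert 0 (x ` {s..t0})"
      using True by auto
    ultimately have "bounded (x ` {s - \<tau>\<^sub>m..})"
      by (rule bounded_subset)
    moreover have "\<forall>\<^sub>F t in at_top. x t = 0"
      unfolding eventually_at_top_linorder using t0(2) by blast
    then have "(x \<longlongrightarrow> 0) at_top"
      by (rule tendsto_eventually)
    ultimately show ?thesis by blast
  next
    case False
    then have pos: "\<tau>\<^sub>m > 0"
      using \<open>0 \<le> \<tau>\<^sub>m\<close> by simp
    obtain S where S: "S > 0" "\<And>t. t \<ge> s - \<tau>\<^sub>m \<Longrightarrow> \<bar>x t\<bar> \<le> S"
      using short_semicycles_imp_bounded[OF pos di assms(8)] assms(9)[OF pos] by blast
    then have "bounded (x ` {s - \<tau>\<^sub>m..})"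
      unfolding bounded_iff by auto
    then show ?thesis
      using strictly_short_semicycles_imp_tendsto_0[OF pos di assms(8) S] by blast
  qed
qed

end
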